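(* Let $O\subset\mathbb{R}^d$ be open, bounded and convex, let $\mu,\nu$ be Radon probability measures on $\mathbb{R}^d$ such that the closures of their supports are contained in $O$, and let $L\in C_{-\gamma}(\mathbb{R}^+\times\overline{O})$ be non-negative. Then $\mathcal{D}_1(\mu,\nu)=\mathcal{P}_1(\mu,\nu)$.
   Context: $\mathbb{R}^+=\{t\ge0\}$. $\lambda>0$ is the Poincaré constant of $O$ (smallest eigenvalue of $-\frac12\Delta$ on $O$ with Dirichlet boundary conditions), and $\gamma$ is fixed with $0<\gamma<\lambda$. $C_{-\gamma}(\mathbb{R}^+\times\overline{O})$ is the Banach space of continuous $w$ on $\mathbb{R}^+\times\overline{O}$ with $e^{-\gamma t}w(t,x)\to0$ as $t\to\infty$ uniformly in $x$, with norm $\sup|e^{-\gamma t}w|$; its dual $\mathcal{M}_\gamma(\mathbb{R}^+\times\overline{O})$ is the space of finite signed Radon measures with $\gamma$-exponential decay (i.e. $\int e^{\gamma t}d|m|<\infty$). $C^{1,2}_{-\gamma}(\mathbb{R}^+\times\overline{O})$ is the set of functions in $C_{-\gamma}$ whose first time derivative and second space derivatives lie in $C_{-\gamma}(\mathbb{R}^+\times\overline{O})$. A pair $(\eta,\rho)$ is admissible if $\eta,\rho\in\mathcal{M}_\gamma(\mathbb{R}^+\times\overline{O})$, $\eta\ge0$, $\rho\ge0$, $\int_{\overline O}u\,d\nu=\int_{\overline{O}}\int_{\mathbb{R}^+}u(x)\rho(dt,dx)$ for all $u\in C(\overline{O})$, and for all $w\in C^{1,2}_{-\gamma}(\mathbb{R}^+\times\overline{O})$,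 $$-\int_{\overline{O}}w(0,y)\mu(dy)=\int_{\overline{O}}\int_{\mathbb{R}^+}\Big[\partial_tw+\tfrac12\Delta w\Big]\eta(dt,dx)-\int_{\overline{O}}\int_{\mathbb{R}^+}w\,\rho(dt,dx).$$ $$\mathcal{P}_1(\mu,\nu)=\inf\Big\{\int_{\overline{O}}\int_{\mathbb{R}^+}L(t,x)\,\eta(dt,dx):\ (\eta,\rho)\text{ admissible}\Big\}$$ (with value $+\infty$ if there is no admissible pair). $V_\psi[J](t,x)=\min\{J(t,x)-\psi(x),\ -\partial_tJ(t,x)-\frac12\Delta J(t,x)+L(t,x)\}$, and $$\mathcal{D}_1(\mu,\nu)=\sup\Big\{\int\psi\,d\nu-\int J(0,y)\mu(dy):\ \psi\in C(\overline{O}),\ J\in C^{1,2}_{-\gamma}(\mathbb{R}^+\times\overline{O}),\ V_\psi[J]\ge0\text{ on }\mathbb{R}^+\times\overline{O}\Big\}.$$ *)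

theory Defs
  imports "HOL-Probability.Probability"
begin

section \<open>The Poincare constant\<close>

text \<open>\<open>g\<close> is the gradient of the \<open>C\<^sup>1\<close> function \<open>\<phi>\<close>, whose support is a compact subset of \<open>\<Omega>\<close>.\<close>

definition C1_compact :: "'a::euclidean_space set \<Rightarrow> ('a \<Rightarrow> real) \<Rightarrow> ('a \<Rightarrow> 'a) \<Rightarrow> bool" where
  "C1_compact \<Omega> \<phi> g \<longleftrightarrow>
     (\<forall>x. GDERIV \<phi> x :> g x) \<and> continuous_on UNIV g \<and>
     compact (closure {x. \<phi> x \<noteq> 0}) \<and> closure {x. \<phi> x \<noteq> 0} \<subseteq> \<Omega>"

text \<open>\<open>u\<close> belongs to the Sobolev space \<open>H\<^sub>0\<^sup>1(\<Omega>)\<close>, the closure of \<open>C\<^sub>c\<^sup>1(\<Omega>)\<close> in \<open>H\<^sup>1(\<Omega>)\<close>,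
  and \<open>G\<close> is its weak gradient.  That \<open>u\<close> and \<open>G\<close> are square integrable follows, because the
  approximating functions are.\<close>

definition H01 :: "'a::euclidean_space set \<Rightarrow> ('a \<Rightarrow> real) \<Rightarrow> ('a \<Rightarrow> 'a) \<Rightarrow> bool" where
  "H01 \<Omega> u G \<longleftrightarrow>
     u \<in> borel_measurable (lebesgue_on \<Omega>) \<and> G \<in> borel_measurable (lebesgue_on \<Omega>) \<and>
     (\<exists>\<phi> g. (\<forall>n::nat. C1_compact \<Omega> (\<phi> n) (g n)) \<and>
        (\<lambda>n. \<integral>\<^sup>+x. ennreal ((\<phi> n x - u x)\<^sup>2) \<partial>lebesgue_on \<Omega>) \<longlonglongrightarrow> 0 \<and>
        (\<lambda>n. \<integral>\<^sup>+x. ennreal ((norm (g n x - G x))\<^sup>2) \<partial>lebesgue_on \<Omega>) \<longlonglongrightarrow> 0)"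

text \<open>Eigenvalues of \<open>- \<Delta> / 2\<close> on \<open>\<Omega>\<close> with Dirichlet boundary conditions, in the weak sense.\<close>

definition dirichlet_eigenvalue :: "'a::euclidean_space set \<Rightarrow> real \<Rightarrow> bool" where
  "dirichlet_eigenvalue \<Omega> l \<longleftrightarrow>
     (\<exists>u G. H01 \<Omega> u G \<and> \<not> (AE x in lebesgue_on \<Omega>. u x = 0) \<and>
        (\<forall>\<phi> g. C1_compact \<Omega> \<phi> g \<longrightarrow>
           (1/2) * (LINT x|lebesgue_on \<Omega>. G x \<bullet> g x) = l * (LINT x|lebesgue_on \<Omega>. u x * \<phi> x)))"

definition is_poincare_constant :: "'a::euclidean_space set \<Rightarrow> real \<Rightarrow> bool" where
  "is_poincare_constant \<Omega> l \<longleftrightarrow>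
     dirichlet_eigenvalue \<Omega> l \<and> (\<forall>l'. dirichlet_eigenvalue \<Omega> l' \<longrightarrow> l \<le> l')"

section \<open>Weighted function spaces on the space-time cylinder\<close>

abbreviation cyl :: "'a::euclidean_space set \<Rightarrow> (real \<times> 'a) set" where
  "cyl \<Omega> \<equiv> {0..} \<times> closure \<Omega>"

text \<open>Functions on the cylinder are total functions whose values outside it never matter.\<close>

definition C_wt :: "real \<Rightarrow> 'a::euclidean_space set \<Rightarrow> (real \<times> 'a \<Rightarrow> real) set" where
  "C_wt \<gamma> \<Omega> = {w. continuous_on (cyl \<Omega>) w \<and>
     uniform_limit (closure \<Omega>) (\<lambda>t x. exp (- \<gamma> * t) * w (t, x)) (\<lambda>_. 0) at_top}"

text \<open>Derivatives are taken within \<open>{0..}\<close> and within \<open>closure \<Omega>\<close>, so that they also have a meaning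
  at \<open>t = 0\<close> and on the boundary of \<open>\<Omega>\<close>.  They are unique there because \<open>\<Omega>\<close> will be nonempty,
  open and convex.\<close>

definition dt :: "(real \<times> 'a::euclidean_space \<Rightarrow> real) \<Rightarrow> real \<times> 'a \<Rightarrow> real" where
  "dt w = (\<lambda>(t, x). vector_derivative (\<lambda>s. w (s, x)) (at t within {0..}))"

definition dx :: "'a::euclidean_space set \<Rightarrow> 'a \<Rightarrow> (real \<times> 'a \<Rightarrow> real) \<Rightarrow> real \<times> 'a \<Rightarrow> real" where
  "dx \<Omega> i w = (\<lambda>(t, x). frechet_derivative (\<lambda>y. w (t, y)) (at x within closure \<Omega>) i)"

definition laplacian :: "'a::euclidean_space set \<Rightarrow> (real \<times> 'a \<Rightarrow> real) \<Rightarrow> real \<times> 'a \<Rightarrow> real" where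
  "laplacian \<Omega> w p = (\<Sum>i\<in>Basis. dx \<Omega> i (dx \<Omega> i w) p)"

definition C12_wt :: "real \<Rightarrow> 'a::euclidean_space set \<Rightarrow> (real \<times> 'a \<Rightarrow> real) set" where
  "C12_wt \<gamma> \<Omega> = {w \<in> C_wt \<gamma> \<Omega>.
     (\<forall>t\<in>{0..}. \<forall>x\<in>closure \<Omega>.
        (\<lambda>s. w (s, x)) differentiable (at t within {0..}) \<and>
        (\<lambda>y. w (t, y)) differentiable (at x within closure \<Omega>) \<and>
        (\<forall>i\<in>Basis. (\<lambda>y. dx \<Omega> i w (t, y)) differentiable (at x within closure \<Omega>))) \<and>
     dt w \<in> C_wt \<gamma> \<Omega> \<and>
     (\<forall>i\<in>Basis. \<forall>j\<in>Basis. dx \<Omega> i (dx \<Omega> j w) \<in> C_wt \<gamma> \<Omega>)}"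

section \<open>Measures\<close>

definition measure_support :: "'a::topological_space measure \<Rightarrow> 'a set" where
  "measure_support M = {x. \<forall>U. open U \<and> x \<in> U \<longrightarrow> emeasure M U > 0}"

text \<open>The non-negative elements of the dual \<open>\<M>\<^sub>\<gamma>\<close> of \<open>C_wt \<gamma> \<Omega>\<close>.  Non-negative measures are the
  only ones needed.  A finite Borel measure on the cylinder is Radon, and for \<open>\<gamma> > 0\<close> the
  integrability condition entails finiteness.\<close>

definition M_wt_nonneg :: "real \<Rightarrow> 'a::euclidean_space set \<Rightarrow> (real \<times> 'a) measure set" where
  "M_wt_nonneg \<gamma> \<Omega> = {m. sets m = sets (restrict_space borel (cyl \<Omega>)) \<and>
     (\<integral>\<^sup>+p. ennreal (exp (\<gamma> * fst p)) \<partial>m) < \<infinity>}"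

section \<open>Primal and dual values\<close>

definition admissible :: "real \<Rightarrow> 'a::euclidean_space set \<Rightarrow> 'a measure \<Rightarrow> 'a measure \<Rightarrow>
    (real \<times> 'a) measure \<Rightarrow> (real \<times> 'a) measure \<Rightarrow> bool" where
  "admissible \<gamma> \<Omega> \<mu> \<nu> \<eta> \<rho> \<longleftrightarrow>
     \<eta> \<in> M_wt_nonneg \<gamma> \<Omega> \<and> \<rho> \<in> M_wt_nonneg \<gamma> \<Omega> \<and>
     (\<forall>u :: 'a \<Rightarrow> real. continuous_on (closure \<Omega>) u \<longrightarrow>
        (LINT x:closure \<Omega>|\<nu>. u x) = (LINT p|\<rho>. u (snd p))) \<and>
     (\<forall>w\<in>C12_wt \<gamma> \<Omega>.
        - (LINT y:closure \<Omega>|\<mu>. w (0, y)) =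
          (LINT p|\<eta>. dt w p + (1/2) * laplacian \<Omega> w p) - (LINT p|\<rho>. w p))"

definition P1 :: "real \<Rightarrow> 'a::euclidean_space set \<Rightarrow> (real \<times> 'a \<Rightarrow> real) \<Rightarrow>
    'a measure \<Rightarrow> 'a measure \<Rightarrow> ereal" where
  "P1 \<gamma> \<Omega> L \<mu> \<nu> = Inf {ereal (LINT p|\<eta>. L p) | \<eta> \<rho>. admissible \<gamma> \<Omega> \<mu> \<nu> \<eta> \<rho>}"

definition V :: "'a::euclidean_space set \<Rightarrow> (real \<times> 'a \<Rightarrow> real) \<Rightarrow> ('a \<Rightarrow> real) \<Rightarrow>
    (real \<times> 'a \<Rightarrow> real) \<Rightarrow> real \<times> 'a \<Rightarrow> real" where
  "V \<Omega> L \<psi> J p = min (J p - \<psi> (snd p)) (- dt J p - (1/2) * laplacian \<Omega> J p + L p)"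

definition D1 :: "real \<Rightarrow> 'a::euclidean_space set \<Rightarrow> (real \<times> 'a \<Rightarrow> real) \<Rightarrow>
    'a measure \<Rightarrow> 'a measure \<Rightarrow> ereal" where
  "D1 \<gamma> \<Omega> L \<mu> \<nu> =
     Sup {ereal ((LINT x:closure \<Omega>|\<nu>. \<psi> x) - (LINT y:closure \<Omega>|\<mu>. J (0, y))) | \<psi> J.
       continuous_on (closure \<Omega>) \<psi> \<and> J \<in> C12_wt \<gamma> \<Omega> \<and> (\<forall>p\<in>cyl \<Omega>. V \<Omega> L \<psi> J p \<ge> 0)}"

end

theory Submission
  imports Defs "HOL-Complex_Analysis.Great_Picard" "HOL-Library.Diagonal_Subsequence"
begin

text \<open>Weak duality is integration of the dual constraints.  For the converse let \<open>D\<close> be the finite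
  dual value.  On pairs of functions \<open>(J - \<psi>, - \<partial>\<^sub>t J - \<Delta> J / 2 + s L)\<close> the assignment
  \<open>s D + \<integral> J(0, \<cdot>) d\<mu> - \<integral> \<psi> d\<nu>\<close> is a positive linear functional.  M. Riesz extends it
  to all of \<open>C_wt\<close>, provided every function is dominated by an admissible pair, and a Daniell-type
  representation theorem turns the two components of the extension into \<open>\<rho>\<close> and \<open>\<eta>\<close>; \<open>s = 1\<close> says
  that their cost is \<open>D\<close>.

  The dominating pairs are \<open>J(t, x) = e\<^bsup>\<gamma> t\<^esup> \<theta>(t) \<phi>(x)\<close> with \<open>\<theta>\<close> decreasing slowly to zero and
  \<open>\<phi> \<ge> 1\<close> a strict supersolution, \<open>- \<Delta> \<phi> / 2 - \<gamma> \<phi> \<ge> 1\<close> up to the boundary.  If there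
  were no such \<open>\<phi>\<close>, the same extension argument on the closure of \<open>\<Omega>\<close> would yield a measure \<open>\<beta>\<close> with
  \<open>\<Delta> \<beta> / 2 + \<gamma> \<beta> \<ge> 0\<close> in the sense of distributions.  Shrinking it into the convex set \<open>\<Omega>\<close> and
  mollifying gives a test function with Rayleigh quotient less than \<open>l\<close>.  This is impossible, since by
  Rellich compactness the infimum of the Rayleigh quotient is itself an eigenvalue.\<close>

section \<open>Positive extension of linear functionals\<close>

text \<open>One obstacle is the boundary. Test functions need two derivatives continuous up to the
  boundary of \<open>\<Omega>\<close>, where convexity alone gives an eigenfunction no such
  regularity, and the first Dirichlet eigenfunction vanishes there while \<open>\<phi>\<close> must
  stay above 1. Hence \<open>\<phi>\<close> comes from a separation argument; the loss caused by
  pushing the separating measure into \<open>\<Omega>\<close> with a contraction is paid from the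
  gap between \<open>\<gamma>\<close> and \<open>l\<close>, because the rescaled constant
  \<open>\<kappa>\<close> still lies below \<open>l\<close>. The other obstacle is the unbounded
  time axis. The weight e^(\<gamma> t) does not belong to \<open>C_wt\<close>, and elements of
  \<open>C_wt\<close> may decay arbitrarily slowly after weighting. So the profile \<theta> is
  fitted to each function, with \<theta>(0) \<le> 4 c as its only quantitative feature. From this
  follows one estimate: the extended functional is at most C c on any function below c e^(\<gamma>
  t). It gives the Daniell condition for large times, where Dini's theorem does not reach, and also
  the exponential moments of the representing measures.\<close>

definition sublinear_on :: "('i \<Rightarrow> real) set \<Rightarrow> (('i \<Rightarrow> real) \<Rightarrow> real) \<Rightarrow> bool" where
  "sublinear_on E q \<longleftrightarrow> (\<forall>x\<in>E. \<forall>y\<in>E. q (\<lambda>i. x i + y i) \<le> q x + q y) \<and>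
     (\<forall>x\<in>E. \<forall>a>0. q (\<lambda>i. a * x i) \<le> a * q x)"

definition linear_fun_space :: "('i \<Rightarrow> real) set \<Rightarrow> bool" where
  "linear_fun_space E \<longleftrightarrow> (\<forall>x\<in>E. \<forall>y\<in>E. (\<lambda>i. x i + y i) \<in> E) \<and>
     (\<forall>x\<in>E. \<forall>a. (\<lambda>i. a * x i) \<in> E)"

definition linear_functional_on :: "('i \<Rightarrow> real) set \<Rightarrow> (('i \<Rightarrow> real) \<Rightarrow> real) \<Rightarrow> bool" where
  "linear_functional_on E q \<longleftrightarrow> (\<forall>x\<in>E. \<forall>y\<in>E. q (\<lambda>i. x i + y i) = q x + q y) \<and>
     (\<forall>x\<in>E. \<forall>a. q (\<lambda>i. a * x i) = a * q x)"

lemma linear_fun_spaceD: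
  assumes "linear_fun_space E"
  shows "x \<in> E \<Longrightarrow> y \<in> E \<Longrightarrow> (\<lambda>i. x i + y i) \<in> E" "x \<in> E \<Longrightarrow> (\<lambda>i. a * x i) \<in> E"
  using assms by (auto simp: linear_fun_space_def)

lemma sublinear_onD:
  assumes "sublinear_on E q"
  shows "x \<in> E \<Longrightarrow> y \<in> E \<Longrightarrow> q (\<lambda>i. x i + y i) \<le> q x + q y"
    "x \<in> E \<Longrightarrow> 0 < a \<Longrightarrow> q (\<lambda>i. a * x i) \<le> a * q x"
  using assms by (auto simp: sublinear_on_def)

lemma linear_functional_onD:
  assumes "linear_functional_on E q"
  shows "x \<in> E \<Longrightarrow> y \<in> E \<Longrightarrow> q (\<lambda>i. x i + y i) = q x + q y"
    "x \<in> E \<Longrightarrow> q (\<lambda>i. a * x i) = a * q x"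
  using assms by (auto simp: linear_functional_on_def)

text \<open>The definition asks for homogeneity only as an inequality, the half that infima of
  functionals inherit directly. The same inequality with factor \<open>inverse a\<close>, applied at
  the scaled function, yields the other half.\<close>

lemma sublinear_on_scale:
  assumes E: "linear_fun_space E" and q: "sublinear_on E q" and x: "x \<in> E" and a: "a > 0"
  shows "q (\<lambda>i. a * x i) = a * q x"
proof (rule antisym)
  show "q (\<lambda>i. a * x i) \<le> a * q x"
    using q x a by (auto simp: sublinear_on_def)
  have "(\<lambda>i. a * x i) \<in> E" using E x by (auto simp: linear_fun_space_def)
  then have "q (\<lambda>i. inverse a * (a * x i)) \<le> inverse a * q (\<lambda>i. a * x i)"
    using q a by (auto simp: sublinear_on_def)
  moreover have "(\<lambda>i. inverse a * (a * x i)) = x" using a by (auto simp: field_simps)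
  ultimately show "a * q x \<le> q (\<lambda>i. a * x i)" using a by (simp add: field_simps)
qed

lemma sublinear_on_zero:
  assumes E: "linear_fun_space E" and q: "sublinear_on E q" and x: "x \<in> E"
  shows "(\<lambda>i. 0) \<in> E" "q (\<lambda>i. 0) = 0"
proof -
  have "(\<lambda>i. 0 * x i) \<in> E" by (rule linear_fun_spaceD(2)[OF E x])
  then show z: "(\<lambda>i. 0) \<in> E" by simp
  show "q (\<lambda>i. 0) = 0"
    using sublinear_on_scale[OF E q z, of 2] by simp
qed

lemma sublinear_on_minus:
  assumes E: "linear_fun_space E" and q: "sublinear_on E q" and x: "x \<in> E"
  shows "- q (\<lambda>i. - x i) \<le> q x"
proof -
  have "q (\<lambda>i. x i + -1 * x i) \<le> q x + q (\<lambda>i. -1 * x i)"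
    by (intro sublinear_onD(1)[OF q] linear_fun_spaceD(2)[OF E] x)
  then show ?thesis using sublinear_on_zero[OF assms] by simp
qed

text \<open>Lower \<open>q\<close> along a direction \<open>x\<close> by minimising q(z + t x) - t
  q(x) over \<open>t \<ge> 0\<close>. The result is again sublinear and lies below \<open>q\<close>
  (take \<open>t = 0\<close>), so minimality forces equality, and the bound from
  \<open>t = 1\<close> shows that \<open>q\<close> is superadditive as well.\<close>

lemma minimal_sublinear_imp_linear:
  assumes E: "linear_fun_space E" and q: "sublinear_on E q"
    and min: "\<And>q'. sublinear_on E q' \<Longrightarrow> \<forall>x\<in>E. q' x \<le> q x \<Longrightarrow> \<forall>x\<in>E. q' x = q x"
  shows "linear_functional_on E q"
proof -
  have Eadd: "(\<lambda>i. x i + y i) \<in> E" if "x \<in> E" "y \<in> E" for x y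
    using linear_fun_spaceD[OF E] that by blast
  have Esc: "(\<lambda>i. a * x i) \<in> E" if "x \<in> E" for x a
    using linear_fun_spaceD[OF E] that by blast
  have qadd: "q (\<lambda>i. x i + y i) \<le> q x + q y" if "x \<in> E" "y \<in> E" for x y
    using sublinear_onD[OF q] that by blast
  have add: "q (\<lambda>i. z i + x i) = q z + q x" if x: "x \<in> E" and z: "z \<in> E" for x z
  proof -
    define h where "h t z = q (\<lambda>i. z i + t * x i) - t * q x" for t z
    define q' where "q' z = (INF t\<in>{0..}. h t z)" for z
    have scx: "q (\<lambda>i. t * x i) = t * q x" if "t \<ge> 0" for t
      using sublinear_on_scale[OF E q x, of t] sublinear_on_zero[OF E q x] that
      by (cases "t = 0") auto
    \<comment> \<open>The bound is independent of \<open>t\<close>, so the infimum defining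
      \<open>q'\<close> is finite.\<close>
    have lower: "- q (\<lambda>i. - z i) \<le> h t z" if z: "z \<in> E" and t: "t \<ge> 0" for t z
    proof -
      have m: "(\<lambda>i. - z i) \<in> E" using Esc[OF z, of "-1"] by simp
      have "q (\<lambda>i. (z i + t * x i) + - z i) \<le> q (\<lambda>i. z i + t * x i) + q (\<lambda>i. - z i)"
        by (intro qadd Eadd Esc x z m)
      then show ?thesis using scx[OF t] by (simp add: h_def)
    qed
    have bdd: "bdd_below ((\<lambda>t. h t z) ` {0..})" if "z \<in> E" for z
      using lower[OF that] by (auto intro!: bdd_belowI)
    have q'le: "q' z \<le> h t z" if "z \<in> E" "t \<ge> 0" for z t
      unfolding q'_def using bdd[OF that(1)] that(2) by (auto intro!: cINF_lower)
    have q'ge: "c \<le> q' z" if "\<And>t. t \<ge> 0 \<Longrightarrow> c \<le> h t z" for c z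
      unfolding q'_def using that by (intro cINF_greatest) auto
    have sub: "sublinear_on E q'"
      unfolding sublinear_on_def
    proof (intro conjI ballI allI impI)
      fix z1 z2 assume z: "z1 \<in> E" "z2 \<in> E"
      \<comment> \<open>The shifts \<open>t1\<close> and \<open>t2\<close> add up to an admissible
        shift of the sum; the two infima are then taken one after the other.\<close>
      have *: "q' (\<lambda>i. z1 i + z2 i) \<le> h t1 z1 + h t2 z2" if t: "t1 \<ge> 0" "t2 \<ge> 0" for t1 t2
      proof -
        have "q' (\<lambda>i. z1 i + z2 i) \<le> h (t1 + t2) (\<lambda>i. z1 i + z2 i)"
          by (intro q'le Eadd z) (use t in auto)
        also have "\<dots> \<le> h t1 z1 + h t2 z2"
          using qadd[OF Eadd[OF z(1) Esc[OF x, of t1]] Eadd[OF z(2) Esc[OF x, of t2]]]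
          by (simp add: h_def algebra_simps)
        finally show ?thesis .
      qed
      have "q' (\<lambda>i. z1 i + z2 i) - h t1 z1 \<le> q' z2" if "t1 \<ge> 0" for t1
        by (rule q'ge) (use *[OF that] in \<open>simp add: algebra_simps\<close>)
      then have "q' (\<lambda>i. z1 i + z2 i) - q' z2 \<le> q' z1"
        by (intro q'ge) (simp add: algebra_simps)
      then show "q' (\<lambda>i. z1 i + z2 i) \<le> q' z1 + q' z2" by simp
    next
      fix z and a :: real assume z: "z \<in> E" and a: "a > 0"
      have "inverse a * q' (\<lambda>i. a * z i) \<le> h t z" if t: "t \<ge> 0" for t
      proof -
        have "q' (\<lambda>i. a * z i) \<le> h (a * t) (\<lambda>i. a * z i)"
          by (intro q'le Esc z) (use a t in auto)
        also have "\<dots> = a * h t z"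
          using sublinear_on_scale[OF E q Eadd[OF z Esc[OF x, of t]] a]
          by (simp add: h_def algebra_simps)
        finally show ?thesis using a by (simp add: field_simps)
      qed
      then have "inverse a * q' (\<lambda>i. a * z i) \<le> q' z" by (rule q'ge)
      then show "q' (\<lambda>i. a * z i) \<le> a * q' z" using a by (simp add: field_simps)
    qed
    have "\<forall>z\<in>E. q' z \<le> q z"
      using q'le[of _ 0] by (simp add: h_def)
    from min[OF sub this] z have "q z = q' z" by simp
    also have "\<dots> \<le> h 1 z" using q'le[OF z] by simp
    finally have "q z + q x \<le> q (\<lambda>i. z i + x i)" by (simp add: h_def)
    with qadd[OF z x] show ?thesis by simp
  qed
  have "q (\<lambda>i. a * x i) = a * q x" if x: "x \<in> E" for x a
  proof -
    consider "a = 0" | "a > 0" | "a < 0" by linarith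
    then show ?thesis
    proof cases
      case 1 then show ?thesis using sublinear_on_zero[OF E q x] by simp
    next
      case 2 then show ?thesis using sublinear_on_scale[OF E q x] by simp
    next
      case 3
      have "q (\<lambda>i. a * x i + (- a) * x i) = q (\<lambda>i. a * x i) + q (\<lambda>i. (- a) * x i)"
        by (intro add Esc x)
      moreover have "q (\<lambda>i. (- a) * x i) = (- a) * q x"
        by (rule sublinear_on_scale[OF E q x]) (use 3 in simp)
      ultimately show ?thesis using sublinear_on_zero[OF E q x] by simp
    qed
  qed
  with add show ?thesis by (auto simp: linear_functional_on_def)
qed

text \<open>Hahn-Banach with Zorn's lemma applied to the sublinear functionals below
  \<open>p\<close> on all of \<open>E\<close>, instead of to partially defined linear ones: a
  minimal element is linear, so no one-step extension is made.\<close>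

lemma linear_functional_below_sublinear:
  assumes E: "linear_fun_space E" and p: "sublinear_on E p"
  obtains q where "linear_functional_on E q" "\<And>x. x \<in> E \<Longrightarrow> q x \<le> p x"
proof -
  \<comment> \<open>Prescribing the value 0 off \<open>E\<close> lets chains have lower bounds: the
    order compares at all functions, and off \<open>E\<close> nothing else would keep the values
    from decreasing forever.\<close>
  define A where "A = {q. sublinear_on E q \<and> (\<forall>x\<in>E. q x \<le> p x) \<and> (\<forall>x. x \<notin> E \<longrightarrow> q x = 0)}"
  define P where "P a b \<longleftrightarrow> (\<forall>x. b x \<le> a x)" for a b :: "('a \<Rightarrow> real) \<Rightarrow> real"
  have lower: "- p (\<lambda>i. - x i) \<le> q x" if "q \<in> A" "x \<in> E" for q x
  proof -
    have "(\<lambda>i. -1 * x i) \<in> E" by (rule linear_fun_spaceD(2)[OF E that(2)])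
    then have "q (\<lambda>i. - x i) \<le> p (\<lambda>i. - x i)" using that by (auto simp: A_def)
    moreover have "- q (\<lambda>i. - x i) \<le> q x"
      by (rule sublinear_on_minus[OF E _ that(2)]) (use that in \<open>auto simp: A_def\<close>)
    ultimately show ?thesis by simp
  qed
  \<comment> \<open>\<open>P\<close> reverses the pointwise order, so the maximal element of Zorn's
    lemma is a minimal functional.\<close>
  have "\<exists>m\<in>A. \<forall>a\<in>A. P m a \<longrightarrow> a = m"
  proof (rule predicate_Zorn)
    show "partial_order_on A (relation_of P A)"
      by (rule partial_order_on_relation_ofI)
        (auto simp: P_def fun_eq_iff intro: order_trans order.antisym)
  next
    fix C assume C: "C \<in> Chains (relation_of P A)"
    then have CA: "C \<subseteq> A" and cmp: "\<And>a b. a \<in> C \<Longrightarrow> b \<in> C \<Longrightarrow> P a b \<or> P b a"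
      by (auto simp: Chains_def relation_of_def)
    show "\<exists>u\<in>A. \<forall>a\<in>C. P a u"
    proof (cases "C = {}")
      case True
      have "(\<lambda>x. if x \<in> E then p x else 0) \<in> A"
        using p by (simp add: A_def sublinear_on_def linear_fun_spaceD[OF E])
      with True show ?thesis by auto
    next
      case False
      define u where "u x = (INF q\<in>C. q x)" for x
      have bdd: "bdd_below ((\<lambda>q. q x) ` C)" for x
      proof (cases "x \<in> E")
        case True
        then show ?thesis using lower CA by (intro bdd_belowI[of _ "- p (\<lambda>i. - x i)"]) auto
      next
        case False
        then show ?thesis using CA by (intro bdd_belowI[of _ 0]) (auto simp: A_def)
      qed
      have ule: "u x \<le> q x" if "q \<in> C" for q x
        unfolding u_def by (rule cINF_lower[OF bdd that])
      have uge: "c \<le> u x" if "\<And>q. q \<in> C \<Longrightarrow> c \<le> q x" for c x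
        unfolding u_def using that False by (intro cINF_greatest) auto
      have "sublinear_on E u"
        unfolding sublinear_on_def
      proof (intro conjI ballI allI impI)
        fix x y assume xy: "x \<in> E" "y \<in> E"
        have *: "u (\<lambda>i. x i + y i) \<le> q1 x + q2 y" if q12: "q1 \<in> C" "q2 \<in> C" for q1 q2
        proof -
          \<comment> \<open>Of two members of the chain one lies below the other everywhere, so it
            serves both arguments at once.\<close>
          from cmp[OF q12] obtain q where q: "q \<in> C" "q x \<le> q1 x" "q y \<le> q2 y"
            using q12 unfolding P_def by (metis order_refl)
          have "u (\<lambda>i. x i + y i) \<le> q (\<lambda>i. x i + y i)" by (rule ule[OF q(1)])
          also have "\<dots> \<le> q x + q y" using q(1) CA xy by (auto simp: A_def sublinear_on_def)
          finally show ?thesis using q by simp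
        qed
        have "u (\<lambda>i. x i + y i) - q1 x \<le> u y" if "q1 \<in> C" for q1
          by (rule uge) (use *[OF that] in \<open>simp add: algebra_simps\<close>)
        then have "u (\<lambda>i. x i + y i) - u y \<le> u x"
          by (intro uge) (simp add: algebra_simps)
        then show "u (\<lambda>i. x i + y i) \<le> u x + u y" by simp
      next
        fix x and a :: real assume x: "x \<in> E" and a: "a > 0"
        have "inverse a * u (\<lambda>i. a * x i) \<le> q x" if q: "q \<in> C" for q
        proof -
          have "u (\<lambda>i. a * x i) \<le> q (\<lambda>i. a * x i)" by (rule ule[OF q])
          also have "\<dots> \<le> a * q x" using q CA x a by (auto simp: A_def sublinear_on_def)
          finally show ?thesis using a by (simp add: field_simps)
        qed
        then have "inverse a * u (\<lambda>i. a * x i) \<le> u x" by (rule uge)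
        then show "u (\<lambda>i. a * x i) \<le> a * u x" using a by (simp add: field_simps)
      qed
      moreover have "u x \<le> p x" if "x \<in> E" for x
      proof -
        obtain q where q: "q \<in> C" using False by auto
        then have "q x \<le> p x" using CA that by (auto simp: A_def)
        with ule[OF q, of x] show ?thesis by simp
      qed
      moreover have "u x = 0" if "x \<notin> E" for x
      proof (rule antisym)
        obtain q where q: "q \<in> C" using False by auto
        then have "q x = 0" using CA that by (auto simp: A_def)
        then show "u x \<le> 0" using ule[OF q, of x] by simp
        show "0 \<le> u x" using CA that by (intro uge) (auto simp: A_def)
      qed
      ultimately have "u \<in> A" by (simp add: A_def)
      then show ?thesis using ule by (auto simp: P_def)
    qed
  qed
  then obtain q where qA: "q \<in> A" and qmin: "\<And>a. a \<in> A \<Longrightarrow> P q a \<Longrightarrow> a = q" by auto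
  have "linear_functional_on E q"
  proof (rule minimal_sublinear_imp_linear[OF E])
    show "sublinear_on E q" using qA by (simp add: A_def)
    fix q' assume q': "sublinear_on E q'" "\<forall>x\<in>E. q' x \<le> q x"
    let ?q = "\<lambda>x. if x \<in> E then q' x else 0"
    have "sublinear_on E ?q"
      using q'(1) by (simp add: sublinear_on_def linear_fun_spaceD[OF E])
    moreover have "q' x \<le> p x" if "x \<in> E" for x
      using q'(2) qA that unfolding A_def by fastforce
    ultimately have "?q \<in> A" unfolding A_def by auto
    moreover have "P q ?q"
      unfolding P_def
    proof
      fix x
      have "q x = 0" if "x \<notin> E"
        using qA that by (simp add: A_def)
      then show "(if x \<in> E then q' x else 0) \<le> q x" using q'(2) by auto
    qed
    ultimately have "?q = q" by (rule qmin)
    from fun_cong[OF this] have "(if x \<in> E then q' x else 0) = q x" for x .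
    then show "\<forall>x\<in>E. q' x = q x" by presburger
  qed
  then show ?thesis by (rule that) (use qA in \<open>auto simp: A_def\<close>)
qed

text \<open>The absolute value makes the condition symmetric, so negation costs nothing: sums are
  majorized by sums of majorants and multiples by \<open>\<bar>a\<bar>\<close> times a majorant,
  both of which stay in the linear graph \<open>R\<close>.\<close>

lemma linear_fun_space_majorized:
  fixes R :: "(('i \<Rightarrow> real) \<times> real) set" and S :: "'i set"
  assumes add: "\<And>x c y d. (x, c) \<in> R \<Longrightarrow> (y, d) \<in> R \<Longrightarrow> (\<lambda>i. x i + y i, c + d) \<in> R"
    and scale: "\<And>x c a. (x, c) \<in> R \<Longrightarrow> (\<lambda>i. a * x i, a * c) \<in> R"
  shows "linear_fun_space {x. \<exists>(y, c)\<in>R. \<forall>i\<in>S. \<bar>x i\<bar> \<le> y i}" (is "linear_fun_space ?E")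
proof -
  have Eadd: "(\<lambda>i. x i + y i) \<in> ?E" if xy: "x \<in> ?E" "y \<in> ?E" for x y
  proof -
    from xy obtain x' c y' d where *: "(x', c) \<in> R" "(y', d) \<in> R"
      "\<forall>i\<in>S. \<bar>x i\<bar> \<le> x' i" "\<forall>i\<in>S. \<bar>y i\<bar> \<le> y' i" by auto
    then have "\<forall>i\<in>S. \<bar>x i + y i\<bar> \<le> x' i + y' i" by fastforce
    with add[OF *(1,2)] show ?thesis by fastforce
  qed
  have Esc: "(\<lambda>i. a * x i) \<in> ?E" if x: "x \<in> ?E" for x a
  proof -
    from x obtain x' c where *: "(x', c) \<in> R" "\<forall>i\<in>S. \<bar>x i\<bar> \<le> x' i" by auto
    then have "\<forall>i\<in>S. \<bar>a * x i\<bar> \<le> \<bar>a\<bar> * x' i" by (auto simp: abs_mult mult_left_mono)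
    with scale[OF *(1), of "\<bar>a\<bar>"] show ?thesis by fastforce
  qed
  show ?thesis using Eadd Esc unfolding linear_fun_space_def by blast
qed

text \<open>M. Riesz: the partial functional is given by its graph \<open>R\<close>; it is single-valued on \<open>S\<close> because
  of positivity.\<close>

lemma positive_extension:
  fixes R :: "(('i \<Rightarrow> real) \<times> real) set" and S :: "'i set"
  assumes ne: "R \<noteq> {}"
    and add: "\<And>x c y d. (x, c) \<in> R \<Longrightarrow> (y, d) \<in> R \<Longrightarrow> (\<lambda>i. x i + y i, c + d) \<in> R"
    and scale: "\<And>x c a. (x, c) \<in> R \<Longrightarrow> (\<lambda>i. a * x i, a * c) \<in> R"
    and pos: "\<And>x c. (x, c) \<in> R \<Longrightarrow> \<forall>i\<in>S. 0 \<le> x i \<Longrightarrow> 0 \<le> c"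
  defines "E \<equiv> {x. \<exists>(y, c)\<in>R. \<forall>i\<in>S. \<bar>x i\<bar> \<le> y i}"
  obtains \<Lambda> where "linear_functional_on E \<Lambda>"
    "\<And>x. x \<in> E \<Longrightarrow> \<forall>i\<in>S. 0 \<le> x i \<Longrightarrow> 0 \<le> \<Lambda> x"
    "\<And>x c. (x, c) \<in> R \<Longrightarrow> x \<in> E \<Longrightarrow> \<Lambda> x = c"
proof -
  have E: "linear_fun_space E"
    unfolding E_def by (rule linear_fun_space_majorized[OF add scale])
  note Eadd = linear_fun_spaceD(1)[OF E] and Esc = linear_fun_spaceD(2)[OF E]
  \<comment> \<open>These are the values the graph assigns to majorants of \<open>x\<close>; their
    infimum \<open>p\<close> bounds every positive extension at \<open>x\<close> from above, so it
    is the natural sublinear functional to stay below.\<close>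
  define B where "B x = {c. \<exists>y. (y, c) \<in> R \<and> (\<forall>i\<in>S. x i \<le> y i)}" for x
  define p where "p x = Inf (B x)" for x
  have B_ne: "B x \<noteq> {}" if "x \<in> E" for x
    using that by (force simp: E_def B_def)
  \<comment> \<open>A majorant of \<open>x\<close> plus a majorant of \<open>- x\<close> is
    nonnegative on \<open>S\<close>, so \<open>pos\<close> applies to the sum.\<close>
  have lower: "- d \<le> c" if "(y, d) \<in> R" "\<forall>i\<in>S. - x i \<le> y i" "c \<in> B x" for x y c d
  proof -
    from that(3) obtain z where z: "(z, c) \<in> R" "\<forall>i\<in>S. x i \<le> z i" by (auto simp: B_def)
    have "0 \<le> z i + y i" if "i \<in> S" for i
      using z(2) \<open>\<forall>i\<in>S. - x i \<le> y i\<close> that by (metis add.commute add_mono minus_add_cancel add.right_inverse)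
    with pos[OF add[OF z(1) that(1)]] show ?thesis by simp
  qed
  have B_bdd: "bdd_below (B x)" if x: "x \<in> E" for x
  proof -
    from x obtain y d where "(y, d) \<in> R" "\<forall>i\<in>S. \<bar>x i\<bar> \<le> y i" by (auto simp: E_def)
    then have "\<forall>i\<in>S. - x i \<le> y i" by fastforce
    from lower[OF \<open>(y, d) \<in> R\<close> this] show ?thesis by (rule bdd_belowI)
  qed
  have ple: "p x \<le> c" if "x \<in> E" "(y, c) \<in> R" "\<forall>i\<in>S. x i \<le> y i" for x y c
    unfolding p_def using that B_bdd by (intro cInf_lower) (auto simp: B_def)
  have pge: "d \<le> p x" if "x \<in> E" "\<And>y c. (y, c) \<in> R \<Longrightarrow> \<forall>i\<in>S. x i \<le> y i \<Longrightarrow> d \<le> c" for x d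
    unfolding p_def using that B_ne by (intro cInf_greatest) (auto simp: B_def)
  have "sublinear_on E p"
    unfolding sublinear_on_def
  proof (intro conjI ballI allI impI)
    fix x y assume xy: "x \<in> E" "y \<in> E"
    have *: "p (\<lambda>i. x i + y i) \<le> c + d"
      if "(x', c) \<in> R" "(y', d) \<in> R" "\<forall>i\<in>S. x i \<le> x' i" "\<forall>i\<in>S. y i \<le> y' i" for x' y' c d
      by (rule ple[OF Eadd[OF xy] add[OF that(1,2)]]) (use that in \<open>auto intro: add_mono\<close>)
    have "p (\<lambda>i. x i + y i) - c \<le> p y"
      if "(x', c) \<in> R" "\<forall>i\<in>S. x i \<le> x' i" for x' c
      by (rule pge[OF xy(2)]) (use *[OF that(1) _ that(2)] in \<open>force simp: algebra_simps\<close>)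
    then have "p (\<lambda>i. x i + y i) - p y \<le> p x"
      by (intro pge[OF xy(1)]) (force simp: algebra_simps)
    then show "p (\<lambda>i. x i + y i) \<le> p x + p y" by simp
  next
    fix x and a :: real assume x: "x \<in> E" and a: "a > 0"
    have "inverse a * p (\<lambda>i. a * x i) \<le> c" if yc: "(y, c) \<in> R" "\<forall>i\<in>S. x i \<le> y i" for y c
    proof -
      have "p (\<lambda>i. a * x i) \<le> a * c"
        by (rule ple[OF Esc[OF x] scale[OF yc(1)]]) (use yc a in auto)
      then show ?thesis using a by (simp add: field_simps)
    qed
    then have "inverse a * p (\<lambda>i. a * x i) \<le> p x" by (rule pge[OF x])
    then show "p (\<lambda>i. a * x i) \<le> a * p x" using a by (simp add: field_simps)
  qed
  then obtain \<Lambda> where \<Lambda>: "linear_functional_on E \<Lambda>" and \<Lambda>p: "\<And>x. x \<in> E \<Longrightarrow> \<Lambda> x \<le> p x"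
    using linear_functional_below_sublinear[OF E] by blast
  have neg: "\<Lambda> (\<lambda>i. - x i) = - \<Lambda> x" if "x \<in> E" for x
  proof -
    have "\<Lambda> (\<lambda>i. -1 * x i) = -1 * \<Lambda> x" by (rule linear_functional_onD(2)[OF \<Lambda> that])
    then show ?thesis by simp
  qed
  have zero: "(\<lambda>i. 0, 0) \<in> R" using ne scale[of _ _ 0] by fastforce
  have Em: "(\<lambda>i. - x i) \<in> E" if "x \<in> E" for x using Esc[OF that, of "-1"] by simp
  \<comment> \<open>If \<open>x\<close> is nonnegative on \<open>S\<close>, the zero element of
    \<open>R\<close> majorizes \<open>- x\<close> at value 0.\<close>
  have "0 \<le> \<Lambda> x" if "x \<in> E" "\<forall>i\<in>S. 0 \<le> x i" for x
    using \<Lambda>p[OF Em[OF that(1)]] ple[OF Em[OF that(1)] zero] neg[OF that(1)] that(2) by simp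
  \<comment> \<open>An element of the graph is its own majorant, and so is its negative; the two
    resulting bounds by \<open>p\<close> meet at \<open>c\<close>.\<close>
  moreover have "\<Lambda> x = c" if "(x, c) \<in> R" "x \<in> E" for x c
  proof (rule antisym)
    show "\<Lambda> x \<le> c" using \<Lambda>p[OF that(2)] ple[OF that(2,1)] by simp
    have "p (\<lambda>i. - x i) \<le> - c"
      using ple[OF Em[OF that(2)] scale[OF that(1), of "-1"]] by simp
    then show "c \<le> \<Lambda> x" using \<Lambda>p[OF Em[OF that(2)]] neg[OF that(2)] by simp
  qed
  ultimately show ?thesis by (rule that[OF \<Lambda>])
qed

section \<open>Representation of Daniell functionals by measures\<close>

text \<open>Functions are total, but only their values on \<open>K\<close> count:
  \<open>solid\<close>, \<open>pos\<close> and \<open>null_limit\<close> all compare on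
  \<open>K\<close>. The condition \<open>null_limit\<close> stands in for compactness of
  \<open>K\<close>, which the cylinder lacks. Solidity keeps truncations and products with cut-offs
  inside \<open>E\<close>.\<close>

locale daniell =
  fixes K :: "'b::metric_space set" and E :: "('b \<Rightarrow> real) set" and \<Lambda> :: "('b \<Rightarrow> real) \<Rightarrow> real"
  assumes space: "linear_fun_space E"
    and cont: "f \<in> E \<Longrightarrow> continuous_on K f"
    and one: "(\<lambda>_. 1) \<in> E"
    and solid: "f \<in> E \<Longrightarrow> continuous_on K g \<Longrightarrow> \<forall>x\<in>K. \<bar>g x\<bar> \<le> \<bar>f x\<bar> \<Longrightarrow> g \<in> E"
    and lin: "linear_functional_on E \<Lambda>"
    and pos: "f \<in> E \<Longrightarrow> \<forall>x\<in>K. 0 \<le> f x \<Longrightarrow> 0 \<le> \<Lambda> f"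
    and null_limit: "(\<And>n. u n \<in> E) \<Longrightarrow> (\<And>n x. x \<in> K \<Longrightarrow> u (Suc n) x \<le> u n x) \<Longrightarrow>
      (\<And>x. x \<in> K \<Longrightarrow> (\<lambda>n. u n x) \<longlonglongrightarrow> 0) \<Longrightarrow> (\<lambda>n. \<Lambda> (u n)) \<longlonglongrightarrow> 0"
begin

lemmas add = linear_functional_onD(1)[OF lin] and scale = linear_functional_onD(2)[OF lin]
lemmas E_add = linear_fun_spaceD(1)[OF space] and E_scale = linear_fun_spaceD(2)[OF space]

lemma E_diff: "f \<in> E \<Longrightarrow> g \<in> E \<Longrightarrow> (\<lambda>x. f x - g x) \<in> E"
  using E_add[of f "\<lambda>x. -1 * g x"] E_scale[of g "-1"] by simp

lemma diff: "f \<in> E \<Longrightarrow> g \<in> E \<Longrightarrow> \<Lambda> (\<lambda>x. f x - g x) = \<Lambda> f - \<Lambda> g"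
  using add[of f "\<lambda>x. -1 * g x"] E_scale[of g "-1"] scale[of g "-1"] by simp

lemma E_const: "(\<lambda>_. c) \<in> E"
  using E_scale[OF one, of c] by simp

lemma const: "\<Lambda> (\<lambda>_. c) = c * \<Lambda> (\<lambda>_. 1)"
  using scale[OF one, of c] by simp

lemma mono: "f \<in> E \<Longrightarrow> g \<in> E \<Longrightarrow> \<forall>x\<in>K. f x \<le> g x \<Longrightarrow> \<Lambda> f \<le> \<Lambda> g"
  using pos[OF E_diff[of g f]] diff[of g f] by simp

lemma cong: "f \<in> E \<Longrightarrow> g \<in> E \<Longrightarrow> \<forall>x\<in>K. f x = g x \<Longrightarrow> \<Lambda> f = \<Lambda> g"
  by (intro antisym mono) auto

lemma E_sum: "finite I \<Longrightarrow> (\<And>i. i \<in> I \<Longrightarrow> F i \<in> E) \<Longrightarrow> (\<lambda>x. \<Sum>i\<in>I. F i x) \<in> E"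
  by (induction I rule: finite_induct) (auto intro: E_const E_add)

lemma sum: "finite I \<Longrightarrow> (\<And>i. i \<in> I \<Longrightarrow> F i \<in> E) \<Longrightarrow> \<Lambda> (\<lambda>x. \<Sum>i\<in>I. F i x) = (\<Sum>i\<in>I. \<Lambda> (F i))"
proof (induction I rule: finite_induct)
  case empty then show ?case using const[of 0] by simp
next
  case (insert i I)
  then show ?case using add[of "F i" "\<lambda>x. \<Sum>i\<in>I. F i x"] E_sum[of I F] by simp
qed

text \<open>The positive part of \<open>f\<close> minus the partial sums decreases to 0 on
  \<open>K\<close>, so \<open>null_limit\<close> lets finite subadditivity pass to the limit. This
  is the only route by which the Daniell condition gives lower bounds for the outer measure.\<close>

lemma le_suminf:
  assumes f: "f \<in> E" and F: "\<And>n. F n \<in> E" and F0: "\<And>n x. x \<in> K \<Longrightarrow> 0 \<le> F n x"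
    and le: "\<And>x. x \<in> K \<Longrightarrow> ennreal (f x) \<le> (\<Sum>n. ennreal (F n x))"
  shows "ennreal (\<Lambda> f) \<le> (\<Sum>n. ennreal (\<Lambda> (F n)))"
proof -
  define S where "S N x = (\<Sum>n<N. F n x)" for N x
  \<comment> \<open>Cutting off at 0 keeps \<open>g N\<close> between 0 and
    \<open>\<bar>f\<bar>\<close> on \<open>K\<close>, so \<open>solid\<close> places it in
    \<open>E\<close>.\<close>
  define g where "g N x = max 0 (f x - S N x)" for N x
  have SE: "S N \<in> E" for N
    using E_sum[of "{..<N}" F] F by (simp add: S_def[abs_def])
  have S0: "0 \<le> S N x" if "x \<in> K" for N x
    using F0[OF that] by (auto simp: S_def intro: sum_nonneg)
  have gE: "g N \<in> E" for N
  proof (rule solid[OF f])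
    show "continuous_on K (g N)"
      unfolding g_def by (intro continuous_intros cont[OF f] cont[OF SE])
    show "\<forall>x\<in>K. \<bar>g N x\<bar> \<le> \<bar>f x\<bar>"
    proof
      fix x assume "x \<in> K"
      from S0[OF this, of N] show "\<bar>g N x\<bar> \<le> \<bar>f x\<bar>" by (simp add: g_def)
    qed
  qed
  have "(\<lambda>N. \<Lambda> (g N)) \<longlonglongrightarrow> 0"
  proof (rule null_limit[OF gE])
    fix n x assume x: "x \<in> K"
    show "g (Suc n) x \<le> g n x" using F0[OF x, of n] by (auto simp: g_def S_def)
  next
    fix x assume x: "x \<in> K"
    show "(\<lambda>n. g n x) \<longlonglongrightarrow> 0"
    proof (rule order_tendstoI)
      fix a :: real assume "a < 0"
      then show "\<forall>\<^sub>F n in sequentially. a < g n x" by (intro always_eventually) (auto simp: g_def)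
    next
      fix a :: real assume a: "0 < a"
      show "\<forall>\<^sub>F n in sequentially. g n x < a"
      proof (cases "f x < a")
        case True
        then show ?thesis using a S0[OF x]
          by (intro always_eventually) (auto simp: g_def intro: le_less_trans[rotated])
      next
        case False
        then have "ennreal (f x - a) < ennreal (f x)" using a by (simp add: ennreal_less_iff)
        also note le[OF x]
        finally have "ennreal (f x - a) < (\<Sum>n. ennreal (F n x))" .
        moreover have "(\<lambda>n. \<Sum>i<n. ennreal (F i x)) \<longlonglongrightarrow> (\<Sum>n. ennreal (F n x))"
          by (rule summable_LIMSEQ) simp
        ultimately have "\<forall>\<^sub>F n in sequentially. ennreal (f x - a) < (\<Sum>i<n. ennreal (F i x))"
          by (simp add: order_tendsto_iff)
        then show ?thesis
        proof eventually_elim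
          case (elim n)
          then have "ennreal (f x - a) < ennreal (S n x)" using F0[OF x] by (simp add: S_def)
          then have "f x - a < S n x" using False by (simp add: ennreal_less_iff)
          then show ?case using a by (simp add: g_def)
        qed
      qed
    qed
  qed
  then have "(\<lambda>N. ennreal (\<Lambda> (g N)) + (\<Sum>n. ennreal (\<Lambda> (F n)))) \<longlonglongrightarrow> ennreal 0 + (\<Sum>n. ennreal (\<Lambda> (F n)))"
    by (intro tendsto_add tendsto_ennrealI tendsto_const)
  moreover have "ennreal (\<Lambda> f) \<le> ennreal (\<Lambda> (g N)) + (\<Sum>n. ennreal (\<Lambda> (F n)))" for N
  proof -
    have "\<Lambda> f \<le> \<Lambda> (\<lambda>x. g N x + S N x)"
      by (intro mono f E_add gE SE) (auto simp: g_def)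
    also have "\<dots> = \<Lambda> (g N) + (\<Sum>n<N. \<Lambda> (F n))"
      using add[OF gE SE] sum[of "{..<N}" F] F by (simp add: S_def[abs_def])
    finally have "ennreal (\<Lambda> f) \<le> ennreal (\<Lambda> (g N) + (\<Sum>n<N. \<Lambda> (F n)))" by (rule ennreal_leI)
    also have "\<dots> = ennreal (\<Lambda> (g N)) + (\<Sum>n<N. ennreal (\<Lambda> (F n)))"
      using pos[OF F] F0 pos[OF gE] by (subst ennreal_plus) (auto simp: g_def intro!: sum_nonneg)
    also have "\<dots> \<le> ennreal (\<Lambda> (g N)) + (\<Sum>n. ennreal (\<Lambda> (F n)))"
      by (intro add_left_mono sum_le_suminf) auto
    finally show ?thesis .
  qed
  ultimately have "ennreal (\<Lambda> f) \<le> ennreal 0 + (\<Sum>n. ennreal (\<Lambda> (F n)))"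
    by (intro LIMSEQ_le_const) auto
  then show ?thesis by simp
qed

section \<open>The outer measure of a Daniell functional\<close>

definition covers :: "'b set \<Rightarrow> (nat \<Rightarrow> 'b \<Rightarrow> real) \<Rightarrow> bool" where
  "covers A F \<longleftrightarrow> (\<forall>n. F n \<in> E \<and> (\<forall>x\<in>K. 0 \<le> F n x)) \<and> (\<forall>x\<in>A. 1 \<le> (\<Sum>n. ennreal (F n x)))"

text \<open>Coverings are countable families rather than single functions. Countable subadditivity
  is then a matter of reindexing a double sequence, and the increments of a monotone sequence of
  functions may serve as a covering.\<close>

definition \<mu> :: "'b set \<Rightarrow> ennreal" where
  "\<mu> A = (INF F\<in>Collect (covers A). \<Sum>n. ennreal (\<Lambda> (F n)))"

lemma \<mu>_le: "covers A F \<Longrightarrow> \<mu> A \<le> (\<Sum>n. ennreal (\<Lambda> (F n)))"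
  unfolding \<mu>_def by (auto intro: INF_lower)

lemma \<mu>_ge: "(\<And>F. covers A F \<Longrightarrow> c \<le> (\<Sum>n. ennreal (\<Lambda> (F n)))) \<Longrightarrow> c \<le> \<mu> A"
  unfolding \<mu>_def by (auto intro: INF_greatest)

lemma \<mu>_le_single:
  assumes f: "f \<in> E" "\<forall>x\<in>K. 0 \<le> f x" "\<forall>x\<in>A. 1 \<le> f x"
  shows "\<mu> A \<le> ennreal (\<Lambda> f)"
proof -
  define F where "F n = (if n = 0 then f else (\<lambda>_. 0))" for n :: nat
  have Fx: "ennreal (F n x) = (if n = 0 then ennreal (f x) else 0)" for n x by (simp add: F_def)
  have "(\<Sum>n. ennreal (F n x)) = ennreal (f x)" for x
    unfolding Fx by (subst suminf_finite[of "{0}"]) auto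
  then have "covers A F"
    using f E_const[of 0] by (auto simp: covers_def F_def)
  from \<mu>_le[OF this] have "\<mu> A \<le> (\<Sum>n. ennreal (\<Lambda> (F n)))" .
  also have "\<dots> = ennreal (\<Lambda> f)"
    using const[of 0] by (subst suminf_finite[of "{0}"]) (auto simp: F_def)
  finally show ?thesis .
qed

lemma \<mu>_mono: "A \<subseteq> B \<Longrightarrow> \<mu> A \<le> \<mu> B"
  by (intro \<mu>_ge \<mu>_le) (auto simp: covers_def)

lemma covers_prod_decode:
  assumes F: "\<And>i. covers (A i) (F i)"
  shows "covers (\<Union>i. A i) (\<lambda>n. F (fst (prod_decode n)) (snd (prod_decode n)))"
    and "(\<Sum>n. ennreal (\<Lambda> (F (fst (prod_decode n)) (snd (prod_decode n))))) =
      (\<Sum>i. \<Sum>n. ennreal (\<Lambda> (F i n)))"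
proof -
  show "(\<Sum>n. ennreal (\<Lambda> (F (fst (prod_decode n)) (snd (prod_decode n))))) =
      (\<Sum>i. \<Sum>n. ennreal (\<Lambda> (F i n)))"
    using suminf_ennreal_2dimen[of "\<lambda>i. \<Sum>n. ennreal (\<Lambda> (F i n))" "\<lambda>(i, n). ennreal (\<Lambda> (F i n))"]
    by (simp add: case_prod_beta)
  have "1 \<le> (\<Sum>n. ennreal (F (fst (prod_decode n)) (snd (prod_decode n)) x))" if "x \<in> A i" for x i
  proof -
    have "1 \<le> (\<Sum>n. ennreal (F i n x))" using F[of i] that by (auto simp: covers_def)
    also have "\<dots> \<le> (\<Sum>i. \<Sum>n. ennreal (F i n x))"
      using sum_le_suminf[of "\<lambda>i. \<Sum>n. ennreal (F i n x)" "{i}"] by simp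
    also have "\<dots> = (\<Sum>n. ennreal (F (fst (prod_decode n)) (snd (prod_decode n)) x))"
      using suminf_ennreal_2dimen[of "\<lambda>i. \<Sum>n. ennreal (F i n x)" "\<lambda>(i, n). ennreal (F i n x)"]
      by (simp add: case_prod_beta)
    finally show ?thesis .
  qed
  then show "covers (\<Union>i. A i) (\<lambda>n. F (fst (prod_decode n)) (snd (prod_decode n)))"
    using F by (auto simp: covers_def)
qed

lemma outer: "outer_measure_space (Pow K) \<mu>"
  unfolding outer_measure_space_def
proof (intro conjI)
  have "\<mu> {} \<le> ennreal (\<Lambda> (\<lambda>_. 0))" by (rule \<mu>_le_single) (auto intro: E_const)
  then show "positive (Pow K) \<mu>" using const[of 0] by (simp add: positive_def)
  show "increasing (Pow K) \<mu>" by (auto simp: increasing_def intro: \<mu>_mono)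
  show "countably_subadditive (Pow K) \<mu>"
    unfolding countably_subadditive_def
  proof (intro allI impI)
    fix A :: "nat \<Rightarrow> 'b set"
    show "\<mu> (\<Union>i. A i) \<le> (\<Sum>i. \<mu> (A i))"
    proof (rule ennreal_le_epsilon)
      fix e :: real assume e: "0 < e" and fin: "(\<Sum>i. \<mu> (A i)) < top"
      have "\<exists>F. covers (A i) F \<and> (\<Sum>n. ennreal (\<Lambda> (F n))) \<le> \<mu> (A i) + ennreal (e * (1/2)^Suc i)" for i
      proof (rule ccontr)
        assume no: "\<not> ?thesis"
        have "\<mu> (A i) + ennreal (e * (1/2)^Suc i) \<le> \<mu> (A i)"
          by (rule \<mu>_ge) (use no in \<open>force simp: not_le\<close>)
        moreover have "\<mu> (A i) < top"
          using fin sum_le_suminf[of "\<lambda>i. \<mu> (A i)" "{i}"] by (simp add: less_top[symmetric] top_unique)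
            (metis top_unique)
        moreover have "0 < e * (1/2)^i" using e by simp
        ultimately show False
          by (cases "\<mu> (A i)") (auto simp flip: ennreal_plus simp: ennreal_le_iff not_le)
      qed
      then obtain F where F: "\<And>i. covers (A i) (F i)"
        "\<And>i. (\<Sum>n. ennreal (\<Lambda> (F i n))) \<le> \<mu> (A i) + ennreal (e * (1/2)^Suc i)" by metis
      have "\<mu> (\<Union>i. A i) \<le> (\<Sum>i. \<Sum>n. ennreal (\<Lambda> (F i n)))"
        using \<mu>_le[OF covers_prod_decode(1)[OF F(1)]] covers_prod_decode(2)[OF F(1)] by simp
      also have "\<dots> \<le> (\<Sum>i. \<mu> (A i) + ennreal (e * (1/2)^Suc i))"
        by (intro suminf_le F(2)) auto
      also have "\<dots> = (\<Sum>i. \<mu> (A i)) + (\<Sum>i. ennreal (e * (1/2)^Suc i))"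
        by (intro suminf_add[symmetric]) auto
      also have "(\<Sum>i. ennreal (e * (1/2)^Suc i)) = ennreal e"
      proof -
        have "(\<lambda>i. e * (1/2)^Suc i) sums (e * 1)" by (intro sums_mult power_half_series)
        then show ?thesis using e by (subst suminf_ennreal_eq) auto
      qed
      finally show "\<mu> (\<Union>i. A i) \<le> (\<Sum>i. \<mu> (A i)) + ennreal e" .
    qed
  qed
qed

lemma \<mu>_add_le: "\<mu> (A \<union> B) \<le> \<mu> A + \<mu> B" if "A \<subseteq> K" "B \<subseteq> K" "A \<inter> B = {}"
proof -
  interpret algebra K "Pow K" by (rule algebra_Pow)
  have "subadditive (Pow K) \<mu>"
    using outer unfolding outer_measure_space_def by (intro countably_subadditive_subadditive) auto
  from subadditiveD[OF this that(3)] that show ?thesis by auto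
qed

text \<open>Continuous cut-offs \<open>u k\<close> increase to the indicator of \<open>U\<close>. A
  covering \<open>F\<close> of \<open>B\<close> splits into \<open>F n * u k\<close> and the rest.
  The rest covers \<open>B - U\<close> for every \<open>k\<close>, and the increments in
  \<open>k\<close> of the first part together cover \<open>B \<inter> U\<close> at the cost given by
  the supremum over \<open>k\<close>.\<close>

lemma open_in_lambda_system:
  assumes U: "open U"
  shows "K \<inter> U \<in> lambda_system K (Pow K) \<mu>"
\<comment> \<open>The whole space is treated apart because the distance to an empty complement is 0
  by convention, which would make every cut-off vanish.\<close>
proof (cases "U = UNIV")
  case True
  have "\<mu> {} = 0" using outer by (auto simp: outer_measure_space_def positive_def)
  then show ?thesis using True by (auto simp: lambda_system_def Int_absorb1)
next
  case False
  define u where "u k x = min 1 (real k * infdist x (- U))" for k x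
  have u01: "0 \<le> u k x" "u k x \<le> 1" for k x by (auto simp: u_def infdist_nonneg)
  have u_mono: "u k x \<le> u (Suc k) x" for k x
    by (auto simp: u_def infdist_nonneg algebra_simps min.coboundedI2)
  have u_cont: "continuous_on K (u k)" for k
    unfolding u_def by (intro continuous_intros)
  have u_out: "u k x = 0" if "x \<notin> U" for k x
    using that by (simp add: u_def)
  have u_in: "\<exists>k0. \<forall>k\<ge>k0. u k x = 1" if "x \<in> U" for x
  proof -
    have "closed (- U)" using U by (rule closed_Compl)
    with False that have "infdist x (- U) \<noteq> 0"
      by (subst in_closed_iff_infdist_zero[symmetric]) auto
    then have i: "0 < infdist x (- U)" using infdist_nonneg[of x "-U"] by simp
    then obtain k0 :: nat where "1 < real k0 * infdist x (- U)" using reals_Archimedean3 by blast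
    then have "u k x = 1" if "k \<ge> k0" for k
    proof -
      have "real k0 * infdist x (- U) \<le> real k * infdist x (- U)"
        using that i by (intro mult_right_mono) auto
      then show ?thesis using \<open>1 < real k0 * infdist x (- U)\<close> by (simp add: u_def)
    qed
    then show ?thesis by blast
  qed
  have "\<mu> (B \<inter> U) + \<mu> (B - U) \<le> \<mu> B" if B: "B \<subseteq> K" for B
  proof (rule \<mu>_ge)
    fix F assume F: "covers B F"
    then have FE: "F n \<in> E" and F0: "x \<in> K \<Longrightarrow> 0 \<le> F n x" for n x by (auto simp: covers_def)
    have FuE: "(\<lambda>x. F n x * u k x) \<in> E" for n k
    proof (rule solid[OF FE])
      show "continuous_on K (\<lambda>x. F n x * u k x)" by (intro continuous_intros u_cont cont[OF FE])
      show "\<forall>x\<in>K. \<bar>F n x * u k x\<bar> \<le> \<bar>F n x\<bar>"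
        using u01 by (auto simp: abs_mult intro!: mult_left_le)
    qed
    define a where "a n k = \<Lambda> (\<lambda>x. F n x * u k x)" for n k
    have a_mono: "a n k \<le> a n (Suc k)" for n k
      unfolding a_def using u_mono F0 by (intro mono FuE) (auto intro: mult_left_mono)
    have a_ge0: "0 \<le> a n k" for n k
      unfolding a_def by (intro pos FuE) (auto simp: F0 u01)
    have a_le: "a n k \<le> \<Lambda> (F n)" for n k
      unfolding a_def using F0 u01 by (intro mono FuE FE) (auto intro: mult_left_le)
    define c where "c n = (SUP k. ennreal (a n k))" for n
    have inside: "\<mu> (B \<inter> U) \<le> (\<Sum>n. c n)"
    proof -
      \<comment> \<open>telescoping: \<open>1\<^sub>U\<close> is the sum of the increments of the \<open>u k\<close>\<close>
      define G where "G n k x = F n x * (u (Suc k) x - u k x)" for n k x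
      have GE: "G n k \<in> E" for n k
        using E_diff[OF FuE[of n "Suc k"] FuE[of n k]] by (simp add: G_def[abs_def] algebra_simps)
      have G0: "x \<in> K \<Longrightarrow> 0 \<le> G n k x" for n k x
        using F0 u_mono by (auto simp: G_def)
      have sumG: "(\<Sum>k. ennreal (G n k x)) = ennreal (F n x)" if x: "x \<in> B \<inter> U" for n x
      proof -
        have "(\<lambda>k. u k x) \<longlonglongrightarrow> 1"
          using u_in[of x] x unfolding eventually_sequentially[symmetric] by (auto intro: tendsto_eventually)
        from telescope_sums[OF this] have "(\<lambda>k. u (Suc k) x - u k x) sums 1" by (simp add: u_def)
        from sums_mult[OF this, of "F n x"] have "(\<lambda>k. G n k x) sums F n x" by (simp add: G_def)
        then show ?thesis using G0[of x n] x B by (intro suminf_ennreal_eq) auto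
      qed
      define H where "H m = G (fst (prod_decode m)) (snd (prod_decode m))" for m
      have "covers (B \<inter> U) H"
        unfolding covers_def
      proof (intro conjI allI ballI)
        fix x assume x: "x \<in> B \<inter> U"
        have "(\<Sum>m. ennreal (H m x)) = (\<Sum>n. \<Sum>k. ennreal (G n k x))"
          using suminf_ennreal_2dimen[of "\<lambda>n. \<Sum>k. ennreal (G n k x)" "\<lambda>(n, k). ennreal (G n k x)"]
          by (simp add: H_def case_prod_beta)
        also have "\<dots> = (\<Sum>n. ennreal (F n x))" using sumG[OF x] by simp
        finally show "1 \<le> (\<Sum>m. ennreal (H m x))" using F x by (auto simp: covers_def)
      qed (auto simp: H_def GE G0)
      from \<mu>_le[OF this] have "\<mu> (B \<inter> U) \<le> (\<Sum>m. ennreal (\<Lambda> (H m)))" .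
      also have "\<dots> = (\<Sum>n. \<Sum>k. ennreal (\<Lambda> (G n k)))"
        using suminf_ennreal_2dimen[of "\<lambda>n. \<Sum>k. ennreal (\<Lambda> (G n k))" "\<lambda>(n, k). ennreal (\<Lambda> (G n k))"]
        by (simp add: H_def case_prod_beta)
      also have "\<dots> \<le> (\<Sum>n. c n)"
      proof (intro suminf_le)
        fix n
        have \<Lambda>G: "\<Lambda> (G n k) = a n (Suc k) - a n k" for k
          using diff[OF FuE[of n "Suc k"] FuE[of n k]] by (simp add: G_def[abs_def] a_def algebra_simps)
        have "(\<Sum>k<m. ennreal (\<Lambda> (G n k))) \<le> c n" for m
        proof -
          have "(\<Sum>k<m. ennreal (\<Lambda> (G n k))) = ennreal (\<Sum>k<m. a n (Suc k) - a n k)"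
            using a_mono by (subst sum_ennreal) (auto simp: \<Lambda>G)
          also have "(\<Sum>k<m. a n (Suc k) - a n k) = a n m - a n 0" by (rule sum_lessThan_telescope)
          also have "ennreal (a n m - a n 0) \<le> ennreal (a n m)" using a_ge0 by (intro ennreal_leI) auto
          also have "\<dots> \<le> c n" unfolding c_def by (rule SUP_upper) simp
          finally show ?thesis .
        qed
        then show "(\<Sum>k. ennreal (\<Lambda> (G n k))) \<le> c n" by (intro suminf_le_const) auto
      qed auto
      finally show ?thesis .
    qed
    \<comment> \<open>Each \<open>u k\<close> is 0 off \<open>U\<close>, so on \<open>B - U\<close>
      the remainders are the original functions and still cover.\<close>
    have outside: "\<mu> (B - U) \<le> (\<Sum>n. ennreal (\<Lambda> (F n) - a n k))" for k
    proof -
      have "covers (B - U) (\<lambda>n x. F n x - F n x * u k x)"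
        using F u01 by (auto simp: covers_def E_diff FuE u_out intro!: mult_left_le)
      from \<mu>_le[OF this] show ?thesis by (simp add: diff FE FuE a_def)
    qed
    have "\<mu> (B - U) + (\<Sum>n. ennreal (a n k)) \<le> (\<Sum>n. ennreal (\<Lambda> (F n)))" for k
    proof -
      have "\<mu> (B - U) + (\<Sum>n. ennreal (a n k)) \<le> (\<Sum>n. ennreal (\<Lambda> (F n) - a n k)) + (\<Sum>n. ennreal (a n k))"
        by (intro add_right_mono outside)
      also have "\<dots> = (\<Sum>n. ennreal (\<Lambda> (F n) - a n k) + ennreal (a n k))"
        by (intro suminf_add) auto
      also have "\<dots> = (\<Sum>n. ennreal (\<Lambda> (F n)))"
        using a_le a_ge0 by (simp flip: ennreal_plus)
      finally show ?thesis .
    qed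
    \<comment> \<open>The estimate is uniform in \<open>k\<close>; since \<open>a n k\<close>
      increases in \<open>k\<close>, the supremum may be moved inside the sum over \<open>n\<close>,
      which produces \<open>c n\<close>.\<close>
    then have "(SUP k. \<mu> (B - U) + (\<Sum>n. ennreal (a n k))) \<le> (\<Sum>n. ennreal (\<Lambda> (F n)))"
      by (intro SUP_least)
    moreover have "(\<Sum>n. c n) = (SUP k. \<Sum>n. ennreal (a n k))"
      unfolding c_def using a_mono
      by (intro ennreal_suminf_SUP_eq) (auto intro!: incseq_SucI ennreal_leI)
    ultimately have "\<mu> (B - U) + (\<Sum>n. c n) \<le> (\<Sum>n. ennreal (\<Lambda> (F n)))"
      by (simp add: ennreal_SUP_add_right)
    from order_trans[OF add_left_mono[OF inside] this]
    show "\<mu> (B \<inter> U) + \<mu> (B - U) \<le> (\<Sum>n. ennreal (\<Lambda> (F n)))"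
      by (subst add.commute)
  qed
  moreover have "\<mu> B \<le> \<mu> (B \<inter> U) + \<mu> (B - U)" if "B \<subseteq> K" for B
    using \<mu>_add_le[of "B \<inter> U" "B - U"] that by (auto simp: Int_Diff_Un)
  ultimately have "\<mu> (B \<inter> U) + \<mu> (B - U) = \<mu> B" if "B \<subseteq> K" for B
    using that by (intro antisym)
  then have "\<mu> (K \<inter> U \<inter> B) + \<mu> ((K - K \<inter> U) \<inter> B) = \<mu> B" if "B \<subseteq> K" for B
  proof -
    have "K \<inter> U \<inter> B = B \<inter> U" "(K - K \<inter> U) \<inter> B = B - U" using that by auto
    then show ?thesis using \<open>\<And>B. B \<subseteq> K \<Longrightarrow> \<mu> (B \<inter> U) + \<mu> (B - U) = \<mu> B\<close> that by simp
  qed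
  then show ?thesis by (auto simp: lambda_system_def)
qed

lemma borel_subset_lambda_system: "sets (restrict_space borel K) \<subseteq> lambda_system K (Pow K) \<mu>"
proof -
  interpret P: sigma_algebra K "Pow K" by (rule sigma_algebra_Pow)
  interpret L: sigma_algebra K "lambda_system K (Pow K) \<mu>"
    using P.caratheodory_lemma[OF outer] by (simp add: measure_space_def)
  have "K \<inter> B \<in> lambda_system K (Pow K) \<mu>" if "B \<in> sets borel" for B
    using that[unfolded sets_borel]
  proof (induction B rule: sigma_sets.induct)
    case (Basic U)
    then show ?case by (auto intro: open_in_lambda_system)
  next
    case Empty
    then show ?case by simp
  next
    case (Compl B)
    have "K \<inter> (UNIV - B) = K - (K \<inter> B)" by auto
    then show ?case using L.compl_sets[OF Compl.IH] by simp
  next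
    case (Union B)
    have eq: "K \<inter> (\<Union>i. B i) = (\<Union>i. K \<inter> B i)" by auto
    have "range (\<lambda>i. K \<inter> B i) \<subseteq> lambda_system K (Pow K) \<mu>" using Union.IH by auto
    then show ?case unfolding eq by (rule L.countable_nat_UN)
  qed
  then show ?thesis by (auto simp: sets_restrict_space)
qed

section \<open>The representing measure and its integrals\<close>

definition "repr = measure_of K (sets (restrict_space borel K)) \<mu>"

lemma sigma_algebra_restrict_borel: "sigma_algebra K (sets (restrict_space borel K))"
  using sets.sigma_algebra_axioms[of "restrict_space borel K"] by (simp add: space_restrict_space)

lemma sets_repr [simp]: "sets repr = sets (restrict_space borel K)"
  unfolding repr_def by (rule sigma_algebra.sets_measure_of_eq[OF sigma_algebra_restrict_borel])

lemma space_repr [simp]: "space repr = K"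
  unfolding repr_def by (rule sigma_algebra.space_measure_of_eq[OF sigma_algebra_restrict_borel])

lemma emeasure_repr: "A \<in> sets repr \<Longrightarrow> emeasure repr A = \<mu> A"
proof -
  assume A: "A \<in> sets repr"
  have "measure_space K (lambda_system K (Pow K) \<mu>) \<mu>"
    using sigma_algebra.caratheodory_lemma[OF sigma_algebra_Pow outer] .
  then have "measure_space K (sets (restrict_space borel K)) \<mu>"
    using sigma_algebra_restrict_borel borel_subset_lambda_system by (rule measure_down)
  then have "positive (sets (restrict_space borel K)) \<mu>"
    "countably_additive (sets (restrict_space borel K)) \<mu>"
    by (auto simp: measure_space_def)
  from emeasure_measure_of_sigma[OF sigma_algebra_restrict_borel this] A
  show ?thesis unfolding repr_def[symmetric] by simp
qed

lemma finite_repr: "finite_measure repr"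
proof
  have "emeasure repr (space repr) \<le> ennreal (\<Lambda> (\<lambda>_. 1))"
    using emeasure_repr[of K] \<mu>_le_single[OF one, of K] sets.top[of repr] by simp
  then show "emeasure repr (space repr) \<noteq> \<infinity>" by (auto simp: top_unique)
qed

lemma measurable_repr: "f \<in> E \<Longrightarrow> f \<in> borel_measurable repr"
  using borel_measurable_continuous_on_restrict[OF cont]
  by (simp cong: measurable_cong_sets add: measurable_cong_sets[OF sets_repr refl])

text \<open>Cut \<open>f\<close> into horizontal slices \<open>g k\<close> of height 1/n. On the set
  where \<open>f\<close> reaches the top of a slice, \<open>n * g k\<close> is at least 1, which
  bounds the measure of that set. Summing the slices gives back \<open>f\<close>, and the error 1/n
  is multiplied by a finite total mass.\<close>

lemma nn_integral_repr_le:
  assumes f: "f \<in> E" and f0: "\<forall>x\<in>K. 0 \<le> f x" and fB: "\<forall>x\<in>K. f x \<le> B"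
  shows "(\<integral>\<^sup>+x. ennreal (f x) \<partial>repr) \<le> ennreal (\<Lambda> f)"
proof -
  interpret finite_measure repr by (rule finite_repr)
  have step: "(\<integral>\<^sup>+x. ennreal (f x) \<partial>repr) \<le> ennreal (1 / real n) * emeasure repr K + ennreal (\<Lambda> f)"
    if n: "n > 0" for n :: nat
  proof -
    \<comment> \<open>With \<open>N / n\<close> above the bound \<open>B\<close>, the first
      \<open>N\<close> slices add up to all of \<open>f\<close>.\<close>
    obtain N :: nat where N: "real n * B < real N" using reals_Archimedean2 by blast
    define a where "a k = real k / real n" for k
    have a_mono: "a k \<le> a (Suc k)" and a0: "0 \<le> a k" for k
      by (auto simp: a_def divide_right_mono)
    define g where "g k x = min (f x) (a (Suc k)) - min (f x) (a k)" for k x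
    have gE: "g k \<in> E" for k
    proof (rule solid[OF f])
      show "continuous_on K (g k)" unfolding g_def by (intro continuous_intros cont[OF f])
      show "\<forall>x\<in>K. \<bar>g k x\<bar> \<le> \<bar>f x\<bar>"
      proof
        fix x assume "x \<in> K"
        then show "\<bar>g k x\<bar> \<le> \<bar>f x\<bar>" using f0 a_mono[of k] a0[of k] by (auto simp: g_def min_def)
      qed
    qed
    have g0: "0 \<le> g k x" for k x
      using a_mono[of k] by (auto simp: g_def min_def)
    define A where "A k = {x\<in>K. real (Suc k) / real n \<le> f x}" for k
    have A_sets: "A k \<in> sets repr" for k
    proof -
      have [measurable]: "f \<in> borel_measurable repr" by (rule measurable_repr[OF f])
      have "{x\<in>space repr. real (Suc k) / real n \<le> f x} \<in> sets repr" by measurable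
      then show ?thesis by (simp add: A_def)
    qed
    note [measurable] = A_sets
    have \<mu>A: "emeasure repr (A k) \<le> ennreal (real n * \<Lambda> (g k))" for k
    proof -
      have "\<mu> (A k) \<le> ennreal (\<Lambda> (\<lambda>x. real n * g k x))"
      proof (rule \<mu>_le_single)
        show "\<forall>x\<in>A k. 1 \<le> real n * g k x"
        proof
          fix x assume "x \<in> A k"
          moreover have "real k / real n \<le> real (Suc k) / real n" by (auto simp: divide_right_mono)
          ultimately have "g k x = real (Suc k) / real n - real k / real n"
            by (auto simp: A_def g_def a_def)
          then show "1 \<le> real n * g k x" using n by (simp add: field_simps)
        qed
      qed (auto simp: E_scale gE g0)
      then show ?thesis using emeasure_repr[OF A_sets] scale[OF gE] by simp
    qed
    \<comment> \<open>At \<open>x\<close> exactly the levels below \<open>n * f x\<close> are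
      reached; what remains above the last one is less than 1/n.\<close>
    have pt: "f x \<le> 1 / real n + (\<Sum>k<N. 1 / real n * indicator (A k) x)" if x: "x \<in> K" for x
    proof -
      define m where "m = nat \<lfloor>real n * f x\<rfloor>"
      have nf: "0 \<le> real n * f x" using f0 x by auto
      have m: "real m \<le> real n * f x" "real n * f x < real m + 1"
        using nf by (auto simp: m_def)
      have "m \<le> N"
      proof -
        have "real n * f x \<le> real n * B" using fB x by (simp add: mult_left_mono)
        with m N show ?thesis by linarith
      qed
      have "real m = (\<Sum>k<m. 1 * indicator (A k) x)"
      proof -
        have "indicator (A k) x = (1::real)" if "k < m" for k
        proof -
          have "real (Suc k) \<le> real m" using that by simp
          also note m(1)
          finally show ?thesis using n x by (simp add: A_def field_simps)
        qed
        then show ?thesis by simp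
      qed
      also have "\<dots> \<le> (\<Sum>k<N. 1 * indicator (A k) x)"
        using \<open>m \<le> N\<close> by (intro sum_mono2) auto
      finally have "real n * f x \<le> 1 + (\<Sum>k<N. indicator (A k) x)" using m by simp
      then have "f x \<le> (1 + (\<Sum>k<N. indicator (A k) x)) / real n" using n by (simp add: field_simps)
      also have "\<dots> = 1 / real n + (\<Sum>k<N. 1 / real n * indicator (A k) x)"
        by (simp add: add_divide_distrib sum_divide_distrib)
      finally show ?thesis .
    qed
    have "(\<integral>\<^sup>+x. ennreal (f x) \<partial>repr) \<le>
      (\<integral>\<^sup>+x. ennreal (1 / real n) + (\<Sum>k<N. ennreal (1 / real n) * indicator (A k) x) \<partial>repr)"
    proof (rule nn_integral_mono)
      fix x assume "x \<in> space repr"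
      then have "ennreal (f x) \<le> ennreal (1 / real n + (\<Sum>k<N. 1 / real n * indicator (A k) x))"
        using pt by (intro ennreal_leI) auto
      also have "\<dots> = ennreal (1 / real n) + (\<Sum>k<N. ennreal (1 / real n * indicator (A k) x))"
        by (subst ennreal_plus) (auto intro!: sum_nonneg)
      also have "\<dots> = ennreal (1 / real n) + (\<Sum>k<N. ennreal (1 / real n) * indicator (A k) x)"
        by (intro arg_cong2[where f="(+)"] sum.cong refl) (auto simp: indicator_def)
      finally show "ennreal (f x) \<le> ennreal (1 / real n) + (\<Sum>k<N. ennreal (1 / real n) * indicator (A k) x)" .
    qed
    also have "\<dots> = ennreal (1 / real n) * emeasure repr K + (\<Sum>k<N. ennreal (1 / real n) * emeasure repr (A k))"
    proof -
      have "(\<integral>\<^sup>+x. ennreal (1 / real n) + (\<Sum>k<N. ennreal (1 / real n) * indicator (A k) x) \<partial>repr) =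
        (\<integral>\<^sup>+x. ennreal (1 / real n) \<partial>repr) + (\<integral>\<^sup>+x. (\<Sum>k<N. ennreal (1 / real n) * indicator (A k) x) \<partial>repr)"
        using A_sets by (intro nn_integral_add) measurable
      also have "(\<integral>\<^sup>+x. (\<Sum>k<N. ennreal (1 / real n) * indicator (A k) x) \<partial>repr) =
        (\<Sum>k<N. \<integral>\<^sup>+x. ennreal (1 / real n) * indicator (A k) x \<partial>repr)"
        using A_sets by (intro nn_integral_sum) measurable
      also have "\<dots> = (\<Sum>k<N. ennreal (1 / real n) * emeasure repr (A k))"
        using A_sets by (intro sum.cong refl nn_integral_cmult_indicator)
      finally show ?thesis by simp
    qed
    also have "\<dots> \<le> ennreal (1 / real n) * emeasure repr K + (\<Sum>k<N. ennreal (1 / real n) * ennreal (real n * \<Lambda> (g k)))"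
      by (intro add_left_mono sum_mono mult_left_mono \<mu>A) auto
    also have "(\<Sum>k<N. ennreal (1 / real n) * ennreal (real n * \<Lambda> (g k))) = (\<Sum>k<N. ennreal (\<Lambda> (g k)))"
      using n pos[OF gE] g0 by (simp flip: ennreal_mult)
    also have "\<dots> = ennreal (\<Sum>k<N. \<Lambda> (g k))"
      using pos[OF gE] g0 by (intro sum_ennreal) auto
    also have "(\<Sum>k<N. \<Lambda> (g k)) = \<Lambda> (\<lambda>x. \<Sum>k<N. g k x)"
      by (rule sum[symmetric]) (auto simp: gE)
    also have "\<Lambda> (\<lambda>x. \<Sum>k<N. g k x) = \<Lambda> f"
    proof (rule cong)
      show "\<forall>x\<in>K. (\<Sum>k<N. g k x) = f x"
      proof
        fix x assume x: "x \<in> K"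
        have "(\<Sum>k<N. g k x) = min (f x) (a N) - min (f x) (a 0)"
          unfolding g_def by (rule sum_lessThan_telescope)
        moreover have "f x \<le> real N / real n"
        proof -
          have "real n * f x \<le> real n * B" using fB x by (simp add: mult_left_mono)
          then have "real n * f x \<le> real N" using N by linarith
          then show ?thesis using n by (simp add: field_simps)
        qed
        ultimately show "(\<Sum>k<N. g k x) = f x" using f0 x by (simp add: a_def)
      qed
    qed (auto intro: f E_sum gE)
    finally show ?thesis .
  qed
  have "(\<lambda>n. emeasure repr K * ennreal (1 / real n) + ennreal (\<Lambda> f)) \<longlonglongrightarrow> emeasure repr K * ennreal 0 + ennreal (\<Lambda> f)"
    using emeasure_finite[of K]
    by (intro tendsto_add tendsto_const ennreal_tendsto_cmult tendsto_ennrealI lim_1_over_n)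
      (auto simp: less_top[symmetric])
  then have "(\<lambda>n. ennreal (1 / real n) * emeasure repr K + ennreal (\<Lambda> f)) \<longlonglongrightarrow> ennreal (\<Lambda> f)"
    by (simp add: mult.commute)
  then show ?thesis
    using step by (intro LIMSEQ_le_const) (auto intro!: exI[of _ 1])
qed

text \<open>The upper bound is applied to \<open>f\<close> and to \<open>B - f\<close>. The two
  integrals add up to \<open>B\<close> times the total mass, which is known exactly, so neither
  inequality can be strict.\<close>

lemma integral_repr_bounded:
  assumes f: "f \<in> E" and f0: "\<forall>x\<in>K. 0 \<le> f x" and fB: "\<forall>x\<in>K. f x \<le> B"
  shows "(\<integral>\<^sup>+x. ennreal (f x) \<partial>repr) = ennreal (\<Lambda> f)"
proof (cases "K = {}")
  case True
  then have "\<Lambda> f = \<Lambda> (\<lambda>_. 0)" by (intro cong f E_const) auto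
  moreover have "(\<integral>\<^sup>+x. ennreal (f x) \<partial>repr) = 0"
    by (rule nn_integral_empty) (use True space_repr in argo)
  ultimately show ?thesis using const[of 0] by simp
next
  case False
  interpret finite_measure repr by (rule finite_repr)
  note [measurable] = measurable_repr[OF f]
  have B: "0 \<le> B" using False f0 fB by force
  have KR: "emeasure repr K = ennreal (\<Lambda> (\<lambda>_. 1))"
  proof (rule antisym)
    show "emeasure repr K \<le> ennreal (\<Lambda> (\<lambda>_. 1))"
      using emeasure_repr[of K] \<mu>_le_single[OF one, of K] sets.top[of repr] by simp
    \<comment> \<open>Every covering of \<open>K\<close> dominates the constant 1 on
      \<open>K\<close>, so \<open>le_suminf\<close> applies to it.\<close>
    have "ennreal (\<Lambda> (\<lambda>_. 1)) \<le> \<mu> K"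
      by (intro \<mu>_ge le_suminf one) (auto simp: covers_def)
    then show "ennreal (\<Lambda> (\<lambda>_. 1)) \<le> emeasure repr K"
      using emeasure_repr[of K] sets.top[of repr] by simp
  qed
  have \<Lambda>f: "0 \<le> \<Lambda> f" "\<Lambda> f \<le> B * \<Lambda> (\<lambda>_. 1)"
    using pos[OF f f0] mono[OF f E_const[of B] fB] const[of B] by auto
  have le: "(\<integral>\<^sup>+x. ennreal (f x) \<partial>repr) \<le> ennreal (\<Lambda> f)"
    by (rule nn_integral_repr_le[OF f f0 fB])
  have "(\<integral>\<^sup>+x. ennreal (B - f x) \<partial>repr) \<le> ennreal (\<Lambda> (\<lambda>x. B - f x))"
    by (rule nn_integral_repr_le[of _ B]) (use E_diff[OF E_const f] f0 fB in auto)
  also have "\<dots> = ennreal (B * \<Lambda> (\<lambda>_. 1) - \<Lambda> f)"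
    using diff[OF E_const f] const[of B] by simp
  finally have le': "(\<integral>\<^sup>+x. ennreal (B - f x) \<partial>repr) \<le> ennreal (B * \<Lambda> (\<lambda>_. 1) - \<Lambda> f)" .
  have "ennreal (B * \<Lambda> (\<lambda>_. 1)) = (\<integral>\<^sup>+x. ennreal B \<partial>repr)"
    using KR B pos[OF one] by (simp add: ennreal_mult)
  also have "\<dots> = (\<integral>\<^sup>+x. ennreal (f x) + ennreal (B - f x) \<partial>repr)"
    using f0 fB by (intro nn_integral_cong) (auto simp flip: ennreal_plus)
  also have "\<dots> = (\<integral>\<^sup>+x. ennreal (f x) \<partial>repr) + (\<integral>\<^sup>+x. ennreal (B - f x) \<partial>repr)"
    by (intro nn_integral_add) auto
  also have "\<dots> \<le> (\<integral>\<^sup>+x. ennreal (f x) \<partial>repr) + ennreal (B * \<Lambda> (\<lambda>_. 1) - \<Lambda> f)"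
    by (intro add_left_mono le')
  finally have *: "ennreal (B * \<Lambda> (\<lambda>_. 1)) \<le>
    (\<integral>\<^sup>+x. ennreal (f x) \<partial>repr) + ennreal (B * \<Lambda> (\<lambda>_. 1) - \<Lambda> f)" .
  show ?thesis
  proof (cases "\<integral>\<^sup>+x. ennreal (f x) \<partial>repr")
    case (real r)
    then have "B * \<Lambda> (\<lambda>_. 1) \<le> r + (B * \<Lambda> (\<lambda>_. 1) - \<Lambda> f)"
      using * \<Lambda>f by (simp flip: ennreal_plus add: ennreal_le_iff)
    then show ?thesis using le real \<Lambda>f by (simp add: ennreal_le_iff)
  next
    case top
    then show ?thesis using le by (simp add: top_unique)
  qed
qed

text \<open>Truncation at height \<open>n\<close> reduces to bounded functions: the functional
  converges along the truncations by \<open>null_limit\<close>, the integral by monotone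
  convergence.\<close>

lemma nn_integral_repr:
  assumes f: "f \<in> E" and f0: "\<forall>x\<in>K. 0 \<le> f x"
  shows "(\<integral>\<^sup>+x. ennreal (f x) \<partial>repr) = ennreal (\<Lambda> f)"
proof -
  note [measurable] = measurable_repr[OF f]
  have gE: "(\<lambda>x. min (f x) (real n)) \<in> E" for n
    by (rule solid[OF f]) (use cont[OF f] f0 in \<open>auto intro!: continuous_intros\<close>)
  have "(\<lambda>n. \<Lambda> (\<lambda>x. f x - min (f x) (real n))) \<longlonglongrightarrow> 0"
  proof (rule null_limit)
    show "(\<lambda>x. f x - min (f x) (real n)) \<in> E" for n by (intro E_diff f gE)
    fix x assume "x \<in> K"
    obtain N :: nat where "f x \<le> real N" using real_arch_simple by blast
    then have "\<forall>\<^sub>F n in sequentially. f x - min (f x) (real n) = 0"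
      unfolding eventually_sequentially by (intro exI[of _ N]) (auto simp: min_def)
    then show "(\<lambda>n. f x - min (f x) (real n)) \<longlonglongrightarrow> 0" by (rule tendsto_eventually)
  qed auto
  then have "(\<lambda>n. \<Lambda> f - \<Lambda> (\<lambda>x. min (f x) (real n))) \<longlonglongrightarrow> 0"
    by (simp add: diff f gE)
  from tendsto_diff[OF tendsto_const[of "\<Lambda> f"] this]
  have "(\<lambda>n. ennreal (\<Lambda> (\<lambda>x. min (f x) (real n)))) \<longlonglongrightarrow> ennreal (\<Lambda> f)"
    by (intro tendsto_ennrealI) simp
  moreover have "ennreal (\<Lambda> (\<lambda>x. min (f x) (real n))) = (\<integral>\<^sup>+x. ennreal (min (f x) (real n)) \<partial>repr)" for n
    using f0 by (intro integral_repr_bounded[symmetric, of _ "real n"] gE) auto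
  moreover have "(\<lambda>n. \<integral>\<^sup>+x. ennreal (min (f x) (real n)) \<partial>repr) \<longlonglongrightarrow> (\<integral>\<^sup>+x. ennreal (f x) \<partial>repr)"
  proof (rule nn_integral_LIMSEQ)
    show "incseq (\<lambda>n x. ennreal (min (f x) (real n)))"
      by (auto simp: incseq_def le_fun_def intro!: ennreal_leI min.mono)
    fix x
    obtain N :: nat where "f x \<le> real N" using real_arch_simple by blast
    then have "\<forall>\<^sub>F n in sequentially. ennreal (min (f x) (real n)) = ennreal (f x)"
      unfolding eventually_sequentially by (intro exI[of _ N]) (auto simp: min_def)
    then show "(\<lambda>n. ennreal (min (f x) (real n))) \<longlonglongrightarrow> ennreal (f x)" by (rule tendsto_eventually)
  qed auto
  ultimately show ?thesis using LIMSEQ_unique by fastforce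
qed

lemma integral_repr:
  assumes f: "f \<in> E"
  shows "integrable repr f" "(LINT x|repr. f x) = \<Lambda> f"
proof -
  define p where "p x = max 0 (f x)" for x
  define q where "q x = max 0 (- f x)" for x
  have pE: "p \<in> E" unfolding p_def
    by (rule solid[OF f]) (use cont[OF f] in \<open>auto intro!: continuous_intros\<close>)
  have qE: "q \<in> E" unfolding q_def
    by (rule solid[OF f]) (use cont[OF f] in \<open>auto intro!: continuous_intros\<close>)
  have int: "has_bochner_integral repr g (\<Lambda> g)" if "g \<in> E" "\<And>x. 0 \<le> g x" for g
    using that nn_integral_repr[OF that(1)] measurable_repr[OF that(1)] pos[OF that(1)]
    by (intro has_bochner_integral_nn_integral) auto
  have fpq: "f = (\<lambda>x. p x - q x)" by (rule ext) (auto simp: p_def q_def)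
  have "has_bochner_integral repr (\<lambda>x. p x - q x) (\<Lambda> p - \<Lambda> q)"
    by (intro has_bochner_integral_diff int pE qE) (auto simp: p_def q_def)
  moreover have "\<Lambda> f = \<Lambda> p - \<Lambda> q"
    unfolding diff[OF pE qE, symmetric] by (rule arg_cong[OF fpq])
  ultimately have "has_bochner_integral repr f (\<Lambda> f)"
    by (simp only: fpq[symmetric])
  then show "integrable repr f" "(LINT x|repr. f x) = \<Lambda> f"
    by (auto simp: has_bochner_integral_iff)
qed

end

section \<open>Rellich compactness\<close>

text \<open>A substitute for the triangle inequality that keeps squared distances, with values in
  \<open>ennreal\<close>, and so avoids square roots; the factor 2 comes from (a + b)^2 \<le> 2 a^2
  + 2 b^2.\<close>

lemma nn_integral_dist_sq_triangle:
  fixes a b c :: "'a \<Rightarrow> 'b::{real_normed_vector, second_countable_topology}"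
  assumes [measurable]: "a \<in> borel_measurable M" "b \<in> borel_measurable M" "c \<in> borel_measurable M"
  shows "(\<integral>\<^sup>+x. ennreal ((norm (a x - c x))\<^sup>2) \<partial>M) \<le>
    2 * (\<integral>\<^sup>+x. ennreal ((norm (a x - b x))\<^sup>2) \<partial>M) + 2 * (\<integral>\<^sup>+x. ennreal ((norm (b x - c x))\<^sup>2) \<partial>M)"
proof -
  have "ennreal ((norm (a x - c x))\<^sup>2) \<le> 2 * ennreal ((norm (a x - b x))\<^sup>2) + 2 * ennreal ((norm (b x - c x))\<^sup>2)" for x
  proof -
    have "norm (a x - c x) \<le> norm (a x - b x) + norm (b x - c x)"
      using norm_triangle_ineq[of "a x - b x" "b x - c x"] by simp
    then have "(norm (a x - c x))\<^sup>2 \<le> (norm (a x - b x) + norm (b x - c x))\<^sup>2" by (rule power_mono) simp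
    also have "\<dots> \<le> 2 * (norm (a x - b x))\<^sup>2 + 2 * (norm (b x - c x))\<^sup>2"
      using sum_squares_bound[of "norm (a x - b x)" "norm (b x - c x)"] by (simp add: power2_sum)
    finally have "ennreal ((norm (a x - c x))\<^sup>2) \<le> ennreal (2 * (norm (a x - b x))\<^sup>2 + 2 * (norm (b x - c x))\<^sup>2)"
      by (rule ennreal_leI)
    then show ?thesis by (simp add: ennreal_plus ennreal_mult)
  qed
  then have "(\<integral>\<^sup>+x. ennreal ((norm (a x - c x))\<^sup>2) \<partial>M) \<le>
    (\<integral>\<^sup>+x. 2 * ennreal ((norm (a x - b x))\<^sup>2) + 2 * ennreal ((norm (b x - c x))\<^sup>2) \<partial>M)"
    by (intro nn_integral_mono)
  also have "\<dots> = 2 * (\<integral>\<^sup>+x. ennreal ((norm (a x - b x))\<^sup>2) \<partial>M) + 2 * (\<integral>\<^sup>+x. ennreal ((norm (b x - c x))\<^sup>2) \<partial>M)"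
    by (simp add: nn_integral_add nn_integral_cmult)
  finally show ?thesis .
qed

text \<open>The Riesz-Fischer argument: a rapidly Cauchy subsequence converges almost everywhere,
  and Fatou's lemma identifies its limit as the limit in mean square of the whole sequence.\<close>

lemma L2_complete:
  fixes f :: "nat \<Rightarrow> 'a \<Rightarrow> 'b::{banach, second_countable_topology}"
  assumes [measurable]: "\<And>n. f n \<in> borel_measurable M"
    and Cauchy: "\<And>e. e > 0 \<Longrightarrow> \<exists>N. \<forall>m\<ge>N. \<forall>n\<ge>N. (\<integral>\<^sup>+x. ennreal ((norm (f m x - f n x))\<^sup>2) \<partial>M) \<le> ennreal e"
  obtains u where "u \<in> borel_measurable M"
    "(\<lambda>n. \<integral>\<^sup>+x. ennreal ((norm (f n x - u x))\<^sup>2) \<partial>M) \<longlonglongrightarrow> 0"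
proof -
  have "\<exists>N. \<forall>m\<ge>N. \<forall>n\<ge>N. (\<integral>\<^sup>+x. ennreal ((norm (f m x - f n x))\<^sup>2) \<partial>M) \<le> ennreal ((1/4)^k)" for k
    by (rule Cauchy) simp
  then obtain N where N: "\<And>k m n. m \<ge> N k \<Longrightarrow> n \<ge> N k \<Longrightarrow>
    (\<integral>\<^sup>+x. ennreal ((norm (f m x - f n x))\<^sup>2) \<partial>M) \<le> ennreal ((1/4)^k)" by metis
  \<comment> \<open>Summing the thresholds makes \<open>r\<close> monotone and keeps
    \<open>r k\<close> at least \<open>N k\<close>.\<close>
  define r where "r k = (\<Sum>i\<le>k. N i)" for k
  have r_mono: "r k \<le> r (Suc k)" for k by (simp add: r_def)
  have rN: "N k \<le> r k" for k
    unfolding r_def using member_le_sum[of k "{..k}" N] by simp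
  have r_le: "(\<integral>\<^sup>+x. ennreal ((norm (f (r (Suc k)) x - f (r k) x))\<^sup>2) \<partial>M) \<le> ennreal ((1/4)^k)" for k
    by (rule N) (use rN[of k] r_mono[of k] in auto)
  \<comment> \<open>The squared increments have integral at most (1/4)^k, so the weights 2^k still
    leave a convergent series. Finiteness of \<open>S x\<close> forces the increments at
    \<open>x\<close> to decay like (1/2)^(k/2), hence to be summable.\<close>
  define S where "S x = (\<Sum>k. ennreal (2^k * (norm (f (r (Suc k)) x - f (r k) x))\<^sup>2))" for x
  have [measurable]: "S \<in> borel_measurable M" unfolding S_def by measurable
  have "(\<integral>\<^sup>+x. S x \<partial>M) = (\<Sum>k. \<integral>\<^sup>+x. ennreal (2^k * (norm (f (r (Suc k)) x - f (r k) x))\<^sup>2) \<partial>M)"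
    unfolding S_def by (intro nn_integral_suminf) measurable
  also have "\<dots> \<le> (\<Sum>k. ennreal ((1/2)^k))"
  proof (intro suminf_le)
    fix k
    have "(\<integral>\<^sup>+x. ennreal (2^k * (norm (f (r (Suc k)) x - f (r k) x))\<^sup>2) \<partial>M) =
      ennreal (2^k) * (\<integral>\<^sup>+x. ennreal ((norm (f (r (Suc k)) x - f (r k) x))\<^sup>2) \<partial>M)"
      by (simp add: ennreal_mult nn_integral_cmult)
    also have "\<dots> \<le> ennreal (2^k) * ennreal ((1/4)^k)" by (intro mult_left_mono r_le) auto
    also have "\<dots> = ennreal (2^k * (1/4)^k)" by (rule ennreal_mult[symmetric]) auto
    also have "(2::real)^k * (1/4)^k = (1/2)^k" by (subst power_mult_distrib[symmetric]) simp
    finally show "(\<integral>\<^sup>+x. ennreal (2^k * (norm (f (r (Suc k)) x - f (r k) x))\<^sup>2) \<partial>M) \<le> ennreal ((1/2)^k)" .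
  qed auto
  also have "\<dots> = ennreal 2"
    using geometric_sums[of "1/2::real"] by (subst suminf_ennreal_eq) auto
  finally have "(\<integral>\<^sup>+x. S x \<partial>M) \<noteq> \<infinity>" by (auto simp: top_unique)
  then have "AE x in M. S x \<noteq> \<infinity>" by (intro nn_integral_PInf_AE) auto
  then have conv: "AE x in M. convergent (\<lambda>k. f (r k) x)"
  proof eventually_elim
    case (elim x)
    then obtain C where C: "S x = ennreal C" "C \<ge> 0" by (cases "S x") auto
    have bd: "norm (f (r (Suc k)) x - f (r k) x) \<le> sqrt C * sqrt (1/2)^k" for k
    proof -
      have "ennreal (2^k * (norm (f (r (Suc k)) x - f (r k) x))\<^sup>2) \<le> S x"
      proof -
        have "(\<Sum>i\<in>{k}. ennreal (2^i * (norm (f (r (Suc i)) x - f (r i) x))\<^sup>2)) \<le> S x"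
          unfolding S_def by (rule sum_le_suminf) auto
        then show ?thesis by simp
      qed
      then have "2^k * (norm (f (r (Suc k)) x - f (r k) x))\<^sup>2 \<le> C" using C by (simp add: ennreal_le_iff)
      then have "(norm (f (r (Suc k)) x - f (r k) x))\<^sup>2 \<le> C * (1/2)^k" by (simp add: field_simps power_one_over)
      then have "norm (f (r (Suc k)) x - f (r k) x) \<le> sqrt (C * (1/2)^k)" by (rule real_le_rsqrt)
      then show ?thesis by (simp add: real_sqrt_mult real_sqrt_power)
    qed
    have sm: "summable (\<lambda>k. sqrt C * sqrt (1/2)^k)"
      by (intro summable_mult summable_geometric) (simp add: real_sqrt_divide)
    have "summable (\<lambda>k. f (r (Suc k)) x - f (r k) x)"
      by (rule summable_comparison_test'[OF sm, of 0]) (rule bd)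
    then have "convergent (\<lambda>n. \<Sum>k<n. f (r (Suc k)) x - f (r k) x)"
      by (rule summable_iff_convergent[THEN iffD1])
    moreover have "(\<Sum>k<n. f (r (Suc k)) x - f (r k) x) = f (r n) x - f (r 0) x" for n
      by (rule sum_lessThan_telescope)
    ultimately have "convergent (\<lambda>n. f (r n) x - f (r 0) x)" by simp
    from convergent_add[OF this convergent_const[of "f (r 0) x"]] show ?case by simp
  qed
  define u where "u x = lim (\<lambda>k. f (r k) x)" for x
  have [measurable]: "u \<in> borel_measurable M" unfolding u_def by measurable
  have lim: "AE x in M. (\<lambda>k. f (r k) x) \<longlonglongrightarrow> u x"
    using conv unfolding u_def by eventually_elim (simp add: convergent_LIMSEQ_iff)
  have "(\<lambda>n. \<integral>\<^sup>+x. ennreal ((norm (f n x - u x))\<^sup>2) \<partial>M) \<longlonglongrightarrow> 0"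
  proof (rule tendsto_zero_ennreal)
    fix e :: real assume "e > 0"
    then obtain k0 where k0: "(1/4::real)^k0 < e" using real_arch_pow_inv[of e "1/4"] by auto
    have r_ge: "N k0 \<le> r k" if "k0 \<le> k" for k
      using rN[of k0] lift_Suc_mono_le[of r, OF r_mono that] by simp
    have "(\<integral>\<^sup>+x. ennreal ((norm (f n x - u x))\<^sup>2) \<partial>M) \<le> ennreal ((1/4)^k0)" if n: "n \<ge> N k0" for n
    proof -
      have "(\<integral>\<^sup>+x. ennreal ((norm (f n x - u x))\<^sup>2) \<partial>M) =
        (\<integral>\<^sup>+x. liminf (\<lambda>k. ennreal ((norm (f n x - f (r k) x))\<^sup>2)) \<partial>M)"
      proof (rule nn_integral_cong_AE)
        show "AE x in M. ennreal ((norm (f n x - u x))\<^sup>2) = liminf (\<lambda>k. ennreal ((norm (f n x - f (r k) x))\<^sup>2))"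
          using lim
        proof eventually_elim
          case (elim x)
          then have "(\<lambda>k. ennreal ((norm (f n x - f (r k) x))\<^sup>2)) \<longlonglongrightarrow> ennreal ((norm (f n x - u x))\<^sup>2)"
            by (intro tendsto_intros tendsto_ennrealI)
          then show ?case by (intro lim_imp_Liminf[symmetric]) auto
        qed
      qed
      also have "\<dots> \<le> liminf (\<lambda>k. \<integral>\<^sup>+x. ennreal ((norm (f n x - f (r k) x))\<^sup>2) \<partial>M)"
        by (rule nn_integral_liminf) measurable
      also have "\<dots> \<le> limsup (\<lambda>k. \<integral>\<^sup>+x. ennreal ((norm (f n x - f (r k) x))\<^sup>2) \<partial>M)"
        by (intro Liminf_le_Limsup) auto
      also have "\<dots> \<le> ennreal ((1/4)^k0)"
        by (intro Limsup_bounded eventually_sequentiallyI[of k0] N n r_ge)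
      finally show ?thesis .
    qed
    moreover have "ennreal ((1/4)^k0) < ennreal e" using k0 \<open>e > 0\<close> by (intro ennreal_lessI)
    ultimately show "\<forall>\<^sub>F n in sequentially. (\<integral>\<^sup>+x. ennreal ((norm (f n x - u x))\<^sup>2) \<partial>M) < ennreal e"
      by (meson eventually_sequentiallyI le_less_trans)
  qed
  then show ?thesis by (rule that[rotated]) measurable
qed

section \<open>Compactly supported functions, difference quotients and mollification\<close>

lemma C1_compactD:
  assumes "C1_compact \<Omega> \<phi> g"
  shows "GDERIV \<phi> x :> g x" "continuous_on UNIV g" "continuous_on UNIV \<phi>"
    and "x \<notin> closure {x. \<phi> x \<noteq> 0} \<Longrightarrow> \<phi> x = 0" "x \<notin> closure {x. \<phi> x \<noteq> 0} \<Longrightarrow> g x = 0"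
    and "x \<notin> \<Omega> \<Longrightarrow> \<phi> x = 0" "x \<notin> \<Omega> \<Longrightarrow> g x = 0"
    and "\<phi> \<in> borel_measurable borel" "g \<in> borel_measurable borel"
proof -
  let ?K = "closure {x. \<phi> x \<noteq> 0}"
  show cg: "continuous_on UNIV g" and der: "GDERIV \<phi> x :> g x" for x
    using assms by (auto simp: C1_compact_def)
  show c: "continuous_on UNIV \<phi>"
    using has_derivative_continuous[OF der[unfolded gderiv_def]]
    by (simp add: continuous_on_eq_continuous_at)
  show z: "x \<notin> ?K \<Longrightarrow> \<phi> x = 0" for x using closure_subset[of "{x. \<phi> x \<noteq> 0}"] by auto
  show gz: "g x = 0" if "x \<notin> ?K" for x
  proof -
    have "((\<lambda>_. 0) has_derivative (\<lambda>_. 0)) (at x)" by (rule has_derivative_const)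
    then have "(\<phi> has_derivative (\<lambda>_. 0)) (at x)"
    proof (rule has_derivative_transform_within_open)
      show "open (- ?K)" by (intro open_Compl closed_closure)
      show "x \<in> - ?K" using that by simp
      show "0 = \<phi> y" if "y \<in> - ?K" for y using z[of y] that by simp
    qed
    moreover have "(\<phi> has_derivative (\<lambda>h. h \<bullet> g x)) (at x)"
      using der[of x] by (simp add: gderiv_def inner_commute)
    ultimately have "(\<lambda>h. h \<bullet> g x) = (\<lambda>_. 0)" by (rule has_derivative_unique[rotated])
    then have "g x \<bullet> g x = 0" by meson
    then show ?thesis by simp
  qed
  have sub: "?K \<subseteq> \<Omega>" using assms by (simp add: C1_compact_def)
  show "x \<notin> \<Omega> \<Longrightarrow> \<phi> x = 0" by (rule z) (use sub in blast)
  show "x \<notin> \<Omega> \<Longrightarrow> g x = 0" by (rule gz) (use sub in blast)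
  show "\<phi> \<in> borel_measurable borel" "g \<in> borel_measurable borel"
    using c cg by (simp_all add: borel_measurable_continuous_onI)
qed

lemma integrable_continuous_zero_outside_compact:
  fixes f :: "'a::euclidean_space \<Rightarrow> 'b::{banach, second_countable_topology}"
  assumes "continuous_on UNIV f" "compact K" "\<And>x. x \<notin> K \<Longrightarrow> f x = 0"
  shows "integrable lborel f"
proof -
  have "integrable lborel (\<lambda>x. indicator K x *\<^sub>R f x)"
    using assms by (intro borel_integrable_compact) (auto intro: continuous_on_subset)
  moreover have "(\<lambda>x. indicator K x *\<^sub>R f x) = f"
    using assms(3) by (auto simp: fun_eq_iff indicator_def)
  ultimately show ?thesis by simp
qed

lemma nn_integral_lborel_translate:
  fixes f :: "'a::euclidean_space \<Rightarrow> ennreal"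
  assumes [measurable]: "f \<in> borel_measurable borel"
  shows "(\<integral>\<^sup>+x. f (x + c) \<partial>lborel) = (\<integral>\<^sup>+x. f x \<partial>lborel)"
proof -
  have "(\<integral>\<^sup>+x. f x \<partial>distr lborel borel ((+) c)) = (\<integral>\<^sup>+x. f (c + x) \<partial>lborel)"
    by (rule nn_integral_distr) auto
  then show ?thesis by (simp add: lborel_distr_plus add.commute)
qed

text \<open>Cauchy-Schwarz against the constant 1 on a measure of mass at most 1. If
  \<open>h\<close> is not integrable its Bochner integral is 0 and the bound is trivial, so
  integrability need not be checked when the lemma is applied.\<close>

lemma square_integral_le_nn_integral:
  fixes h :: "'a \<Rightarrow> real"
  assumes M: "emeasure M (space M) \<le> 1" and [measurable]: "h \<in> borel_measurable M"
  shows "ennreal ((LINT x|M. h x)\<^sup>2) \<le> (\<integral>\<^sup>+x. ennreal ((h x)\<^sup>2) \<partial>M)"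
proof -
  have "ennreal \<bar>LINT x|M. h x\<bar> \<le> (\<integral>\<^sup>+x. ennreal \<bar>h x\<bar> \<partial>M)"
  proof (cases "integrable M h")
    case True
    then show ?thesis using integral_norm_bound_ennreal[OF True] by simp
  next
    case False
    then show ?thesis by (simp add: not_integrable_integral_eq)
  qed
  then have "(ennreal \<bar>LINT x|M. h x\<bar>)\<^sup>2 \<le> (\<integral>\<^sup>+x. ennreal \<bar>h x\<bar> * 1 \<partial>M)\<^sup>2" by (intro power_mono) auto
  also have "\<dots> \<le> (\<integral>\<^sup>+x. (ennreal \<bar>h x\<bar>)\<^sup>2 \<partial>M) * (\<integral>\<^sup>+x. 1\<^sup>2 \<partial>M)"
    by (rule Cauchy_Schwarz_nn_integral) auto
  also have "\<dots> \<le> (\<integral>\<^sup>+x. (ennreal \<bar>h x\<bar>)\<^sup>2 \<partial>M) * 1"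
    using M by (intro mult_left_mono) auto
  finally show ?thesis by (simp add: ennreal_power)
qed

text \<open>Write the difference as the integral of \<open>g (x + s z) \<bullet> z\<close> over
  \<open>s\<close> in [0,1], use Cauchy-Schwarz, and exchange the integrals; translation invariance
  then removes the dependence on \<open>s\<close>.\<close>

lemma nn_integral_difference_quotient_le:
  assumes C: "C1_compact \<Omega> \<phi> g"
  shows "(\<integral>\<^sup>+x. ennreal ((\<phi> (x + z) - \<phi> x)\<^sup>2) \<partial>lborel) \<le> ennreal ((norm z)\<^sup>2) * (\<integral>\<^sup>+x. ennreal ((norm (g x))\<^sup>2) \<partial>lborel)"
proof -
  note [measurable] = C1_compactD(8,9)[OF C]
  define I where "I = density lborel (indicator {0..1::real})"
  have [measurable_cong]: "sets I = sets borel" by (simp add: I_def)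
  have I1: "emeasure I (space I) \<le> 1" by (simp add: I_def emeasure_density)
  interpret I: finite_measure I using I1 by (intro finite_measureI) (auto simp: top_unique)
  interpret pair_sigma_finite lborel I
    by (simp add: pair_sigma_finite_def sigma_finite_lborel I.sigma_finite_measure_axioms)
  have "ennreal ((\<phi> (x + z) - \<phi> x)\<^sup>2) \<le> (\<integral>\<^sup>+s. ennreal ((norm z)\<^sup>2 * (norm (g (x + s *\<^sub>R z)))\<^sup>2) \<partial>I)" for x
  proof -
    have "(LINT s|lborel. (g (x + s *\<^sub>R z) \<bullet> z) * indicator {0..1} s) = \<phi> (x + 1 *\<^sub>R z) - \<phi> (x + 0 *\<^sub>R z)"
    proof (rule integral_FTC_Icc_real)
      fix s :: real
      have "((\<lambda>s. x + s *\<^sub>R z) has_derivative (\<lambda>h. h *\<^sub>R z)) (at s)"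
        by (auto intro!: derivative_eq_intros)
      moreover have "(\<phi> has_derivative (\<lambda>h. h \<bullet> g (x + s *\<^sub>R z))) (at (x + s *\<^sub>R z))"
        using C1_compactD(1)[OF C] by (simp add: gderiv_def inner_commute)
      ultimately have "((\<lambda>s. \<phi> (x + s *\<^sub>R z)) has_derivative (\<lambda>h. (h *\<^sub>R z) \<bullet> g (x + s *\<^sub>R z))) (at s)"
        by (rule has_derivative_compose)
      moreover have "(\<lambda>h. (h *\<^sub>R z) \<bullet> g (x + s *\<^sub>R z)) = (*) (g (x + s *\<^sub>R z) \<bullet> z)"
        by (auto simp: fun_eq_iff inner_commute)
      ultimately show "((\<lambda>s. \<phi> (x + s *\<^sub>R z)) has_real_derivative g (x + s *\<^sub>R z) \<bullet> z) (at s)"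
        by (simp only: has_field_derivative_def)
      have gc: "isCont g y" for y
        using C1_compactD(2)[OF C] by (simp add: continuous_on_eq_continuous_at)
      have "isCont (\<lambda>s. x + s *\<^sub>R z) s" by (intro continuous_intros)
      from isCont_o2[OF this gc] have "isCont (\<lambda>s. g (x + s *\<^sub>R z)) s" .
      then show "isCont (\<lambda>s. g (x + s *\<^sub>R z) \<bullet> z) s"
        by (intro continuous_intros)
    qed simp
    also have "(LINT s|lborel. (g (x + s *\<^sub>R z) \<bullet> z) * indicator {0..1} s) = (LINT s|I. g (x + s *\<^sub>R z) \<bullet> z)"
      unfolding I_def ennreal_indicator[symmetric]
      by (subst integral_density) (auto simp: mult.commute)
    finally have "\<phi> (x + z) - \<phi> x = (LINT s|I. g (x + s *\<^sub>R z) \<bullet> z)" by simp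
    then have "ennreal ((\<phi> (x + z) - \<phi> x)\<^sup>2) \<le> (\<integral>\<^sup>+s. ennreal ((g (x + s *\<^sub>R z) \<bullet> z)\<^sup>2) \<partial>I)"
      using square_integral_le_nn_integral[OF I1, of "\<lambda>s. g (x + s *\<^sub>R z) \<bullet> z"] by simp
    also have "\<dots> \<le> (\<integral>\<^sup>+s. ennreal ((norm z)\<^sup>2 * (norm (g (x + s *\<^sub>R z)))\<^sup>2) \<partial>I)"
    proof (intro nn_integral_mono ennreal_leI)
      fix s
      have "(g (x + s *\<^sub>R z) \<bullet> z)\<^sup>2 \<le> (norm (g (x + s *\<^sub>R z)) * norm z)\<^sup>2"
        using Cauchy_Schwarz_ineq2[of "g (x + s *\<^sub>R z)" z] by (simp add: abs_le_square_iff[symmetric] abs_mult)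
      then show "(g (x + s *\<^sub>R z) \<bullet> z)\<^sup>2 \<le> (norm z)\<^sup>2 * (norm (g (x + s *\<^sub>R z)))\<^sup>2"
        by (simp add: power_mult_distrib mult.commute)
    qed
    finally show ?thesis .
  qed
  then have "(\<integral>\<^sup>+x. ennreal ((\<phi> (x + z) - \<phi> x)\<^sup>2) \<partial>lborel) \<le>
    (\<integral>\<^sup>+x. \<integral>\<^sup>+s. ennreal ((norm z)\<^sup>2 * (norm (g (x + s *\<^sub>R z)))\<^sup>2) \<partial>I \<partial>lborel)"
    by (intro nn_integral_mono)
  also have "\<dots> = (\<integral>\<^sup>+s. \<integral>\<^sup>+x. ennreal ((norm z)\<^sup>2 * (norm (g (x + s *\<^sub>R z)))\<^sup>2) \<partial>lborel \<partial>I)"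
    by (rule Fubini'[symmetric]) measurable
  also have "\<dots> = (\<integral>\<^sup>+s. ennreal ((norm z)\<^sup>2) * (\<integral>\<^sup>+x. ennreal ((norm (g x))\<^sup>2) \<partial>lborel) \<partial>I)"
  proof (intro nn_integral_cong)
    fix s
    have "(\<integral>\<^sup>+x. ennreal ((norm z)\<^sup>2 * (norm (g (x + s *\<^sub>R z)))\<^sup>2) \<partial>lborel) =
      ennreal ((norm z)\<^sup>2) * (\<integral>\<^sup>+x. ennreal ((norm (g (x + s *\<^sub>R z)))\<^sup>2) \<partial>lborel)"
      by (simp add: ennreal_mult nn_integral_cmult)
    also have "(\<integral>\<^sup>+x. ennreal ((norm (g (x + s *\<^sub>R z)))\<^sup>2) \<partial>lborel) = (\<integral>\<^sup>+x. ennreal ((norm (g x))\<^sup>2) \<partial>lborel)"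
      by (rule nn_integral_lborel_translate) measurable
    finally show "(\<integral>\<^sup>+x. ennreal ((norm z)\<^sup>2 * (norm (g (x + s *\<^sub>R z)))\<^sup>2) \<partial>lborel) =
      ennreal ((norm z)\<^sup>2) * (\<integral>\<^sup>+x. ennreal ((norm (g x))\<^sup>2) \<partial>lborel)" .
  qed
  also have "\<dots> = ennreal ((norm z)\<^sup>2) * (\<integral>\<^sup>+x. ennreal ((norm (g x))\<^sup>2) \<partial>lborel) * emeasure I (space I)"
    by (rule nn_integral_const)
  also have "\<dots> \<le> ennreal ((norm z)\<^sup>2) * (\<integral>\<^sup>+x. ennreal ((norm (g x))\<^sup>2) \<partial>lborel) * 1"
    by (intro mult_left_mono I1) simp
  finally show ?thesis by simp
qed

text \<open>A normalised cone, Lipschitz but not smooth: the kernel only has to make averages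
  equicontinuous. The single constant \<open>B\<close> bounds both the kernel and its Lipschitz
  constant.\<close>

lemma mollifier_exists:
  fixes \<epsilon> :: real
  assumes "\<epsilon> > 0"
  obtains k :: "'a::euclidean_space \<Rightarrow> real" and B :: real
  where "\<And>z. 0 \<le> k z" "\<And>z. k z \<le> B" "\<And>z. \<epsilon> \<le> norm z \<Longrightarrow> k z = 0"
    "\<And>x y. \<bar>k x - k y\<bar> \<le> B * norm (x - y)" "continuous_on UNIV k" "integrable lborel k"
    "(LINT z|lborel. k z) = 1" "B \<ge> 0"
proof -
  define h where "h z = max 0 (\<epsilon> - norm z)" for z :: 'a
  have h_cont: "continuous_on UNIV h" unfolding h_def by (intro continuous_intros)
  have h_int: "integrable lborel h"
    by (rule integrable_continuous_zero_outside_compact[OF h_cont compact_cball[of 0 \<epsilon>]])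
      (simp add: h_def)
  define c where "c = (LINT z|lborel. h z)"
  have "0 < \<epsilon> / 2 * measure lborel (ball (0::'a) (\<epsilon>/2))"
    using assms content_ball_pos[of "\<epsilon>/2" "0::'a"] by simp
  also have "\<dots> = (LINT z|lborel. \<epsilon> / 2 * indicator (ball 0 (\<epsilon>/2)) (z::'a))"
    by simp
  also have "\<dots> \<le> c"
    unfolding c_def
  proof (intro integral_mono h_int)
    show "integrable lborel (\<lambda>z::'a. \<epsilon> / 2 * indicator (ball 0 (\<epsilon>/2)) z)"
      using emeasure_lborel_ball_finite[of "0::'a" "\<epsilon>/2"]
      by (intro integrable_mult_right integrable_real_indicator) auto
  qed (use assms in \<open>auto simp: h_def indicator_def\<close>)
  finally have c: "c > 0" .
  define B where "B = max (1 / c) (\<epsilon> / c)"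
  show thesis
  proof (rule that[of "\<lambda>z. h z / c" B])
    show "0 \<le> h z / c" for z using c by (simp add: h_def)
    show "h z / c \<le> B" for z
    proof -
      have "h z \<le> \<epsilon>" using assms by (simp add: h_def)
      then have "h z / c \<le> \<epsilon> / c" using c by (simp add: divide_right_mono)
      then show ?thesis by (simp add: B_def)
    qed
    show "h z / c = 0" if "\<epsilon> \<le> norm z" for z using that by (simp add: h_def)
    show "\<bar>h x / c - h y / c\<bar> \<le> B * norm (x - y)" for x y
    proof -
      have "\<bar>h x - h y\<bar> \<le> norm (x - y)"
        using norm_triangle_ineq3[of x y] by (auto simp: h_def max_def)
      then have "\<bar>h x - h y\<bar> / c \<le> norm (x - y) / c" using c by (simp add: divide_right_mono)
      also have "\<dots> \<le> B * norm (x - y)"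
        using mult_right_mono[of "1/c" B "norm (x - y)"] by (simp add: B_def)
      finally show ?thesis using c by (simp flip: diff_divide_distrib)
    qed
    show "continuous_on UNIV (\<lambda>z. h z / c)" using c by (intro continuous_intros h_cont) auto
    show "integrable lborel (\<lambda>z. h z / c)" using h_int by simp
    show "(LINT z|lborel. h z / c) = 1" using c by (simp add: c_def[symmetric])
    show "B \<ge> 0" using c assms by (simp add: B_def le_max_iff_disj)
  qed
qed

text \<open>The mollification is an average of the translates of \<open>\<phi>\<close> by vectors
  \<open>z\<close> with \<open>norm z < \<epsilon>\<close>, taken against a probability density. The
  square of the average is at most the average of the squares, and each translate is within the
  difference quotient bound.\<close>

lemma mollification_error:
  fixes \<phi> :: "'a::euclidean_space \<Rightarrow> real"
  assumes C: "C1_compact \<Omega> \<phi> g"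
    and k: "\<And>z. 0 \<le> k z" "\<And>z. \<epsilon> \<le> norm z \<Longrightarrow> k z = 0" "continuous_on UNIV k" "integrable lborel k"
      "(LINT z|lborel. k z) = 1" and \<epsilon>: "0 < \<epsilon>"
  shows "(\<integral>\<^sup>+x. ennreal (((LINT y|lborel. k (y - x) * \<phi> y) - \<phi> x)\<^sup>2) \<partial>lborel) \<le>
    ennreal (\<epsilon>\<^sup>2) * (\<integral>\<^sup>+x. ennreal ((norm (g x))\<^sup>2) \<partial>lborel)"
proof -
  note [measurable] = C1_compactD(8,9)[OF C]
  have [measurable]: "k \<in> borel_measurable borel" using k(3) by (rule borel_measurable_continuous_onI)
  define M where "M = density lborel (\<lambda>z. ennreal (k z))"
  have [measurable_cong]: "sets M = sets borel" by (simp add: M_def)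
  have k1: "(\<integral>\<^sup>+z. ennreal (k z) \<partial>lborel) = 1"
    using nn_integral_eq_integral[OF k(4)] k(1,5) by simp
  then have M1: "emeasure M (space M) \<le> 1"
    by (simp add: M_def emeasure_density)
  interpret M: finite_measure M using M1 by (intro finite_measureI) (auto simp: top_unique)
  interpret pair_sigma_finite lborel M
    by (simp add: pair_sigma_finite_def sigma_finite_lborel M.sigma_finite_measure_axioms)
  have int\<phi>: "integrable lborel (\<lambda>z. k z * \<phi> (x + z))" for x
  proof (rule integrable_continuous_zero_outside_compact)
    show "continuous_on UNIV (\<lambda>z. k z * \<phi> (x + z))"
      by (intro continuous_intros k(3) continuous_on_compose2[OF C1_compactD(3)[OF C]]) auto
    show "k z * \<phi> (x + z) = 0" if "z \<notin> cball 0 \<epsilon>" for z using k(2)[of z] that by simp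
  qed simp
  have eq: "(LINT y|lborel. k (y - x) * \<phi> y) - \<phi> x = (LINT z|M. \<phi> (x + z) - \<phi> x)" for x
  proof -
    have "(LINT y|lborel. k (y - x) * \<phi> y) = (LINT y|distr lborel borel ((+) x). k (y - x) * \<phi> y)"
      by (simp add: lborel_distr_plus)
    also have "\<dots> = (LINT z|lborel. k z * \<phi> (x + z))"
      by (subst integral_distr) auto
    finally have "(LINT y|lborel. k (y - x) * \<phi> y) - \<phi> x = (LINT z|lborel. k z * \<phi> (x + z)) - (LINT z|lborel. k z * \<phi> x)"
      using k(5) by simp
    also have "\<dots> = (LINT z|lborel. k z * \<phi> (x + z) - k z * \<phi> x)"
      using int\<phi>[of x] k(4) by (intro Bochner_Integration.integral_diff[symmetric]) auto
    also have "\<dots> = (LINT z|M. \<phi> (x + z) - \<phi> x)"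
      unfolding M_def using k(1) by (subst integral_density) (auto simp: algebra_simps)
    finally show ?thesis .
  qed
  have "(\<integral>\<^sup>+x. ennreal (((LINT y|lborel. k (y - x) * \<phi> y) - \<phi> x)\<^sup>2) \<partial>lborel) \<le>
    (\<integral>\<^sup>+x. \<integral>\<^sup>+z. ennreal ((\<phi> (x + z) - \<phi> x)\<^sup>2) \<partial>M \<partial>lborel)"
    unfolding eq by (intro nn_integral_mono square_integral_le_nn_integral M1) measurable
  also have "\<dots> = (\<integral>\<^sup>+z. \<integral>\<^sup>+x. ennreal ((\<phi> (x + z) - \<phi> x)\<^sup>2) \<partial>lborel \<partial>M)"
    by (rule Fubini'[symmetric]) measurable
  also have "\<dots> \<le> (\<integral>\<^sup>+z. ennreal ((norm z)\<^sup>2) * (\<integral>\<^sup>+x. ennreal ((norm (g x))\<^sup>2) \<partial>lborel) \<partial>M)"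
    by (intro nn_integral_mono nn_integral_difference_quotient_le[OF C])
  also have "\<dots> = (\<integral>\<^sup>+z. ennreal (k z) * (ennreal ((norm z)\<^sup>2) * (\<integral>\<^sup>+x. ennreal ((norm (g x))\<^sup>2) \<partial>lborel)) \<partial>lborel)"
    unfolding M_def by (intro nn_integral_density) measurable
  also have "\<dots> \<le> (\<integral>\<^sup>+z. ennreal (k z) * (ennreal (\<epsilon>\<^sup>2) * (\<integral>\<^sup>+x. ennreal ((norm (g x))\<^sup>2) \<partial>lborel)) \<partial>lborel)"
  proof (rule nn_integral_mono)
    fix z :: 'a
    show "ennreal (k z) * (ennreal ((norm z)\<^sup>2) * (\<integral>\<^sup>+x. ennreal ((norm (g x))\<^sup>2) \<partial>lborel)) \<le>
      ennreal (k z) * (ennreal (\<epsilon>\<^sup>2) * (\<integral>\<^sup>+x. ennreal ((norm (g x))\<^sup>2) \<partial>lborel))"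
    proof (cases "norm z \<le> \<epsilon>")
      case True
      then show ?thesis by (intro mult_left_mono mult_right_mono ennreal_leI power_mono) auto
    next
      case False
      then show ?thesis using k(2)[of z] by simp
    qed
  qed
  also have "\<dots> = (\<integral>\<^sup>+z. ennreal (k z) \<partial>lborel) * (ennreal (\<epsilon>\<^sup>2) * (\<integral>\<^sup>+x. ennreal ((norm (g x))\<^sup>2) \<partial>lborel))"
    by (rule nn_integral_multc) measurable
  also have "\<dots> = ennreal (\<epsilon>\<^sup>2) * (\<integral>\<^sup>+x. ennreal ((norm (g x))\<^sup>2) \<partial>lborel)"
    using k1 by simp
  finally show ?thesis .
qed

text \<open>At a fixed scale \<open>\<epsilon>\<close> the mollified functions are uniformly bounded
  and equicontinuous, so Arzela-Ascoli selects a uniformly convergent subsequence; the mollification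
  error is controlled by the gradient bound. Only a fixed tolerance \<open>\<delta>\<close> is
  reached, because \<open>\<epsilon>\<close> depends on it.\<close>

lemma C1_compact_subseq_close:
  fixes \<Omega> :: "'a::euclidean_space set"
  assumes \<Omega>: "bounded \<Omega>"
    and C1: "\<And>n. C1_compact \<Omega> (\<phi> n) (g n)"
    and L2: "\<And>n. (\<integral>\<^sup>+x. ennreal ((\<phi> n x)\<^sup>2) \<partial>lborel) \<le> 1"
    and grad: "\<And>n. (\<integral>\<^sup>+x. ennreal ((norm (g n x))\<^sup>2) \<partial>lborel) \<le> ennreal C"
    and C: "C \<ge> 0" and \<delta>: "\<delta> > 0"
  shows "\<exists>r::nat \<Rightarrow> nat. strict_mono r \<and>
    (\<forall>i j. (\<integral>\<^sup>+x. ennreal ((\<phi> (r i) x - \<phi> (r j) x)\<^sup>2) \<partial>lborel) \<le> ennreal \<delta>)"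
proof -
  note [measurable] = C1_compactD(8,9)[OF C1]
  obtain R where "\<forall>x\<in>\<Omega>. norm x \<le> R" using \<Omega> by (auto simp: bounded_iff)
  then have R: "\<Omega> \<subseteq> cball 0 R" by auto
  define K where "K = cball (0::'a) R"
  have [measurable]: "K \<in> sets borel" by (simp add: K_def)
  define V where "V = measure lborel K"
  have V: "emeasure lborel K = ennreal V" "V \<ge> 0"
    using emeasure_lborel_cball_finite[of "0::'a" R]
    by (auto simp: V_def K_def emeasure_eq_ennreal_measure less_top[symmetric])
  have \<phi>0: "\<phi> n x = 0" if "x \<notin> K" for n x
    by (rule C1_compactD(6)[OF C1]) (use that R in \<open>auto simp: K_def\<close>)
  \<comment> \<open>Two applications of the squared triangle inequality count the mollification
    error \<open>\<epsilon>\<^sup>2 * C\<close> six times and the uniform error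
    \<open>\<theta>\<^sup>2 * V\<close> four times. The constants here and in
    \<open>\<theta>\<close> make each contribution at most \<open>\<delta> / 2\<close>, and
    \<open>C + 1\<close>, \<open>V + 1\<close> avoid division by zero.\<close>
  define \<epsilon> where "\<epsilon> = sqrt (\<delta> / (12 * (C + 1)))"
  have \<epsilon>: "\<epsilon> > 0" using C \<delta> by (simp add: \<epsilon>_def)
  have \<epsilon>C: "6 * (\<epsilon>\<^sup>2 * C) \<le> \<delta> / 2"
  proof -
    have "\<epsilon>\<^sup>2 = \<delta> / (12 * (C + 1))" using C \<delta> by (simp add: \<epsilon>_def)
    then have "12 * \<epsilon>\<^sup>2 + 12 * (\<epsilon>\<^sup>2 * C) = \<delta>" using C by (simp add: field_simps)
    then show ?thesis using zero_le_power2[of \<epsilon>] by linarith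
  qed
  define \<theta> where "\<theta> = sqrt (\<delta> / (8 * (V + 1)))"
  have \<theta>: "\<theta> > 0" using V \<delta> by (simp add: \<theta>_def)
  have \<theta>V: "4 * (\<theta>\<^sup>2 * V) \<le> \<delta> / 2"
  proof -
    have "\<theta>\<^sup>2 = \<delta> / (8 * (V + 1))" using V \<delta> by (simp add: \<theta>_def)
    then have "8 * \<theta>\<^sup>2 + 8 * (\<theta>\<^sup>2 * V) = \<delta>" using V by (simp add: field_simps)
    then show ?thesis using zero_le_power2[of \<theta>] by linarith
  qed
  obtain k :: "'a \<Rightarrow> real" and B where k: "\<And>z. 0 \<le> k z" "\<And>z. k z \<le> B" "\<And>z. \<epsilon> \<le> norm z \<Longrightarrow> k z = 0"
    "\<And>x y. \<bar>k x - k y\<bar> \<le> B * norm (x - y)" "continuous_on UNIV k" "integrable lborel k"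
    "(LINT z|lborel. k z) = 1" "B \<ge> 0"
    by (rule mollifier_exists[OF \<epsilon>], rule that)
  have [measurable]: "k \<in> borel_measurable borel" using k(5) by (rule borel_measurable_continuous_onI)
  define m where "m n x = (LINT y|lborel. k (y - x) * \<phi> n y)" for n x
  have \<phi>_int: "integrable lborel (\<phi> n)" for n
    by (rule integrable_continuous_zero_outside_compact[OF C1_compactD(3)[OF C1] compact_cball[of 0 R]])
      (use \<phi>0 K_def in auto)
  \<comment> \<open>The square integral bounds the integral of \<open>\<bar>\<phi> n\<bar>\<close>
    because \<bar>y\<bar> \<le> 1 + y^2 and all functions live on the set \<open>K\<close> of finite
    volume.\<close>
  have L1: "(LINT y|lborel. \<bar>\<phi> n y\<bar>) \<le> V + 1" for n
  proof -
    have "ennreal (LINT y|lborel. \<bar>\<phi> n y\<bar>) = (\<integral>\<^sup>+y. ennreal \<bar>\<phi> n y\<bar> \<partial>lborel)"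
      using \<phi>_int by (intro nn_integral_eq_integral[symmetric]) auto
    also have "\<dots> \<le> (\<integral>\<^sup>+y. indicator K y + ennreal ((\<phi> n y)\<^sup>2) \<partial>lborel)"
    proof (rule nn_integral_mono)
      fix y
      show "ennreal \<bar>\<phi> n y\<bar> \<le> indicator K y + ennreal ((\<phi> n y)\<^sup>2)"
      proof (cases "y \<in> K")
        case True
        have "\<bar>\<phi> n y\<bar> \<le> 1 + (\<phi> n y)\<^sup>2"
          using sum_squares_bound[of 1 "\<bar>\<phi> n y\<bar>"] by simp
        then have "ennreal \<bar>\<phi> n y\<bar> \<le> ennreal (1 + (\<phi> n y)\<^sup>2)" by (rule ennreal_leI)
        then show ?thesis using True by (simp add: ennreal_plus)
      next
        case False
        then show ?thesis using \<phi>0 by simp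
      qed
    qed
    also have "\<dots> = emeasure lborel K + (\<integral>\<^sup>+y. ennreal ((\<phi> n y)\<^sup>2) \<partial>lborel)"
      by (subst nn_integral_add) auto
    also have "\<dots> \<le> ennreal V + 1" using V L2 by (intro add_mono) auto
    finally have "ennreal (LINT y|lborel. \<bar>\<phi> n y\<bar>) \<le> ennreal (V + 1)" using V by (simp add: ennreal_plus)
    then show ?thesis by (subst (asm) ennreal_le_iff) (use V in auto)
  qed
  have mk_int: "integrable lborel (\<lambda>y. k (y - x) * \<phi> n y)" for n x
  proof (rule Bochner_Integration.integrable_bound[OF integrable_mult_right[OF \<phi>_int[of n], of B]])
    show "AE y in lborel. norm (k (y - x) * \<phi> n y) \<le> norm (B * \<phi> n y)"
      using k(1,2,8) by (auto simp: abs_mult intro!: mult_right_mono)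
  qed measurable
  have m_diff: "\<bar>m n x - m n y\<bar> \<le> B * norm (x - y) * (V + 1)" for n x y
  proof -
    have "m n x - m n y = (LINT z|lborel. (k (z - x) - k (z - y)) * \<phi> n z)"
      unfolding m_def using mk_int by (subst Bochner_Integration.integral_diff[symmetric]) (auto simp: algebra_simps)
    also have "\<bar>\<dots>\<bar> \<le> (LINT z|lborel. B * norm (x - y) * \<bar>\<phi> n z\<bar>)"
      unfolding real_norm_def[symmetric]
    proof (rule Bochner_Integration.integral_norm_bound_integral)
      show "integrable lborel (\<lambda>z. (k (z - x) - k (z - y)) * \<phi> n z)"
        using Bochner_Integration.integrable_diff[OF mk_int[of x n] mk_int[of y n]] by (simp add: algebra_simps)
      show "integrable lborel (\<lambda>z. B * norm (x - y) * norm (\<phi> n z))"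
        using \<phi>_int by (intro integrable_mult_right integrable_norm)
      fix z
      have "\<bar>k (z - x) - k (z - y)\<bar> \<le> B * norm (x - y)"
        using k(4)[of "z - x" "z - y"] by (simp add: norm_minus_commute)
      then show "norm ((k (z - x) - k (z - y)) * \<phi> n z) \<le> B * norm (x - y) * norm (\<phi> n z)"
        by (simp add: abs_mult mult_right_mono)
    qed
    also have "\<dots> = B * norm (x - y) * (LINT z|lborel. \<bar>\<phi> n z\<bar>)" by simp
    also have "\<dots> \<le> B * norm (x - y) * (V + 1)" using k(8) L1 by (intro mult_left_mono) auto
    finally show ?thesis .
  qed
  have m_bound: "\<bar>m n x\<bar> \<le> B * (V + 1)" for n x
  proof -
    have "\<bar>m n x\<bar> \<le> (LINT z|lborel. B * \<bar>\<phi> n z\<bar>)"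
      unfolding m_def real_norm_def[symmetric]
      using mk_int[of x n] \<phi>_int[of n] k(1,2)
      by (intro Bochner_Integration.integral_norm_bound_integral) (auto simp: abs_mult intro!: mult_right_mono)
    also have "\<dots> = B * (LINT z|lborel. \<bar>\<phi> n z\<bar>)" by simp
    also have "\<dots> \<le> B * (V + 1)" using k(8) L1 by (intro mult_left_mono) auto
    finally show ?thesis .
  qed
  obtain l s where s: "strict_mono (s :: nat \<Rightarrow> nat)"
    and conv: "\<And>e. 0 < e \<Longrightarrow> \<exists>N. \<forall>n x. n \<ge> N \<and> x \<in> K \<longrightarrow> norm (m (s n) x - l x) < e"
  proof (rule Arzela_Ascoli[of K m "B * (V + 1)"])
    show "compact K" by (simp add: K_def)
    show "norm (m n x) \<le> B * (V + 1)" for n x using m_bound by simp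
    fix x and e :: real assume e: "0 < e"
    define d where "d = e / (B * (V + 1) + 1)"
    have pos: "B * (V + 1) + 1 > 0" using k(8) V by (simp add: add_nonneg_pos)
    have "norm (m n x - m n y) < e" if "norm (x - y) < d" for n y
    proof -
      have "\<bar>m n x - m n y\<bar> \<le> norm (x - y) * (B * (V + 1))" using m_diff[of n x y] by (simp add: mult_ac)
      also have "\<dots> \<le> d * (B * (V + 1))" using that k(8) V by (intro mult_right_mono) auto
      also have "\<dots> < e" using pos e by (simp add: d_def field_simps)
      finally show ?thesis by simp
    qed
    then show "\<exists>d>0. \<forall>n y. y \<in> K \<and> norm (x - y) < d \<longrightarrow> norm (m n x - m n y) < e"
      using e pos by (intro exI[of _ d]) (auto simp: d_def)
  qed blast
  obtain N where N: "\<And>n x. n \<ge> N \<Longrightarrow> x \<in> K \<Longrightarrow> \<bar>m (s n) x - l x\<bar> < \<theta> / 2"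
    using conv[of "\<theta> / 2"] \<theta> by auto
  define r where "r n = s (n + N)" for n
  have "strict_mono r" using s by (auto simp: r_def strict_mono_def)
  have m_cont: "continuous_on UNIV (m n)" for n
  proof -
    have "(B * (V + 1))-lipschitz_on UNIV (m n)"
      using m_diff[of n] k(8) V by (intro lipschitz_onI) (auto simp: dist_norm mult_ac)
    then show ?thesis by (rule lipschitz_on_continuous_on)
  qed
  have [measurable]: "m n \<in> borel_measurable borel" for n
    by (rule borel_measurable_continuous_onI[OF m_cont])
  \<comment> \<open>Mollification spreads mass outside \<open>K\<close>, whereas uniform convergence
    is known on \<open>K\<close> only. Cutting off can only reduce the distance to
    \<open>\<phi> n\<close>, which vanishes off \<open>K\<close>.\<close>
  define b where "b n x = indicator K x * m n x" for n x
  have [measurable]: "b n \<in> borel_measurable borel" for n unfolding b_def by measurable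
  have close_b: "(\<integral>\<^sup>+x. ennreal ((norm (b n x - \<phi> n x))\<^sup>2) \<partial>lborel) \<le> ennreal (\<epsilon>\<^sup>2 * C)" for n
  proof -
    have "(\<integral>\<^sup>+x. ennreal ((norm (b n x - \<phi> n x))\<^sup>2) \<partial>lborel) \<le> (\<integral>\<^sup>+x. ennreal ((m n x - \<phi> n x)\<^sup>2) \<partial>lborel)"
      by (intro nn_integral_mono ennreal_leI) (auto simp: b_def \<phi>0 indicator_def)
    also have "\<dots> \<le> ennreal (\<epsilon>\<^sup>2) * (\<integral>\<^sup>+x. ennreal ((norm (g n x))\<^sup>2) \<partial>lborel)"
      unfolding m_def by (rule mollification_error[OF C1 k(1) k(3) k(5,6,7) \<epsilon>])
    also have "\<dots> \<le> ennreal (\<epsilon>\<^sup>2) * ennreal C" by (intro mult_left_mono grad) auto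
    finally show ?thesis using C by (simp add: ennreal_mult)
  qed
  have close_b': "(\<integral>\<^sup>+x. ennreal ((norm (\<phi> n x - b n x))\<^sup>2) \<partial>lborel) \<le> ennreal (\<epsilon>\<^sup>2 * C)" for n
    using close_b[of n] by (simp only: norm_minus_commute)
  have bb: "(\<integral>\<^sup>+x. ennreal ((norm (b (r i) x - b (r j) x))\<^sup>2) \<partial>lborel) \<le> ennreal (\<theta>\<^sup>2 * V)" for i j
  proof -
    have "(\<integral>\<^sup>+x. ennreal ((norm (b (r i) x - b (r j) x))\<^sup>2) \<partial>lborel) \<le> (\<integral>\<^sup>+x. ennreal (\<theta>\<^sup>2) * indicator K x \<partial>lborel)"
    proof (rule nn_integral_mono)
      fix x
      show "ennreal ((norm (b (r i) x - b (r j) x))\<^sup>2) \<le> ennreal (\<theta>\<^sup>2) * indicator K x"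
      proof (cases "x \<in> K")
        case True
        have "\<bar>m (r i) x - m (r j) x\<bar> \<le> \<theta>"
          using N[of "i + N" x] N[of "j + N" x] True unfolding r_def by linarith
        then have "\<bar>m (r i) x - m (r j) x\<bar>\<^sup>2 \<le> \<theta>\<^sup>2" by (intro power_mono) auto
        then show ?thesis using True by (simp add: b_def ennreal_leI)
      next
        case False
        then show ?thesis by (simp add: b_def)
      qed
    qed
    also have "\<dots> = ennreal (\<theta>\<^sup>2 * V)"
      using V by (simp add: nn_integral_cmult_indicator ennreal_mult)
    finally show ?thesis .
  qed
  have "(\<integral>\<^sup>+x. ennreal ((\<phi> (r i) x - \<phi> (r j) x)\<^sup>2) \<partial>lborel) \<le> ennreal \<delta>" for i j
  proof -
    have "(\<integral>\<^sup>+x. ennreal ((norm (\<phi> (r i) x - \<phi> (r j) x))\<^sup>2) \<partial>lborel) \<le>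
      2 * (\<integral>\<^sup>+x. ennreal ((norm (\<phi> (r i) x - b (r i) x))\<^sup>2) \<partial>lborel) +
      2 * (\<integral>\<^sup>+x. ennreal ((norm (b (r i) x - \<phi> (r j) x))\<^sup>2) \<partial>lborel)"
      by (rule nn_integral_dist_sq_triangle) measurable
    also have "\<dots> \<le> 2 * ennreal (\<epsilon>\<^sup>2 * C) + 2 *
      (2 * (\<integral>\<^sup>+x. ennreal ((norm (b (r i) x - b (r j) x))\<^sup>2) \<partial>lborel) +
       2 * (\<integral>\<^sup>+x. ennreal ((norm (b (r j) x - \<phi> (r j) x))\<^sup>2) \<partial>lborel))"
      by (intro add_mono mult_left_mono close_b' nn_integral_dist_sq_triangle) auto
    also have "\<dots> \<le> 2 * ennreal (\<epsilon>\<^sup>2 * C) + 2 * (2 * ennreal (\<theta>\<^sup>2 * V) + 2 * ennreal (\<epsilon>\<^sup>2 * C))"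
      by (intro add_mono mult_left_mono bb close_b order_refl) auto
    also have "\<dots> = ennreal (2 * (\<epsilon>\<^sup>2 * C) + 2 * (2 * (\<theta>\<^sup>2 * V) + 2 * (\<epsilon>\<^sup>2 * C)))"
    proof -
      have "2 * ennreal a + 2 * (2 * ennreal b + 2 * ennreal a) = ennreal (2 * a + 2 * (2 * b + 2 * a))"
        if "0 \<le> a" "0 \<le> b" for a b
        using that by (simp only: ennreal_numeral[symmetric] ennreal_mult[symmetric]
          ennreal_plus[symmetric] zero_le_numeral mult_nonneg_nonneg add_nonneg_nonneg)
      then show ?thesis using C V by simp
    qed
    also have "\<dots> \<le> ennreal \<delta>" using \<epsilon>C \<theta>V by (intro ennreal_leI) (simp add: algebra_simps)
    finally show ?thesis by simp
  qed
  with \<open>strict_mono r\<close> show ?thesis by blast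
qed

text \<open>Stage \<open>n\<close> selects for tolerance \<open>1 / real (Suc n)\<close>. The
  property \<open>P n\<close> passes to further subsequences, so a tail of the diagonal sequence
  satisfies it for each \<open>n\<close>.\<close>

lemma C1_compact_Cauchy_subseq:
  fixes \<Omega> :: "'a::euclidean_space set"
  assumes \<Omega>: "bounded \<Omega>"
    and C1: "\<And>n. C1_compact \<Omega> (\<phi> n) (g n)"
    and L2: "\<And>n. (\<integral>\<^sup>+x. ennreal ((\<phi> n x)\<^sup>2) \<partial>lborel) \<le> 1"
    and grad: "\<And>n. (\<integral>\<^sup>+x. ennreal ((norm (g n x))\<^sup>2) \<partial>lborel) \<le> ennreal C" and C: "C \<ge> 0"
  obtains r :: "nat \<Rightarrow> nat" where "strict_mono r"
    "\<And>e. e > 0 \<Longrightarrow> \<exists>N. \<forall>i\<ge>N. \<forall>j\<ge>N. (\<integral>\<^sup>+x. ennreal ((\<phi> (r i) x - \<phi> (r j) x)\<^sup>2) \<partial>lborel) \<le> ennreal e"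
proof -
  define P where "P n s \<longleftrightarrow> (\<forall>i j. (\<integral>\<^sup>+x. ennreal ((\<phi> (s i) x - \<phi> (s j) x)\<^sup>2) \<partial>lborel) \<le> ennreal (1 / real (Suc n)))"
    for n and s :: "nat \<Rightarrow> nat"
  interpret subseqs P
  proof
    fix n and s :: "nat \<Rightarrow> nat"
    obtain r :: "nat \<Rightarrow> nat" where "strict_mono r"
      "\<forall>i j. (\<integral>\<^sup>+x. ennreal ((\<phi> (s (r i)) x - \<phi> (s (r j)) x)\<^sup>2) \<partial>lborel) \<le> ennreal (1 / real (Suc n))"
      using C1_compact_subseq_close[of \<Omega> "\<lambda>n. \<phi> (s n)" "\<lambda>n. g (s n)" C "1 / real (Suc n)",
        OF \<Omega> C1 L2 grad C] by auto
    then show "\<exists>r'. strict_mono r' \<and> P n (s \<circ> r')" by (auto simp: P_def)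
  qed
  have P: "P n (diagseq \<circ> (+) (Suc n))" for n
    by (rule diagseq_holds) (auto simp: P_def)
  have PD: "(\<integral>\<^sup>+x. ennreal ((\<phi> (s i) x - \<phi> (s j) x)\<^sup>2) \<partial>lborel) \<le> ennreal (1 / real (Suc n))"
    if "P n s" for n s i j using that unfolding P_def by blast
  show thesis
  proof (rule that[OF subseq_diagseq])
    fix e :: real assume "e > 0"
    obtain n where n: "1 / real (Suc n) < e" by (rule nat_approx_posE[OF \<open>e > 0\<close>])
    have "(\<integral>\<^sup>+x. ennreal ((\<phi> (diagseq i) x - \<phi> (diagseq j) x)\<^sup>2) \<partial>lborel) \<le> ennreal e"
      if "i \<ge> Suc n" "j \<ge> Suc n" for i j
    proof -
      have "(\<integral>\<^sup>+x. ennreal ((\<phi> (diagseq i) x - \<phi> (diagseq j) x)\<^sup>2) \<partial>lborel) \<le> ennreal (1 / real (Suc n))"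
        using PD[OF P[of n], of "i - Suc n" "j - Suc n"] that by (simp del: of_nat_Suc)
      also have "\<dots> \<le> ennreal e" using n by (intro ennreal_leI) simp
      finally show ?thesis .
    qed
    then show "\<exists>N. \<forall>i\<ge>N. \<forall>j\<ge>N. (\<integral>\<^sup>+x. ennreal ((\<phi> (diagseq i) x - \<phi> (diagseq j) x)\<^sup>2) \<partial>lborel) \<le> ennreal e"
      by (intro exI[of _ "Suc n"] allI impI)
  qed
qed

section \<open>The Poincare inequality\<close>

text \<open>Cauchy-Schwarz bounds the squared difference of the pairings by the squared distance of
  \<open>f n\<close> to \<open>u\<close> times the squared norm of \<open>v\<close>. Square
  integrability of \<open>u\<close> is derived from a single \<open>f n0\<close> at distance less
  than 1.\<close>

lemma L2_inner_tendsto: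
  fixes f :: "nat \<Rightarrow> 'a \<Rightarrow> 'b::euclidean_space"
  assumes [measurable]: "\<And>n. f n \<in> borel_measurable M" "u \<in> borel_measurable M" "v \<in> borel_measurable M"
    and f: "\<And>n. (\<integral>\<^sup>+x. ennreal ((norm (f n x))\<^sup>2) \<partial>M) < \<infinity>" and v: "(\<integral>\<^sup>+x. ennreal ((norm (v x))\<^sup>2) \<partial>M) < \<infinity>"
    and lim: "(\<lambda>n. \<integral>\<^sup>+x. ennreal ((norm (f n x - u x))\<^sup>2) \<partial>M) \<longlonglongrightarrow> 0"
  shows "(\<lambda>n. LINT x|M. f n x \<bullet> v x) \<longlonglongrightarrow> (LINT x|M. u x \<bullet> v x)"
proof -
  have int: "integrable M (\<lambda>x. w x \<bullet> v x)"
    if w: "w \<in> borel_measurable M" "(\<integral>\<^sup>+x. ennreal ((norm (w x))\<^sup>2) \<partial>M) < \<infinity>" for w :: "'a \<Rightarrow> 'b"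
  proof (rule integrableI_bounded)
    note [measurable] = w(1)
    show "(\<lambda>x. w x \<bullet> v x) \<in> borel_measurable M" by measurable
    have "(\<integral>\<^sup>+x. ennreal (norm (w x \<bullet> v x)) \<partial>M) \<le>
      (\<integral>\<^sup>+x. ennreal ((norm (w x))\<^sup>2) + ennreal ((norm (v x))\<^sup>2) \<partial>M)"
    proof (rule nn_integral_mono)
      fix x
      have "norm (w x \<bullet> v x) \<le> norm (w x) * norm (v x)" using Cauchy_Schwarz_ineq2 by simp
      also have "\<dots> \<le> (norm (w x))\<^sup>2 + (norm (v x))\<^sup>2"
        using sum_squares_bound[of "norm (w x)" "norm (v x)"] zero_le_power2[of "norm (w x)"]
          zero_le_power2[of "norm (v x)"] mult_nonneg_nonneg[of "norm (w x)" "norm (v x)"] norm_ge_zero by linarith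
      finally have "ennreal (norm (w x \<bullet> v x)) \<le> ennreal ((norm (w x))\<^sup>2 + (norm (v x))\<^sup>2)"
        by (rule ennreal_leI)
      also have "\<dots> = ennreal ((norm (w x))\<^sup>2) + ennreal ((norm (v x))\<^sup>2)"
        by (rule ennreal_plus) auto
      finally show "ennreal (norm (w x \<bullet> v x)) \<le> ennreal ((norm (w x))\<^sup>2) + ennreal ((norm (v x))\<^sup>2)" .
    qed
    also have "\<dots> < \<infinity>" using w(2) v by (subst nn_integral_add) auto
    finally show "(\<integral>\<^sup>+x. ennreal (norm (w x \<bullet> v x)) \<partial>M) < \<infinity>" .
  qed
  have "\<forall>\<^sub>F n in sequentially. (\<integral>\<^sup>+x. ennreal ((norm (f n x - u x))\<^sup>2) \<partial>M) < 1"
    using lim by (rule order_tendstoD) simp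
  then obtain n0 where n0: "(\<integral>\<^sup>+x. ennreal ((norm (f n0 x - u x))\<^sup>2) \<partial>M) < 1"
    using eventually_happens'[OF sequentially_bot] by blast
  have n0': "(\<integral>\<^sup>+x. ennreal ((norm (u x - f n0 x))\<^sup>2) \<partial>M) < 1"
    using n0 by (simp only: norm_minus_commute)
  have "(\<integral>\<^sup>+x. ennreal ((norm (u x - 0))\<^sup>2) \<partial>M) \<le>
    2 * (\<integral>\<^sup>+x. ennreal ((norm (u x - f n0 x))\<^sup>2) \<partial>M) + 2 * (\<integral>\<^sup>+x. ennreal ((norm (f n0 x - 0))\<^sup>2) \<partial>M)"
    by (rule nn_integral_dist_sq_triangle) auto
  also have "\<dots> < \<infinity>"
    using n0' f[of n0] by (auto simp: ennreal_mult_less_top intro: less_trans)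
  finally have u: "(\<integral>\<^sup>+x. ennreal ((norm (u x))\<^sup>2) \<partial>M) < \<infinity>" by simp
  define V where "V = (\<integral>\<^sup>+x. ennreal ((norm (v x))\<^sup>2) \<partial>M)"
  define e where "e n = (LINT x|M. f n x \<bullet> v x) - (LINT x|M. u x \<bullet> v x)" for n
  have bound: "ennreal ((e n)\<^sup>2) \<le> V * (\<integral>\<^sup>+x. ennreal ((norm (f n x - u x))\<^sup>2) \<partial>M)" for n
  proof -
    have i: "integrable M (\<lambda>x. (f n x - u x) \<bullet> v x)"
      using int[OF _ f[of n]] int[OF _ u] by (simp add: inner_diff_left)
    have "e n = (LINT x|M. (f n x - u x) \<bullet> v x)"
      using int[OF _ f[of n]] int[OF _ u] by (simp add: e_def inner_diff_left)
    then have "ennreal (norm (e n)) \<le> (\<integral>\<^sup>+x. ennreal (norm ((f n x - u x) \<bullet> v x)) \<partial>M)"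
      using integral_norm_bound_ennreal[OF i] by simp
    also have "\<dots> \<le> (\<integral>\<^sup>+x. ennreal (norm (f n x - u x)) * ennreal (norm (v x)) \<partial>M)"
    proof (intro nn_integral_mono)
      fix x
      have "norm ((f n x - u x) \<bullet> v x) \<le> norm (f n x - u x) * norm (v x)"
        using Cauchy_Schwarz_ineq2 by simp
      then show "ennreal (norm ((f n x - u x) \<bullet> v x)) \<le> ennreal (norm (f n x - u x)) * ennreal (norm (v x))"
        by (simp add: ennreal_mult[symmetric] ennreal_leI)
    qed
    finally have "(ennreal (norm (e n)))\<^sup>2 \<le> (\<integral>\<^sup>+x. ennreal (norm (f n x - u x)) * ennreal (norm (v x)) \<partial>M)\<^sup>2"
      by (intro power_mono) auto
    also have "\<dots> \<le> (\<integral>\<^sup>+x. (ennreal (norm (f n x - u x)))\<^sup>2 \<partial>M) * (\<integral>\<^sup>+x. (ennreal (norm (v x)))\<^sup>2 \<partial>M)"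
      by (rule Cauchy_Schwarz_nn_integral) measurable
    finally show ?thesis by (simp add: ennreal_power V_def mult.commute)
  qed
  have "V < top" using v by (simp add: V_def)
  from ennreal_tendsto_cmult[OF this lim]
  have L: "(\<lambda>n. V * (\<integral>\<^sup>+x. ennreal ((norm (f n x - u x))\<^sup>2) \<partial>M)) \<longlonglongrightarrow> 0" by simp
  have "(\<lambda>n. ennreal ((e n)\<^sup>2)) \<longlonglongrightarrow> 0"
  proof (rule tendsto_sandwich[OF _ _ tendsto_const L])
    show "\<forall>\<^sub>F n in sequentially. 0 \<le> ennreal ((e n)\<^sup>2)" by simp
    show "\<forall>\<^sub>F n in sequentially. ennreal ((e n)\<^sup>2) \<le> V * (\<integral>\<^sup>+x. ennreal ((norm (f n x - u x))\<^sup>2) \<partial>M)"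
      by (rule always_eventually) (rule allI, rule bound)
  qed
  then have "(\<lambda>n. (e n)\<^sup>2) \<longlonglongrightarrow> 0"
    unfolding ennreal_0[symmetric] by (subst (asm) tendsto_ennreal_iff) simp_all
  then have "(\<lambda>n. sqrt ((e n)\<^sup>2)) \<longlonglongrightarrow> sqrt 0" by (intro tendsto_real_sqrt)
  then have "(\<lambda>n. \<bar>e n\<bar>) \<longlonglongrightarrow> 0" by (simp only: real_sqrt_abs real_sqrt_zero)
  then have "e \<longlonglongrightarrow> 0" by (rule tendsto_rabs_zero_cancel)
  then show ?thesis unfolding e_def by (rule LIM_zero_cancel)
qed

lemma C1_compact_lincomb:
  assumes "C1_compact \<Omega> \<phi> g" "C1_compact \<Omega> \<psi> h"
  shows "C1_compact \<Omega> (\<lambda>x. a * \<phi> x + b * \<psi> x) (\<lambda>x. a *\<^sub>R g x + b *\<^sub>R h x)"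
  unfolding C1_compact_def
proof (intro conjI allI)
  let ?A = "{x. \<phi> x \<noteq> 0}" and ?B = "{x. \<psi> x \<noteq> 0}" and ?C = "{x. a * \<phi> x + b * \<psi> x \<noteq> 0}"
  have K: "compact (closure ?A)" "compact (closure ?B)" "closure ?A \<subseteq> \<Omega>" "closure ?B \<subseteq> \<Omega>"
    using assms by (simp_all add: C1_compact_def)
  have "?C \<subseteq> ?A \<union> ?B" by auto
  from closure_mono[OF this] have sub: "closure ?C \<subseteq> closure ?A \<union> closure ?B"
    by (simp only: closure_Un)
  have "bounded (closure ?C)"
    by (rule bounded_subset[OF compact_imp_bounded[OF compact_Un[OF K(1,2)]] sub])
  then show "compact (closure ?C)" by (simp add: compact_eq_bounded_closed)
  show "closure ?C \<subseteq> \<Omega>" by (rule order_trans[OF sub]) (simp add: K)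
  show "continuous_on UNIV (\<lambda>x. a *\<^sub>R g x + b *\<^sub>R h x)"
    by (intro continuous_intros C1_compactD(2)[OF assms(1)] C1_compactD(2)[OF assms(2)])
  fix x
  show "GDERIV (\<lambda>x. a * \<phi> x + b * \<psi> x) x :> a *\<^sub>R g x + b *\<^sub>R h x"
    using C1_compactD(1)[OF assms(1), of x] C1_compactD(1)[OF assms(2), of x]
    unfolding gderiv_def by (auto intro!: derivative_eq_intros simp: inner_add_right)
qed

lemma C1_compact_integrable:
  assumes "C1_compact \<Omega> \<phi> g" "C1_compact \<Omega> \<psi> h"
  shows "integrable lborel (\<lambda>x. \<phi> x * \<psi> x)" "integrable lborel (\<lambda>x. g x \<bullet> h x)"
proof -
  have K: "compact (closure {x. \<phi> x \<noteq> 0})" using assms by (simp add: C1_compact_def)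
  show "integrable lborel (\<lambda>x. \<phi> x * \<psi> x)"
  proof (rule integrable_continuous_zero_outside_compact[OF _ K])
    show "continuous_on UNIV (\<lambda>x. \<phi> x * \<psi> x)"
      by (intro continuous_on_mult C1_compactD(3)[OF assms(1)] C1_compactD(3)[OF assms(2)])
    fix x assume "x \<notin> closure {x. \<phi> x \<noteq> 0}"
    from C1_compactD(4)[OF assms(1) this] show "\<phi> x * \<psi> x = 0" by simp
  qed
  show "integrable lborel (\<lambda>x. g x \<bullet> h x)"
  proof (rule integrable_continuous_zero_outside_compact[OF _ K])
    show "continuous_on UNIV (\<lambda>x. g x \<bullet> h x)"
      by (intro continuous_on_inner C1_compactD(2)[OF assms(1)] C1_compactD(2)[OF assms(2)])
    fix x assume "x \<notin> closure {x. \<phi> x \<noteq> 0}"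
    from C1_compactD(5)[OF assms(1) this] show "g x \<bullet> h x = 0" by simp
  qed
qed

text \<open>One expansion serves three purposes: normalisation (\<open>b = 0\<close>), the
  parallelogram identity (\<open>b\<close> equal to 1 and -1) and the first variation of the
  Rayleigh quotient (\<open>a = 1\<close>, \<open>b\<close> arbitrary).\<close>

lemma C1_compact_expand:
  assumes C: "C1_compact \<Omega> \<phi> g" "C1_compact \<Omega> \<psi> h"
  shows "(LINT x|lborel. (a * \<phi> x + b * \<psi> x)\<^sup>2) =
      a\<^sup>2 * (LINT x|lborel. (\<phi> x)\<^sup>2) + 2 * a * b * (LINT x|lborel. \<phi> x * \<psi> x) + b\<^sup>2 * (LINT x|lborel. (\<psi> x)\<^sup>2)"
    and "(LINT x|lborel. (norm (a *\<^sub>R g x + b *\<^sub>R h x))\<^sup>2) =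
      a\<^sup>2 * (LINT x|lborel. (norm (g x))\<^sup>2) + 2 * a * b * (LINT x|lborel. g x \<bullet> h x) + b\<^sup>2 * (LINT x|lborel. (norm (h x))\<^sup>2)"
proof -
  note i = C1_compact_integrable[OF C] C1_compact_integrable[OF C(1) C(1)] C1_compact_integrable[OF C(2) C(2)]
  have "(LINT x|lborel. (a * \<phi> x + b * \<psi> x)\<^sup>2) =
    (LINT x|lborel. a\<^sup>2 * (\<phi> x * \<phi> x) + 2 * a * b * (\<phi> x * \<psi> x) + b\<^sup>2 * (\<psi> x * \<psi> x))"
    by (intro Bochner_Integration.integral_cong refl) (simp add: power2_eq_square algebra_simps)
  also have "\<dots> = a\<^sup>2 * (LINT x|lborel. \<phi> x * \<phi> x) + 2 * a * b * (LINT x|lborel. \<phi> x * \<psi> x) + b\<^sup>2 * (LINT x|lborel. \<psi> x * \<psi> x)"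
    using i by simp
  finally show "(LINT x|lborel. (a * \<phi> x + b * \<psi> x)\<^sup>2) =
      a\<^sup>2 * (LINT x|lborel. (\<phi> x)\<^sup>2) + 2 * a * b * (LINT x|lborel. \<phi> x * \<psi> x) + b\<^sup>2 * (LINT x|lborel. (\<psi> x)\<^sup>2)"
    by (simp add: power2_eq_square)
  have "(LINT x|lborel. (norm (a *\<^sub>R g x + b *\<^sub>R h x))\<^sup>2) =
    (LINT x|lborel. a\<^sup>2 * (g x \<bullet> g x) + 2 * a * b * (g x \<bullet> h x) + b\<^sup>2 * (h x \<bullet> h x))"
    unfolding power2_norm_eq_inner
    by (intro Bochner_Integration.integral_cong refl)
      (simp add: power2_eq_square inner_add_left inner_add_right inner_commute algebra_simps)
  also have "\<dots> = a\<^sup>2 * (LINT x|lborel. g x \<bullet> g x) + 2 * a * b * (LINT x|lborel. g x \<bullet> h x) + b\<^sup>2 * (LINT x|lborel. h x \<bullet> h x)"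
    using i by simp
  finally show "(LINT x|lborel. (norm (a *\<^sub>R g x + b *\<^sub>R h x))\<^sup>2) =
      a\<^sup>2 * (LINT x|lborel. (norm (g x))\<^sup>2) + 2 * a * b * (LINT x|lborel. g x \<bullet> h x) + b\<^sup>2 * (LINT x|lborel. (norm (h x))\<^sup>2)"
    by (simp add: power2_norm_eq_inner)
qed

lemma C1_compact_nn_integral:
  assumes "C1_compact \<Omega> \<phi> g"
  shows "(\<integral>\<^sup>+x. ennreal ((\<phi> x)\<^sup>2) \<partial>lborel) = ennreal (LINT x|lborel. (\<phi> x)\<^sup>2)"
    and "(\<integral>\<^sup>+x. ennreal ((norm (g x))\<^sup>2) \<partial>lborel) = ennreal (LINT x|lborel. (norm (g x))\<^sup>2)"
  using C1_compact_integrable[OF assms assms] unfolding power2_norm_eq_inner power2_eq_square[of "\<phi> _"]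
  by (intro nn_integral_eq_integral; simp)+

lemma nn_integral_lebesgue_on:
  fixes f :: "'a::euclidean_space \<Rightarrow> ennreal"
  assumes "open \<Omega>"
  shows "(\<integral>\<^sup>+x. f x \<partial>lebesgue_on \<Omega>) = (\<integral>\<^sup>+x. f x * indicator \<Omega> x \<partial>lborel)"
  using assms by (subst nn_integral_restrict_space) (auto simp: nn_integral_completion)

lemma borel_measurable_lebesgue_on:
  "f \<in> borel_measurable borel \<Longrightarrow> f \<in> borel_measurable (lebesgue_on \<Omega>)"
  by (intro measurable_restrict_space1 measurable_completion) simp

text \<open>The eigenvalue problem is posed with Lebesgue measure on \<open>\<Omega>\<close>, the
  computations use \<open>lborel\<close> on the whole space; functions vanishing off
  \<open>\<Omega>\<close> pass from one to the other.\<close>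

lemma integral_lebesgue_on:
  fixes f :: "'a::euclidean_space \<Rightarrow> real"
  assumes "open \<Omega>" "f \<in> borel_measurable borel" "\<And>x. x \<notin> \<Omega> \<Longrightarrow> f x = 0"
  shows "(LINT x|lebesgue_on \<Omega>. f x) = (LINT x|lborel. f x)"
proof -
  have "(LINT x|lebesgue_on \<Omega>. f x) = (LINT x|lebesgue. indicator \<Omega> x *\<^sub>R f x)"
    using assms(1) by (intro integral_restrict_space) auto
  also have "(\<lambda>x. indicator \<Omega> x *\<^sub>R f x) = f" using assms(3) by (auto simp: fun_eq_iff indicator_def)
  also have "(LINT x|lebesgue. f x) = (LINT x|lborel. f x)"
    using assms(2) by (intro integral_completion) simp
  finally show ?thesis .
qed

text \<open>Rellich makes a minimizing sequence Cauchy in mean square, and near-minimality then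
  makes the gradients Cauchy too, so the limit lies in \<open>H01\<close> without any weak
  compactness. Vanishing of the first variation says that this limit is an eigenfunction for the
  infimum \<open>\<Lambda>\<close>; since \<open>l\<close> is the smallest eigenvalue,
  \<open>l \<le> \<Lambda>\<close>.\<close>

lemma poincare_inequality:
  fixes \<Omega> :: "'a::euclidean_space set"
  assumes \<Omega>: "open \<Omega>" "bounded \<Omega>" and l: "is_poincare_constant \<Omega> l" and C: "C1_compact \<Omega> \<phi> g"
  shows "l * (LINT x|lborel. (\<phi> x)\<^sup>2) \<le> 1/2 * (LINT x|lborel. (norm (g x))\<^sup>2)"
proof -
  define m where "m f = (LINT x|lborel. (f x)\<^sup>2)" for f :: "'a \<Rightarrow> real"
  define E where "E g = 1/2 * (LINT x|lborel. (norm (g x))\<^sup>2)" for g :: "'a \<Rightarrow> 'a"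
  have m0: "0 \<le> m f" for f by (simp add: m_def)
  have E0: "0 \<le> E g" for g by (simp add: E_def)
  define A where "A = {E g |\<phi> g. C1_compact \<Omega> \<phi> g \<and> m \<phi> = 1}"
  have A_scale: "E h / m \<psi> \<in> A" if h: "C1_compact \<Omega> \<psi> h" "m \<psi> \<noteq> 0" for \<psi> h
  proof -
    let ?c = "1 / sqrt (m \<psi>)"
    have c: "?c\<^sup>2 = 1 / m \<psi>" using m0[of \<psi>] by (simp add: power_divide)
    have C': "C1_compact \<Omega> (\<lambda>x. ?c * \<psi> x + 0 * \<psi> x) (\<lambda>x. ?c *\<^sub>R h x + 0 *\<^sub>R h x)"
      by (rule C1_compact_lincomb[OF h(1) h(1)])
    have "m (\<lambda>x. ?c * \<psi> x + 0 * \<psi> x) = ?c\<^sup>2 * m \<psi>"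
      unfolding m_def C1_compact_expand(1)[OF h(1) h(1)] by simp
    moreover have "E (\<lambda>x. ?c *\<^sub>R h x + 0 *\<^sub>R h x) = ?c\<^sup>2 * E h"
      unfolding E_def C1_compact_expand(2)[OF h(1) h(1)] by simp
    ultimately have "m (\<lambda>x. ?c * \<psi> x + 0 * \<psi> x) = 1"
      "E (\<lambda>x. ?c *\<^sub>R h x + 0 *\<^sub>R h x) = E h / m \<psi>"
      using c h(2) by simp_all
    with C' show ?thesis
      unfolding A_def mem_Collect_eq
      by (intro exI[of _ "\<lambda>x. ?c * \<psi> x + 0 * \<psi> x"] exI[of _ "\<lambda>x. ?c *\<^sub>R h x + 0 *\<^sub>R h x"] conjI) simp_all
  qed
  show ?thesis
  \<comment> \<open>A nonzero \<open>\<phi>\<close> is also what shows that the set \<open>A\<close>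
    of quotients is nonempty.\<close>
  proof (cases "m \<phi> = 0")
    case True
    then show ?thesis using E0[of g] unfolding m_def E_def by simp
  next
    case False
    define \<Lambda> where "\<Lambda> = Inf A"
    have A_ne: "A \<noteq> {}" using A_scale[OF C False] by auto
    have A_bdd: "bdd_below A" by (rule bdd_belowI[of _ 0]) (auto simp: A_def E0)
    have \<Lambda>0: "0 \<le> \<Lambda>" unfolding \<Lambda>_def by (rule cInf_greatest[OF A_ne]) (auto simp: A_def E0)
    have Q: "\<Lambda> * m \<psi> \<le> E h" if "C1_compact \<Omega> \<psi> h" for \<psi> h
    proof (cases "m \<psi> = 0")
      case True then show ?thesis using E0[of h] by simp
    next
      case False
      have "\<Lambda> \<le> E h / m \<psi>" unfolding \<Lambda>_def by (rule cInf_lower[OF A_scale[OF that False] A_bdd])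
      then show ?thesis using False m0[of \<psi>] by (simp add: field_simps)
    qed
    have "\<exists>\<phi> g. C1_compact \<Omega> \<phi> g \<and> m \<phi> = 1 \<and> E g < \<Lambda> + 1 / real (Suc n)" for n
    proof -
      have "\<Lambda> < \<Lambda> + 1 / real (Suc n)" by simp
      then have "\<exists>a\<in>A. a < \<Lambda> + 1 / real (Suc n)"
        unfolding \<Lambda>_def by (rule cInf_lessD[OF A_ne])
      then show ?thesis by (auto simp: A_def)
    qed
    then obtain f0 h0 where f0: "\<And>n. C1_compact \<Omega> (f0 n) (h0 n)" "\<And>n. m (f0 n) = 1"
      "\<And>n. E (h0 n) < \<Lambda> + 1 / real (Suc n)" by metis
    have "(\<integral>\<^sup>+x. ennreal ((f0 n x)\<^sup>2) \<partial>lborel) \<le> 1" for n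
      using C1_compact_nn_integral(1)[OF f0(1)[of n]] f0(2)[of n] by (simp add: m_def)
    moreover have "(\<integral>\<^sup>+x. ennreal ((norm (h0 n x))\<^sup>2) \<partial>lborel) \<le> ennreal (2 * \<Lambda> + 2)" for n
    proof -
      have "1 / real (Suc n) \<le> 1" by simp
      then have "E (h0 n) \<le> \<Lambda> + 1" using f0(3)[of n] by linarith
      then have "(LINT x|lborel. (norm (h0 n x))\<^sup>2) \<le> 2 * \<Lambda> + 2" by (simp add: E_def)
      then show ?thesis unfolding C1_compact_nn_integral(2)[OF f0(1)[of n]] by (rule ennreal_leI)
    qed
    moreover have "0 \<le> 2 * \<Lambda> + 2" using \<Lambda>0 by simp
    ultimately obtain r :: "nat \<Rightarrow> nat" where r: "strict_mono r"
      "\<And>e. e > 0 \<Longrightarrow> \<exists>N. \<forall>i\<ge>N. \<forall>j\<ge>N. (\<integral>\<^sup>+x. ennreal ((f0 (r i) x - f0 (r j) x)\<^sup>2) \<partial>lborel) \<le> ennreal e"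
      by (rule C1_compact_Cauchy_subseq[OF \<Omega>(2) f0(1)]) (rule that)
    define f where "f n = f0 (r n)" for n
    define h where "h n = h0 (r n)" for n
    have C1: "C1_compact \<Omega> (f n) (h n)" and m1: "m (f n) = 1" for n
      using f0 by (simp_all add: f_def h_def)
    note [measurable] = C1_compactD(8,9)[OF C1]
    have E1: "E (h n) < \<Lambda> + 1 / real (Suc n)" for n
    proof -
      have "E (h n) < \<Lambda> + 1 / real (Suc (r n))" using f0(3) by (simp add: h_def)
      also have "1 / real (Suc (r n)) \<le> 1 / real (Suc n)"
        using seq_suble[OF r(1), of n] by (intro divide_left_mono) auto
      finally show ?thesis by simp
    qed
    have diff1: "(\<integral>\<^sup>+x. ennreal ((norm (f i x - f j x))\<^sup>2) \<partial>lborel) = ennreal (m (\<lambda>x. 1 * f i x + (-1) * f j x))" for i j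
      using C1_compact_nn_integral(1)[OF C1_compact_lincomb[OF C1[of i] C1[of j], of 1 "-1"]] by (simp add: m_def)
    have diff2: "(\<integral>\<^sup>+x. ennreal ((norm (h i x - h j x))\<^sup>2) \<partial>lborel) = ennreal (2 * E (\<lambda>x. 1 *\<^sub>R h i x + (-1) *\<^sub>R h j x))" for i j
      using C1_compact_nn_integral(2)[OF C1_compact_lincomb[OF C1[of i] C1[of j], of 1 "-1"]] by (simp add: E_def)
    have Cauchy1: "\<exists>N. \<forall>i\<ge>N. \<forall>j\<ge>N. (\<integral>\<^sup>+x. ennreal ((norm (f i x - f j x))\<^sup>2) \<partial>lborel) \<le> ennreal e" if "e > 0" for e
      using r(2)[OF that] by (simp add: f_def)
    \<comment> \<open>parallelogram identity: the midpoints of a minimizing sequence cannot beat the infimum\<close>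
    have par: "E (\<lambda>x. 1 *\<^sub>R h i x + (-1) *\<^sub>R h j x) \<le>
      2 / real (Suc i) + 2 / real (Suc j) + \<Lambda> * m (\<lambda>x. 1 * f i x + (-1) * f j x)" for i j
    proof -
      have "E (\<lambda>x. 1 *\<^sub>R h i x + (-1) *\<^sub>R h j x) + E (\<lambda>x. 1 *\<^sub>R h i x + 1 *\<^sub>R h j x) = 2 * E (h i) + 2 * E (h j)"
        unfolding E_def C1_compact_expand(2)[OF C1[of i] C1[of j]] by (simp add: algebra_simps)
      moreover have "m (\<lambda>x. 1 * f i x + (-1) * f j x) + m (\<lambda>x. 1 * f i x + 1 * f j x) = 2 * m (f i) + 2 * m (f j)"
        unfolding m_def C1_compact_expand(1)[OF C1[of i] C1[of j]] by (simp add: algebra_simps)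
      then have "m (\<lambda>x. 1 * f i x + 1 * f j x) = 4 - m (\<lambda>x. 1 * f i x + (-1) * f j x)"
        using m1 by simp
      then have "\<Lambda> * (4 - m (\<lambda>x. 1 * f i x + (-1) * f j x)) \<le> E (\<lambda>x. 1 *\<^sub>R h i x + 1 *\<^sub>R h j x)"
        using Q[OF C1_compact_lincomb[OF C1[of i] C1[of j], of 1 1]] by simp
      then have "4 * \<Lambda> - \<Lambda> * m (\<lambda>x. 1 * f i x + (-1) * f j x) \<le> E (\<lambda>x. 1 *\<^sub>R h i x + 1 *\<^sub>R h j x)"
        by (simp add: right_diff_distrib)
      moreover have "2 * E (h i) \<le> 2 * \<Lambda> + 2 / real (Suc i)" "2 * E (h j) \<le> 2 * \<Lambda> + 2 / real (Suc j)"
        using E1[of i] E1[of j] by (simp_all del: of_nat_Suc)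
      ultimately show ?thesis by linarith
    qed
    \<comment> \<open>The energy of the difference is bounded by \<open>e/8 + e/8 + e/4\<close>. The
      squared norm of the gradient is twice the energy, which gives \<open>e\<close>.\<close>
    have Cauchy2: "\<exists>N. \<forall>i\<ge>N. \<forall>j\<ge>N. (\<integral>\<^sup>+x. ennreal ((norm (h i x - h j x))\<^sup>2) \<partial>lborel) \<le> ennreal e" if e: "e > 0" for e
    proof -
      obtain N1 where N1: "\<And>i j. i \<ge> N1 \<Longrightarrow> j \<ge> N1 \<Longrightarrow>
        (\<integral>\<^sup>+x. ennreal ((norm (f i x - f j x))\<^sup>2) \<partial>lborel) \<le> ennreal (e / (4 * (\<Lambda> + 1)))"
        using Cauchy1[of "e / (4 * (\<Lambda> + 1))"] e \<Lambda>0 by (auto simp del: real_norm_def)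
      obtain N2 where N2: "1 / real (Suc N2) < e / 16" by (rule nat_approx_posE[of "e / 16"]) (use e in auto)
      have "(\<integral>\<^sup>+x. ennreal ((norm (h i x - h j x))\<^sup>2) \<partial>lborel) \<le> ennreal e"
        if ij: "i \<ge> max N1 N2" "j \<ge> max N1 N2" for i j
      proof -
        have "m (\<lambda>x. 1 * f i x + (-1) * f j x) \<le> e / (4 * (\<Lambda> + 1))"
        proof -
          have "ennreal (m (\<lambda>x. 1 * f i x + (-1) * f j x)) \<le> ennreal (e / (4 * (\<Lambda> + 1)))"
            using N1[of i j] ij unfolding diff1 by simp
          then show ?thesis by (subst (asm) ennreal_le_iff) (use e \<Lambda>0 in auto)
        qed
        then have "\<Lambda> * m (\<lambda>x. 1 * f i x + (-1) * f j x) \<le> (\<Lambda> + 1) * (e / (4 * (\<Lambda> + 1)))"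
          using \<Lambda>0 m0 by (intro mult_mono) auto
        also have "\<dots> = e / 4" using \<Lambda>0 by (simp add: field_simps)
        finally have 1: "\<Lambda> * m (\<lambda>x. 1 * f i x + (-1) * f j x) \<le> e / 4" .
        have 2: "2 / real (Suc k) \<le> e / 8" if "k \<ge> N2" for k
        proof -
          have "1 / real (Suc k) \<le> 1 / real (Suc N2)" using that by (intro divide_left_mono) auto
          then show ?thesis using N2 by (simp del: of_nat_Suc)
        qed
        have "2 * E (\<lambda>x. 1 *\<^sub>R h i x + (-1) *\<^sub>R h j x) \<le> e"
          using par[of i j] 1 2[of i] 2[of j] ij by linarith
        then show ?thesis unfolding diff2 by (rule ennreal_leI)
      qed
      then show ?thesis by (intro exI[of _ "max N1 N2"] allI impI)
    qed
    obtain u where u[measurable]: "u \<in> borel_measurable lborel"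
      and ulim: "(\<lambda>n. \<integral>\<^sup>+x. ennreal ((norm (f n x - u x))\<^sup>2) \<partial>lborel) \<longlonglongrightarrow> 0"
    proof (rule L2_complete)
      show "f n \<in> borel_measurable lborel" for n by simp
    qed (use Cauchy1 in auto)
    obtain G where G[measurable]: "G \<in> borel_measurable lborel"
      and Glim: "(\<lambda>n. \<integral>\<^sup>+x. ennreal ((norm (h n x - G x))\<^sup>2) \<partial>lborel) \<longlonglongrightarrow> 0"
    proof (rule L2_complete)
      show "h n \<in> borel_measurable lborel" for n by simp
    qed (use Cauchy2 in auto)
    have on_le: "(\<integral>\<^sup>+x. k x \<partial>lebesgue_on \<Omega>) \<le> (\<integral>\<^sup>+x. k x \<partial>lborel)" for k :: "'a \<Rightarrow> ennreal"
      unfolding nn_integral_lebesgue_on[OF \<Omega>(1)] by (intro nn_integral_mono) (auto simp: indicator_def)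
    have on_lim: "(\<lambda>n. \<integral>\<^sup>+x. k n x \<partial>lebesgue_on \<Omega>) \<longlonglongrightarrow> 0"
      if "(\<lambda>n. \<integral>\<^sup>+x. k n x \<partial>lborel) \<longlonglongrightarrow> 0" for k :: "nat \<Rightarrow> 'a \<Rightarrow> ennreal"
      by (rule tendsto_sandwich[OF _ _ tendsto_const that]) (auto intro: always_eventually on_le)
    have H: "H01 \<Omega> u G"
      unfolding H01_def
    proof (intro conjI exI allI)
      show "u \<in> borel_measurable (lebesgue_on \<Omega>)" "G \<in> borel_measurable (lebesgue_on \<Omega>)"
        using u G by (auto intro: borel_measurable_lebesgue_on)
      show "C1_compact \<Omega> (f n) (h n)" for n by (rule C1)
      show "(\<lambda>n. \<integral>\<^sup>+x. ennreal ((f n x - u x)\<^sup>2) \<partial>lebesgue_on \<Omega>) \<longlonglongrightarrow> 0"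
        using on_lim[OF ulim] by simp
      show "(\<lambda>n. \<integral>\<^sup>+x. ennreal ((norm (h n x - G x))\<^sup>2) \<partial>lebesgue_on \<Omega>) \<longlonglongrightarrow> 0"
        using on_lim[OF Glim] by simp
    qed
    \<comment> \<open>Convergence in mean square preserves the normalisation: were \<open>u\<close>
      zero, the distances to it would all be 1.\<close>
    have nz: "\<not> (AE x in lebesgue_on \<Omega>. u x = 0)"
    proof
      assume z: "AE x in lebesgue_on \<Omega>. u x = 0"
      have "(\<integral>\<^sup>+x. ennreal ((norm (f n x - u x))\<^sup>2) \<partial>lebesgue_on \<Omega>) = 1" for n
      proof -
        have "(\<integral>\<^sup>+x. ennreal ((norm (f n x - u x))\<^sup>2) \<partial>lebesgue_on \<Omega>) = (\<integral>\<^sup>+x. ennreal ((f n x)\<^sup>2) \<partial>lebesgue_on \<Omega>)"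
          by (rule nn_integral_cong_AE) (use z in \<open>auto elim: eventually_mono\<close>)
        also have "\<dots> = (\<integral>\<^sup>+x. ennreal ((f n x)\<^sup>2) \<partial>lborel)"
          unfolding nn_integral_lebesgue_on[OF \<Omega>(1)]
          using C1_compactD(6)[OF C1[of n]] by (intro nn_integral_cong) (auto simp: indicator_def)
        also have "\<dots> = 1" using C1_compact_nn_integral(1)[OF C1[of n]] m1[of n] by (simp add: m_def)
        finally show ?thesis .
      qed
      with on_lim[OF ulim] have "(\<lambda>n. 1 :: ennreal) \<longlonglongrightarrow> 0" by simp
      then show False using LIMSEQ_unique[OF _ tendsto_const] by fastforce
    qed
    have EL: "(1/2) * (LINT x|lebesgue_on \<Omega>. G x \<bullet> p x) = \<Lambda> * (LINT x|lebesgue_on \<Omega>. u x * \<psi> x)"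
      if p: "C1_compact \<Omega> \<psi> p" for \<psi> p
    proof -
      note [measurable] = C1_compactD(8,9)[OF p]
      define q where "q = E p - \<Lambda> * m \<psi>"
      define B where "B n = 1/2 * (LINT x|lborel. h n x \<bullet> p x) - \<Lambda> * (LINT x|lborel. f n x * \<psi> x)" for n
      define B' where "B' = 1/2 * (LINT x|lborel. G x \<bullet> p x) - \<Lambda> * (LINT x|lborel. u x * \<psi> x)"
      have fin: "(\<integral>\<^sup>+x. ennreal ((norm (f n x))\<^sup>2) \<partial>lborel) < \<infinity>" "(\<integral>\<^sup>+x. ennreal ((norm (h n x))\<^sup>2) \<partial>lborel) < \<infinity>" for n
        using C1_compact_nn_integral[OF C1[of n]] by simp_all
      have finp: "(\<integral>\<^sup>+x. ennreal ((norm (\<psi> x))\<^sup>2) \<partial>lborel) < \<infinity>" "(\<integral>\<^sup>+x. ennreal ((norm (p x))\<^sup>2) \<partial>lborel) < \<infinity>"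
        using C1_compact_nn_integral[OF p] by simp_all
      have "(\<lambda>n. LINT x|lborel. f n x \<bullet> \<psi> x) \<longlonglongrightarrow> (LINT x|lborel. u x \<bullet> \<psi> x)"
        by (rule L2_inner_tendsto) (use fin finp ulim in auto)
      moreover have "(\<lambda>n. LINT x|lborel. h n x \<bullet> p x) \<longlonglongrightarrow> (LINT x|lborel. G x \<bullet> p x)"
        by (rule L2_inner_tendsto) (use fin finp Glim in auto)
      ultimately have B: "B \<longlonglongrightarrow> B'"
        unfolding B_def B'_def by (intro tendsto_intros) (simp_all add: inner_real_def)
      \<comment> \<open>Perturbing a near-minimizer by \<open>s * \<psi>\<close> cannot bring the
        energy below \<open>\<Lambda>\<close> times the mass. The defect of \<open>f n\<close>
        itself is less than \<open>1 / real (Suc n)\<close>, which disappears in the limit and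
        leaves a quadratic in \<open>s\<close> without constant term.\<close>
      have nonneg: "0 \<le> 1 / real (Suc n) + 2 * s * B n + s\<^sup>2 * q" for s n
      proof -
        have "\<Lambda> * m (\<lambda>x. 1 * f n x + s * \<psi> x) \<le> E (\<lambda>x. 1 *\<^sub>R h n x + s *\<^sub>R p x)"
          by (rule Q[OF C1_compact_lincomb[OF C1 p]])
        then have "0 \<le> E (h n) - \<Lambda> * m (f n) + 2 * s * B n + s\<^sup>2 * q"
          unfolding m_def E_def q_def B_def C1_compact_expand[OF C1 p] by (simp add: algebra_simps)
        then show ?thesis using E1[of n] m1[of n] by simp
      qed
      have "(\<lambda>n. 1 / real (Suc n) + 2 * s * B n + s\<^sup>2 * q) \<longlonglongrightarrow> 0 + 2 * s * B' + s\<^sup>2 * q" for s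
        by (intro tendsto_intros B LIMSEQ_Suc[OF lim_1_over_n])
      from LIMSEQ_le_const[OF this] nonneg have "0 \<le> 0 + 2 * s * B' + s\<^sup>2 * q" for s by blast
      moreover have "s * (2 * B' + s * q) = 0 + 2 * s * B' + s\<^sup>2 * q" for s
        by (simp add: power2_eq_square algebra_simps)
      ultimately have key: "0 \<le> s * (2 * B' + s * q)" for s by simp
      have q0: "0 \<le> q" using Q[OF p] by (simp add: q_def)
      have "B' = 0"
      proof (rule ccontr)
        assume nz: "B' \<noteq> 0"
        \<comment> \<open>Evaluating the quadratic here gives
          \<open>- (s\<^sup>2 * (q + 2))\<close>, which is negative unless \<open>B'\<close> is
          zero; adding 1 to \<open>q\<close> covers the case \<open>q = 0\<close>.\<close>
        define s where "s = - B' / (q + 1)"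
        have s: "s \<noteq> 0" "B' = - s * (q + 1)" using nz q0 by (simp_all add: s_def)
        have "0 \<le> s * (2 * B' + s * q)" by (rule key)
        also have "\<dots> = - (s\<^sup>2 * (q + 2))"
          unfolding s(2) by (simp add: power2_eq_square algebra_simps)
        also have "\<dots> < 0" using s(1) q0 by simp
        finally show False by simp
      qed
      moreover have "(LINT x|lebesgue_on \<Omega>. G x \<bullet> p x) = (LINT x|lborel. G x \<bullet> p x)"
        using C1_compactD(7)[OF p] G by (intro integral_lebesgue_on[OF \<Omega>(1)]) auto
      moreover have "(LINT x|lebesgue_on \<Omega>. u x * \<psi> x) = (LINT x|lborel. u x * \<psi> x)"
        using C1_compactD(6)[OF p] u by (intro integral_lebesgue_on[OF \<Omega>(1)]) auto
      ultimately show ?thesis by (simp add: B'_def)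
    qed
    have "dirichlet_eigenvalue \<Omega> \<Lambda>"
      unfolding dirichlet_eigenvalue_def 
      by (intro exI[of _ u] exI[of _ G] conjI H nz allI impI EL)
    then have "l \<le> \<Lambda>" using l by (simp add: is_poincare_constant_def)
    then have "l * m \<phi> \<le> \<Lambda> * m \<phi>" using m0 by (rule mult_right_mono)
    with Q[OF C] show ?thesis by (simp add: m_def E_def)
  qed
qed

section \<open>A strict supersolution up to the boundary\<close>

lemma uniformly_continuous_zero_outside_compact:
  fixes f :: "'a::euclidean_space \<Rightarrow> 'b::real_normed_vector"
  assumes "continuous_on UNIV f" "compact K" "\<And>x. x \<notin> K \<Longrightarrow> f x = 0" "e > 0"
  obtains d where "d > 0" "\<And>x y. norm (x - y) < d \<Longrightarrow> norm (f x - f y) < e"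
proof -
  obtain R where "\<forall>x\<in>K. norm x \<le> R" using compact_imp_bounded[OF assms(2)] by (auto simp: bounded_iff)
  then have out: "f x = 0" if "norm x > R" for x using assms(3)[of x] that by force
  have "uniformly_continuous_on (cball 0 (R + 1)) f"
    using continuous_on_subset[OF assms(1)] by (intro compact_uniformly_continuous) auto
  then obtain d where d: "d > 0" "\<And>x y. x \<in> cball 0 (R + 1) \<Longrightarrow> y \<in> cball 0 (R + 1) \<Longrightarrow> dist y x < d \<Longrightarrow> dist (f y) (f x) < e"
    using assms(4) unfolding uniformly_continuous_on_def by metis
  show thesis
  \<comment> \<open>The cap 1 keeps a pair of points in the ball of radius \<open>R + 1\<close> as
    soon as one of them has norm at most \<open>R\<close>; if neither has, both values are
    0.\<close>
  proof (rule that[of "min d 1"])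
    fix x y :: 'a assume xy: "norm (x - y) < min d 1"
    show "norm (f x - f y) < e"
    proof (cases "norm x \<le> R \<or> norm y \<le> R")
      case True
      have "norm x \<le> norm y + norm (x - y)" "norm y \<le> norm x + norm (x - y)"
        using norm_triangle_ineq[of y "x - y"] norm_triangle_ineq[of x "y - x"]
        by (simp_all add: norm_minus_commute)
      then have "norm x \<le> R + 1" "norm y \<le> R + 1" using True xy by auto
      with d(2)[of y x] xy show ?thesis by (simp add: dist_norm)
    next
      case False
      then show ?thesis using out[of x] out[of y] assms(4) by simp
    qed
  qed (use d in simp)
qed

lemma bounded_zero_outside_compact:
  fixes f :: "'a::euclidean_space \<Rightarrow> 'b::real_normed_vector"
  assumes "continuous_on UNIV f" "compact K" "\<And>x. x \<notin> K \<Longrightarrow> f x = 0"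
  shows "\<exists>B. \<forall>x. norm (f x) \<le> B"
proof -
  have c: "compact (f ` K)"
    using assms(1,2) continuous_on_subset by (intro compact_continuous_image) auto
  then obtain B where "\<forall>y\<in>f ` K. norm y \<le> B" using compact_imp_bounded[OF c] by (auto simp: bounded_iff)
  then have "norm (f x) \<le> max B 0" for x
    using assms(3)[of x] by (cases "x \<in> K") (auto simp: le_max_iff_disj)
  then show ?thesis by blast
qed

section \<open>Convolution with a finite measure\<close>

definition conv :: "'a::euclidean_space measure \<Rightarrow> ('a \<Rightarrow> 'b::euclidean_space) \<Rightarrow> 'a \<Rightarrow> 'b" where
  "conv N f x = (LINT z|N. f (x - z))"

lemma conv_integrable:
  fixes f :: "'a::euclidean_space \<Rightarrow> 'b::euclidean_space"
  assumes "finite_measure N" "sets N = sets borel"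
    and f: "continuous_on UNIV f" "compact K" "\<And>x. x \<notin> K \<Longrightarrow> f x = 0"
  shows "integrable N (\<lambda>z. f (x - z))"
proof -
  obtain B where B: "\<forall>x. norm (f x) \<le> B" using bounded_zero_outside_compact[OF f] by auto
  interpret finite_measure N by fact
  have "continuous_on UNIV (\<lambda>z. f (x - z))"
    by (rule continuous_on_compose2[OF f(1)]) (auto intro!: continuous_intros)
  then have "(\<lambda>z. f (x - z)) \<in> borel_measurable N"
    using borel_measurable_continuous_onI measurable_cong_sets[OF assms(2) refl] by blast
  then show ?thesis by (intro integrable_const_bound[of _ B]) (auto simp: B)
qed

lemma conv_continuous:
  fixes f :: "'a::euclidean_space \<Rightarrow> 'b::euclidean_space"
  assumes N: "finite_measure N" "sets N = sets borel"
    and f: "continuous_on UNIV f" "compact K" "\<And>x. x \<notin> K \<Longrightarrow> f x = 0"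
  shows "continuous_on UNIV (conv N f)"
  unfolding continuous_on_iff
proof (intro ballI allI impI)
  fix x :: 'a and e :: real assume "e > 0"
  interpret finite_measure N by fact
  let ?n = "measure N (space N)"
  define e' where "e' = e / (?n + 1)"
  have e': "e' > 0" "e' * ?n < e"
    using \<open>e > 0\<close> measure_nonneg[of N "space N"] by (simp_all add: e'_def field_simps add_pos_nonneg)
  obtain d where d: "d > 0" "\<And>x y. norm (x - y) < d \<Longrightarrow> norm (f x - f y) < e'"
    using uniformly_continuous_zero_outside_compact[OF f e'(1)] by metis
  have "dist (conv N f y) (conv N f x) < e" if y: "dist y x < d" for y
  proof -
    note i = conv_integrable[OF N f, of y] conv_integrable[OF N f, of x]
    have "conv N f y - conv N f x = (LINT z|N. f (y - z) - f (x - z))"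
      unfolding conv_def using i by (rule Bochner_Integration.integral_diff[symmetric])
    also have "norm \<dots> \<le> (LINT z|N. e')"
    proof (rule Bochner_Integration.integral_norm_bound_integral)
      show "integrable N (\<lambda>z. f (y - z) - f (x - z))" using i by (rule Bochner_Integration.integrable_diff)
      fix z
      have "norm ((y - z) - (x - z)) < d" using y by (simp add: dist_norm)
      from d(2)[OF this] show "norm (f (y - z) - f (x - z)) \<le> e'" by simp
    qed simp
    also have "\<dots> < e" using e' by (simp add: mult.commute)
    finally show ?thesis by (simp add: dist_norm)
  qed
  then show "\<exists>d>0. \<forall>x'\<in>UNIV. dist x' x < d \<longrightarrow> dist (conv N f x') (conv N f x) < e"
    using d(1) by auto
qed

text \<open>Uniform continuity of \<open>G\<close> bounds the linearization error of
  \<open>f\<close> by \<open>e'\<close> times the step, with the same \<open>e'\<close> at all base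
  points. This bound can be integrated over the finite measure, which justifies differentiation
  under the integral.\<close>

lemma conv_gderiv:
  fixes f :: "'a::euclidean_space \<Rightarrow> real"
  assumes N: "finite_measure N" "sets N = sets borel" and f: "C1_compact UNIV f G"
  shows "GDERIV (conv N f) x :> conv N G x"
  unfolding gderiv_def has_derivative_at_alt
proof (intro conjI allI impI)
  interpret finite_measure N by fact
  let ?n = "measure N (space N)"
  let ?K = "closure {x. f x \<noteq> 0}"
  have K: "compact ?K" using f by (simp add: C1_compact_def)
  note fi = conv_integrable[OF N C1_compactD(3)[OF f] K C1_compactD(4)[OF f]]
  note Gi = conv_integrable[OF N C1_compactD(2)[OF f] K C1_compactD(5)[OF f]]
  show "bounded_linear (\<lambda>h. h \<bullet> conv N G x)" by (rule bounded_linear_inner_left)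
  fix e :: real assume "e > 0"
  define e' where "e' = e / (?n + 1)"
  have e': "e' > 0" "e' * ?n \<le> e"
    using \<open>e > 0\<close> measure_nonneg[of N "space N"] by (simp_all add: e'_def field_simps add_pos_nonneg)
  obtain d where d: "d > 0" "\<And>x y. norm (x - y) < d \<Longrightarrow> norm (G x - G y) < e'"
    using uniformly_continuous_zero_outside_compact[OF C1_compactD(2)[OF f] K C1_compactD(5)[OF f] e'(1)]
    by metis
  have lin: "\<bar>f b - f a - (b - a) \<bullet> G a\<bar> \<le> norm (b - a) * e'" if ab: "norm (b - a) < d" for a b
  proof -
    have "norm (f b - f a - (b - a) \<bullet> G a) \<le> norm (b - a) * e'"
    proof (rule differentiable_bound_linearization[where S = "ball a d" and f' = "\<lambda>x h. h \<bullet> G x" and ?x0.0 = a])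
      fix t :: real assume "t \<in> {0..1}"
      then have "norm (t *\<^sub>R (b - a)) \<le> norm (b - a)" by (simp add: mult_left_le_one_le)
      then show "a + t *\<^sub>R (b - a) \<in> ball a d" using ab by (simp add: dist_norm)
    next
      fix y assume "y \<in> ball a d"
      show "(f has_derivative (\<lambda>h. h \<bullet> G y)) (at y within ball a d)"
        using C1_compactD(1)[OF f, of y] unfolding gderiv_def by (rule has_derivative_at_withinI)
      have "norm (G y - G a) \<le> e'"
        using d(2)[of y a] \<open>y \<in> ball a d\<close> by (simp add: dist_norm norm_minus_commute)
      have "norm (h \<bullet> G y - h \<bullet> G a) \<le> e' * norm h" for h
      proof -
        have "norm (h \<bullet> G y - h \<bullet> G a) = \<bar>h \<bullet> (G y - G a)\<bar>" by (simp add: inner_diff_right)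
        also have "\<dots> \<le> norm h * norm (G y - G a)" by (rule Cauchy_Schwarz_ineq2)
        also have "\<dots> \<le> norm h * e'" by (rule mult_left_mono) (use \<open>norm (G y - G a) \<le> e'\<close> in auto)
        finally show ?thesis by (simp add: mult.commute)
      qed
      then show "onorm ((\<lambda>h. h \<bullet> G y) - (\<lambda>h. h \<bullet> G a)) \<le> e'"
        using e' by (intro onorm_le) auto
    qed (use d in simp)
    then show ?thesis by simp
  qed
  have "norm (conv N f y - conv N f x - (y - x) \<bullet> conv N G x) \<le> e * norm (y - x)" if y: "norm (y - x) < d" for y
  proof -
    have Gi': "integrable N (\<lambda>z. (y - x) \<bullet> G (x - z))" by (intro integrable_inner_right Gi)
    have "(y - x) \<bullet> conv N G x = (LINT z|N. (y - x) \<bullet> G (x - z))"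
      unfolding conv_def using Gi by (subst integral_inner_right) auto
    then have "conv N f y - conv N f x - (y - x) \<bullet> conv N G x =
      (LINT z|N. f (y - z) - f (x - z) - (y - x) \<bullet> G (x - z))"
      using fi[of y] fi[of x] Gi' unfolding conv_def by simp
    also have "norm \<dots> \<le> (LINT z|N. norm (y - x) * e')"
    proof (rule Bochner_Integration.integral_norm_bound_integral)
      show "integrable N (\<lambda>z. f (y - z) - f (x - z) - (y - x) \<bullet> G (x - z))"
        using fi[of y] fi[of x] Gi' by (intro Bochner_Integration.integrable_diff)
      fix z
      show "norm (f (y - z) - f (x - z) - (y - x) \<bullet> G (x - z)) \<le> norm (y - x) * e'"
        using lin[of "y - z" "x - z"] y by simp
    qed simp
    also have "\<dots> = norm (y - x) * (e' * ?n)" by simp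
    also have "\<dots> \<le> norm (y - x) * e" using e' by (intro mult_left_mono) auto
    finally show ?thesis by (simp add: mult.commute)
  qed
  then show "\<exists>d>0. \<forall>y. norm (y - x) < d \<longrightarrow>
      norm (conv N f y - conv N f x - (y - x) \<bullet> conv N G x) \<le> e * norm (y - x)"
    using d(1) by blast
qed

text \<open>Translation invariance makes the integral of every difference quotient vanish; they
  converge boundedly and on a fixed ball to the derivative. This is the only form of integration by
  parts used for the Rayleigh quotient.\<close>

lemma integral_gradient_zero:
  fixes f :: "'a::euclidean_space \<Rightarrow> real"
  assumes f: "C1_compact \<Omega> f G" and i: "i \<in> Basis"
  shows "(LINT x|lborel. G x \<bullet> i) = 0"
proof -
  let ?K = "closure {x. f x \<noteq> 0}"
  have K: "compact ?K" using f by (simp add: C1_compact_def)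
  note [measurable] = C1_compactD(8,9)[OF f]
  obtain B where B: "\<forall>x. norm (G x) \<le> B"
    using bounded_zero_outside_compact[OF C1_compactD(2)[OF f] K C1_compactD(5)[OF f]] by auto
  obtain R where R: "\<forall>x\<in>?K. norm x \<le> R" using compact_imp_bounded[OF K] by (auto simp: bounded_iff)
  have f_int: "integrable lborel f"
    by (rule integrable_continuous_zero_outside_compact[OF C1_compactD(3)[OF f] K C1_compactD(4)[OF f]])
  define h where "h n = 1 / real (Suc n)" for n
  have h: "0 < h n" "h n \<le> 1" for n by (simp_all add: h_def)
  have hlim: "h \<longlonglongrightarrow> 0" unfolding h_def by (rule LIMSEQ_Suc[OF lim_1_over_n])
  define q where "q n x = (f (x + h n *\<^sub>R i) - f x) / h n" for n x
  have tr: "integrable lborel (\<lambda>x. f (x + c))" "(LINT x|lborel. f (x + c)) = (LINT x|lborel. f x)" for c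
  proof -
    have "integrable (distr lborel borel ((+) c)) f" using f_int by (simp add: lborel_distr_plus)
    then show "integrable lborel (\<lambda>x. f (x + c))" by (subst (asm) integrable_distr_eq) (auto simp: add.commute)
    have "(LINT x|distr lborel borel ((+) c). f x) = (LINT x|lborel. f (c + x))" by (rule integral_distr) auto
    then show "(LINT x|lborel. f (x + c)) = (LINT x|lborel. f x)" by (simp add: lborel_distr_plus add.commute)
  qed
  have q0: "(LINT x|lborel. q n x) = 0" for n
    unfolding q_def using tr f_int by simp
  have "(\<lambda>n. LINT x|lborel. q n x) \<longlonglongrightarrow> (LINT x|lborel. G x \<bullet> i)"
  proof (rule integral_dominated_convergence)
    show "(\<lambda>x. G x \<bullet> i) \<in> borel_measurable lborel" "q n \<in> borel_measurable lborel" for n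
      unfolding q_def by measurable
    show "integrable lborel (\<lambda>x::'a. B * indicator (cball 0 (R + 1)) x)"
      using emeasure_lborel_cball_finite[of "0::'a" "R + 1"]
      by (intro integrable_mult_right integrable_real_indicator) auto
    show "AE x in lborel. (\<lambda>n. q n x) \<longlonglongrightarrow> G x \<bullet> i"
    proof (rule AE_I2)
      fix x
      have "((\<lambda>t. x + t *\<^sub>R i) has_derivative (\<lambda>t. t *\<^sub>R i)) (at 0)" by (auto intro!: derivative_eq_intros)
      moreover have "(f has_derivative (\<lambda>h. h \<bullet> G x)) (at (x + 0 *\<^sub>R i))"
        using C1_compactD(1)[OF f, of x] by (simp add: gderiv_def)
      ultimately have "((\<lambda>t. f (x + t *\<^sub>R i)) has_derivative (\<lambda>t. (t *\<^sub>R i) \<bullet> G x)) (at 0)"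
        by (rule has_derivative_compose)
      moreover have "(\<lambda>t. (t *\<^sub>R i) \<bullet> G x) = (*) (G x \<bullet> i)" by (auto simp: fun_eq_iff inner_commute)
      ultimately have "((\<lambda>t. f (x + t *\<^sub>R i)) has_real_derivative G x \<bullet> i) (at 0)"
        by (simp only: has_field_derivative_def)
      then have "((\<lambda>t. (f (x + t *\<^sub>R i) - f x) / t) \<longlongrightarrow> G x \<bullet> i) (at 0)"
        by (simp add: DERIV_def)
      moreover have "filterlim h (at 0) sequentially"
      proof -
        have "h n \<noteq> 0" for n using h(1)[of n] by simp
        then show ?thesis using hlim by (simp add: filterlim_at)
      qed
      ultimately show "(\<lambda>n. q n x) \<longlonglongrightarrow> G x \<bullet> i"
        unfolding q_def by (rule filterlim_compose)
    qed
    show "AE x in lborel. norm (q n x) \<le> B * indicator (cball 0 (R + 1)) x" for n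
    proof (rule AE_I2)
      fix x
      have ni: "norm (h n *\<^sub>R i) \<le> 1" "norm (h n *\<^sub>R i) = h n" using i h[of n] by simp_all
      show "norm (q n x) \<le> B * indicator (cball 0 (R + 1)) x"
      proof (cases "x \<in> cball 0 (R + 1)")
        case True
        have "norm (f (x + h n *\<^sub>R i) - f x) \<le> B * norm ((x + h n *\<^sub>R i) - x)"
        proof (rule differentiable_bound[where S = UNIV])
          fix y
          show "(f has_derivative (\<lambda>h. h \<bullet> G y)) (at y within UNIV)"
            using C1_compactD(1)[OF f, of y] by (simp add: gderiv_def)
          have "norm (h \<bullet> G y) \<le> B * norm h" for h
          proof -
            have "norm (h \<bullet> G y) \<le> norm h * norm (G y)" using Cauchy_Schwarz_ineq2 by simp
            also have "\<dots> \<le> norm h * B" by (intro mult_left_mono B[rule_format]) auto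
            finally show ?thesis by (simp add: mult.commute)
          qed
          then show "onorm (\<lambda>h. h \<bullet> G y) \<le> B" by (rule onorm_le)
        qed auto
        then show ?thesis using True h[of n] ni by (simp add: q_def field_simps)
      next
        case False
        then have "norm x > R + 1" by simp
        moreover have "norm x \<le> norm (x + h n *\<^sub>R i) + norm (h n *\<^sub>R i)"
          using norm_triangle_ineq4[of "x + h n *\<^sub>R i" "h n *\<^sub>R i"] by simp
        ultimately have "norm x > R" "norm (x + h n *\<^sub>R i) > R" using ni by auto
        then have "x \<notin> ?K" "x + h n *\<^sub>R i \<notin> ?K" using R by force+
        from this[THEN C1_compactD(4)[OF f]] show ?thesis using False by (simp add: q_def)
      qed
    qed
  qed
  then show ?thesis using q0 LIMSEQ_unique[OF _ tendsto_const] by fastforce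
qed

section \<open>Twice continuously differentiable functions and a bump\<close>

definition C2_fun :: "('a::euclidean_space \<Rightarrow> real) \<Rightarrow> ('a \<Rightarrow> 'a) \<Rightarrow> ('a \<Rightarrow> 'a \<Rightarrow> 'a) \<Rightarrow> bool" where
  "C2_fun \<phi> D G \<longleftrightarrow> (\<forall>x. GDERIV \<phi> x :> D x) \<and>
     (\<forall>i\<in>Basis. (\<forall>x. GDERIV (\<lambda>x. D x \<bullet> i) x :> G i x) \<and> continuous_on UNIV (G i))"

text \<open>Under \<open>C2_fun \<phi> D G\<close> the vector \<open>G i x\<close> is the i-th row
  of the Hessian, so this is the Laplacian of \<open>\<phi>\<close>. Derivatives are carried as
  explicit witnesses, so that sums, multiples and affine substitutions act on them by
  formulas.\<close>

definition hess_trace :: "('a::euclidean_space \<Rightarrow> 'a \<Rightarrow> 'a) \<Rightarrow> 'a \<Rightarrow> real" where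
  "hess_trace G x = (\<Sum>i\<in>Basis. G i x \<bullet> i)"

lemma C2_fun_const: "C2_fun (\<lambda>_. c) (\<lambda>_. 0) (\<lambda>_ _. 0)"
  by (auto simp: C2_fun_def gderiv_def)

lemma C2_fun_add:
  "C2_fun \<phi> D G \<Longrightarrow> C2_fun \<phi>' D' G' \<Longrightarrow> C2_fun (\<lambda>x. \<phi> x + \<phi>' x) (\<lambda>x. D x + D' x) (\<lambda>i x. G i x + G' i x)"
  unfolding C2_fun_def by (auto simp: inner_add_left intro!: GDERIV_add continuous_intros)

lemma GDERIV_cmult: "GDERIV f x :> D \<Longrightarrow> GDERIV (\<lambda>x. a * f x) x :> a *\<^sub>R D" for a :: real
  unfolding gderiv_def by (auto intro!: derivative_eq_intros)

lemma C2_fun_scale: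
  "C2_fun \<phi> D G \<Longrightarrow> C2_fun (\<lambda>x. a * \<phi> x) (\<lambda>x. a *\<^sub>R D x) (\<lambda>i x. a *\<^sub>R G i x)"
  unfolding C2_fun_def by (auto intro!: GDERIV_cmult continuous_intros)

lemma GDERIV_affine:
  assumes "GDERIV f (p + c *\<^sub>R x) :> D"
  shows "GDERIV (\<lambda>x. f (p + c *\<^sub>R x)) x :> c *\<^sub>R D"
proof -
  have "((\<lambda>x. p + c *\<^sub>R x) has_derivative (\<lambda>h. c *\<^sub>R h)) (at x)" by (auto intro!: derivative_eq_intros)
  from has_derivative_compose[OF this assms[unfolded gderiv_def]]
  show ?thesis unfolding gderiv_def by (simp add: mult.commute)
qed

lemma C2_fun_affine:
  assumes "C2_fun \<phi> D G"
  shows "C2_fun (\<lambda>x. \<phi> (p + c *\<^sub>R x)) (\<lambda>x. c *\<^sub>R D (p + c *\<^sub>R x)) (\<lambda>i x. c\<^sup>2 *\<^sub>R G i (p + c *\<^sub>R x))"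
  unfolding C2_fun_def
proof (intro conjI allI ballI)
  fix x
  show "GDERIV (\<lambda>x. \<phi> (p + c *\<^sub>R x)) x :> c *\<^sub>R D (p + c *\<^sub>R x)"
    by (rule GDERIV_affine) (use assms in \<open>auto simp: C2_fun_def\<close>)
next
  fix i x :: 'a assume i: "i \<in> Basis"
  have "GDERIV (\<lambda>x. D x \<bullet> i) (p + c *\<^sub>R x) :> G i (p + c *\<^sub>R x)"
    using assms i by (auto simp: C2_fun_def)
  from GDERIV_cmult[OF GDERIV_affine[OF this], of c]
  show "GDERIV (\<lambda>x. c *\<^sub>R D (p + c *\<^sub>R x) \<bullet> i) x :> c\<^sup>2 *\<^sub>R G i (p + c *\<^sub>R x)"
    by (simp add: power2_eq_square)
next
  fix i :: 'a assume "i \<in> Basis"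
  then have "continuous_on UNIV (G i)" using assms by (auto simp: C2_fun_def)
  then have "continuous_on UNIV (\<lambda>x. G i (p + c *\<^sub>R x))"
    by (rule continuous_on_compose2) (auto intro!: continuous_intros)
  then show "continuous_on UNIV (\<lambda>x. c\<^sup>2 *\<^sub>R G i (p + c *\<^sub>R x))" by (intro continuous_intros)
qed

lemma hess_trace_add: "hess_trace (\<lambda>i x. G i x + G' i x) x = hess_trace G x + hess_trace G' x"
  by (simp add: hess_trace_def inner_add_left sum.distrib)

lemma hess_trace_scale: "hess_trace (\<lambda>i x. a *\<^sub>R G i x) x = a * hess_trace G x"
  by (simp add: hess_trace_def sum_distrib_left)

lemma DERIV_max_0_power:
  "((\<lambda>u. max 0 u ^ Suc (Suc n)) has_real_derivative real (Suc (Suc n)) * max 0 u ^ Suc n) (at u)" for u :: real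
proof -
  consider "u > 0" | "u < 0" | "u = 0" by linarith
  then show ?thesis
  proof cases
    case 1
    have "((\<lambda>u. u ^ Suc (Suc n)) has_real_derivative real (Suc (Suc n)) * max 0 u ^ Suc n) (at u)"
      using 1 by (auto intro!: derivative_eq_intros simp del: power_Suc)
    then show ?thesis
      by (rule has_field_derivative_transform_within_open[where S = "{0<..}"]) (use 1 in auto)
  next
    case 2
    have "((\<lambda>u. 0) has_real_derivative real (Suc (Suc n)) * max 0 u ^ Suc n) (at u)"
      using 2 by (auto intro!: derivative_eq_intros)
    then show ?thesis
      by (rule has_field_derivative_transform_within_open[where S = "{..<0}"]) (use 2 in auto)
  next
    case 3
    have "((\<lambda>h. max 0 h ^ Suc n) \<longlongrightarrow> max 0 0 ^ Suc n) (at (0::real))" by (intro tendsto_intros)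
    then have "((\<lambda>h. max 0 h ^ Suc n) \<longlongrightarrow> 0) (at (0::real))" by simp
    moreover have "max 0 h ^ Suc n = max 0 h ^ Suc (Suc n) / h" if "h \<noteq> 0" for h :: real
      using that by (cases "h > 0") (auto simp: max_def)
    ultimately have "((\<lambda>h. max 0 h ^ Suc (Suc n) / h) \<longlongrightarrow> 0) (at (0::real))"
      using LIM_equal[of 0 "\<lambda>h. max 0 h ^ Suc n" "\<lambda>h. max 0 h ^ Suc (Suc n) / h"] by blast
    then show ?thesis using 3 by (simp add: DERIV_def)
  qed
qed

text \<open>The cube is the lowest integer power for which truncating
  \<open>r\<^sup>2 - x \<bullet> x\<close> at 0 leaves the second derivatives continuous across the
  sphere.\<close>

definition bump :: "real \<Rightarrow> 'a::euclidean_space \<Rightarrow> real" where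
  "bump r x = max 0 (r\<^sup>2 - x \<bullet> x) ^ 3"

definition bump_grad :: "real \<Rightarrow> 'a::euclidean_space \<Rightarrow> 'a" where
  "bump_grad r x = (- 6 * max 0 (r\<^sup>2 - x \<bullet> x) ^ 2) *\<^sub>R x"

definition bump_hess :: "real \<Rightarrow> 'a::euclidean_space \<Rightarrow> 'a \<Rightarrow> 'a" where
  "bump_hess r i x = (- 6 * max 0 (r\<^sup>2 - x \<bullet> x) ^ 2) *\<^sub>R i + (24 * max 0 (r\<^sup>2 - x \<bullet> x) * (x \<bullet> i)) *\<^sub>R x"

lemma GDERIV_max_0_power:
  "GDERIV (\<lambda>x. max 0 (r\<^sup>2 - x \<bullet> x) ^ Suc (Suc n)) x :> (- 2 * real (Suc (Suc n)) * max 0 (r\<^sup>2 - x \<bullet> x) ^ Suc n) *\<^sub>R x"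
proof -
  have "((\<lambda>x. r\<^sup>2 - x \<bullet> x) has_derivative (\<lambda>h. - 2 * (h \<bullet> x))) (at x)"
    by (auto intro!: derivative_eq_intros simp: inner_commute)
  from has_derivative_compose[OF this DERIV_max_0_power[of n, unfolded has_field_derivative_def]]
  have "((\<lambda>x. max 0 (r\<^sup>2 - x \<bullet> x) ^ Suc (Suc n)) has_derivative
    (\<lambda>h. real (Suc (Suc n)) * max 0 (r\<^sup>2 - x \<bullet> x) ^ Suc n * (- 2 * (h \<bullet> x)))) (at x)" .
  moreover have "(\<lambda>h. real (Suc (Suc n)) * max 0 (r\<^sup>2 - x \<bullet> x) ^ Suc n * (- 2 * (h \<bullet> x))) =
    (\<lambda>h. h \<bullet> ((- 2 * real (Suc (Suc n)) * max 0 (r\<^sup>2 - x \<bullet> x) ^ Suc n) *\<^sub>R x))"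
    by (rule ext) (simp only: inner_scaleR_right mult_ac)
  ultimately show ?thesis unfolding gderiv_def by (simp only:)
qed

lemma C2_fun_bump: "C2_fun (bump r) (bump_grad r) (bump_hess r)"
  unfolding C2_fun_def
proof (intro conjI allI ballI)
  fix x :: 'a
  show "GDERIV (bump r) x :> bump_grad r x"
    using GDERIV_max_0_power[of r 1 x] unfolding bump_def[abs_def] bump_grad_def
    by (simp add: numeral_3_eq_3 numeral_2_eq_2)
next
  fix i x :: 'a assume "i \<in> Basis"
  have "GDERIV (\<lambda>x. x \<bullet> i) x :> i" by (auto simp: gderiv_def intro!: derivative_eq_intros)
  from GDERIV_mult[OF GDERIV_cmult[OF GDERIV_max_0_power[of r 0 x], of "-6"] this]
  show "GDERIV (\<lambda>x. bump_grad r x \<bullet> i) x :> bump_hess r i x"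
    unfolding bump_hess_def bump_grad_def by (simp add: numeral_2_eq_2 mult_ac)
next
  fix i :: 'a
  show "continuous_on UNIV (bump_hess r i)"
    unfolding bump_hess_def[abs_def] by (intro continuous_intros)
qed

lemma bump_nonneg: "0 \<le> bump r x" by (simp add: bump_def)

lemma bump_pos: "norm x < r \<Longrightarrow> 0 < bump r x"
proof -
  assume "norm x < r"
  then have "(norm x)\<^sup>2 < r\<^sup>2" by (intro power_strict_mono) auto
  then show ?thesis by (simp add: bump_def power2_norm_eq_inner)
qed

lemma bump_zero:
  assumes "r \<ge> 0" "x \<notin> cball 0 r"
  shows "bump r x = 0" "bump_grad r x = 0" "bump_hess r i x = 0"
proof -
  have "r\<^sup>2 \<le> (norm x)\<^sup>2" using assms by (intro power_mono) auto
  then have "max 0 (r\<^sup>2 - x \<bullet> x) = 0" by (simp add: power2_norm_eq_inner)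
  then show "bump r x = 0" "bump_grad r x = 0" "bump_hess r i x = 0"
    by (simp_all add: bump_def bump_grad_def bump_hess_def)
qed

lemma C1_compactI:
  assumes "\<And>x. GDERIV \<phi> x :> g x" "continuous_on UNIV g" "compact K" "K \<subseteq> \<Omega>" "\<And>x. x \<notin> K \<Longrightarrow> \<phi> x = 0"
  shows "C1_compact \<Omega> \<phi> g"
proof -
  have "closure {x. \<phi> x \<noteq> 0} \<subseteq> K"
    using assms(5) compact_imp_closed[OF assms(3)] by (intro closure_minimal) auto
  moreover from this have "bounded (closure {x. \<phi> x \<noteq> 0})"
    using compact_imp_bounded[OF assms(3)] bounded_subset by blast
  ultimately show ?thesis using assms(1,2,4) by (auto simp: C1_compact_def compact_eq_bounded_closed)
qed

lemma C1_compact_bump: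
  assumes "r \<ge> 0"
  shows "C1_compact UNIV (bump r) (bump_grad r)"
    and "i \<in> Basis \<Longrightarrow> C1_compact UNIV (\<lambda>x. bump_grad r x \<bullet> i) (bump_hess r i)"
proof -
  show "C1_compact UNIV (bump r) (bump_grad r)"
  proof (rule C1_compactI[of _ _ "cball 0 r"])
    show "continuous_on UNIV (bump_grad r)" unfolding bump_grad_def[abs_def] by (intro continuous_intros)
  qed (use C2_fun_bump bump_zero[OF assms] in \<open>auto simp: C2_fun_def\<close>)
  show "C1_compact UNIV (\<lambda>x. bump_grad r x \<bullet> i) (bump_hess r i)" if "i \<in> Basis"
  proof (rule C1_compactI[of _ _ "cball 0 r"])
    show "bump_grad r x \<bullet> i = 0" if "x \<notin> cball 0 r" for x
      using bump_zero(2)[OF assms that] by simp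
  qed (use C2_fun_bump[of r] that in \<open>auto simp: C2_fun_def\<close>)
qed

text \<open>Mollifying a measure that is subharmonic up to \<open>\<kappa>\<close> in the sense of distributions yields a
  test function with Rayleigh quotient at most \<open>\<kappa>\<close>.\<close>

lemma subsolution_measure_imp_test_function:
  fixes N :: "'a::euclidean_space measure"
  assumes N: "finite_measure N" "sets N = sets borel" "emeasure N (space N) \<noteq> 0"
    and A: "compact A" "A \<subseteq> \<Omega>" "AE z in N. z \<in> A" and \<Omega>: "open \<Omega>"
    and sub: "\<And>\<phi> D G. C2_fun \<phi> D G \<Longrightarrow> (\<And>x. 0 \<le> \<phi> x) \<Longrightarrow> 0 \<le> (LINT z|N. 1/2 * hess_trace G z + \<kappa> * \<phi> z)"
  obtains b g where "C1_compact \<Omega> b g" "0 < (LINT x|lborel. (b x)\<^sup>2)"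
    "1/2 * (LINT x|lborel. (norm (g x))\<^sup>2) \<le> \<kappa> * (LINT x|lborel. (b x)\<^sup>2)"
proof -
  interpret finite_measure N by (rule N(1))
  obtain \<epsilon> where \<epsilon>: "\<epsilon> > 0" "(\<Union>x\<in>A. ball x \<epsilon>) \<subseteq> \<Omega>"
    by (rule compact_subset_open_imp_ball_epsilon_subset[OF A(1) \<Omega> A(2)])
  \<comment> \<open>Half of the distance guaranteed around \<open>A\<close> leaves room for the
    closed ball of radius \<open>r\<close>, so the mollified measure has compact support in
    \<open>\<Omega>\<close>.\<close>
  define r where "r = \<epsilon> / 2"
  have r: "r > 0" "r \<ge> 0" using \<epsilon> by (simp_all add: r_def)
  note cb = C1_compact_bump(1)[OF r(2)] and cg = C1_compact_bump(2)[OF r(2)]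
  have cK: "compact (cball (0::'a) r)" by simp
  note b_int = conv_integrable[OF N(1,2) C1_compactD(3)[OF cb] cK bump_zero(1)[OF r(2)]]
  note g_int = conv_integrable[OF N(1,2) C1_compactD(2)[OF cb] cK bump_zero(2)[OF r(2)]]
  have h_int: "integrable N (\<lambda>z. bump_hess r i (x - z))" if "i \<in> Basis" for i x
    by (rule conv_integrable[OF N(1,2) C1_compactD(2)[OF cg[OF that]] cK bump_zero(3)[OF r(2)]])
  define b where "b = conv N (bump r)"
  define g where "g = conv N (bump_grad r)"
  define h where "h i = conv N (bump_hess r i)" for i
  have b_der: "GDERIV b x :> g x" for x unfolding b_def g_def by (rule conv_gderiv[OF N(1,2) cb])
  have gi_eq: "conv N (\<lambda>x. bump_grad r x \<bullet> i) = (\<lambda>x. g x \<bullet> i)" for i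
    unfolding g_def conv_def using g_int by (auto intro!: ext integral_inner_left)
  have g_der: "GDERIV (\<lambda>x. g x \<bullet> i) x :> h i x" if "i \<in> Basis" for i x
    using conv_gderiv[OF N(1,2) cg[OF that], of x] unfolding gi_eq h_def .
  have b_cont: "continuous_on UNIV b"
    unfolding b_def by (rule conv_continuous[OF N(1,2) C1_compactD(3)[OF cb] cK bump_zero(1)[OF r(2)]])
  have g_cont: "continuous_on UNIV g"
    unfolding g_def by (rule conv_continuous[OF N(1,2) C1_compactD(2)[OF cb] cK bump_zero(2)[OF r(2)]])
  have h_cont: "continuous_on UNIV (h i)" if "i \<in> Basis" for i
    unfolding h_def by (rule conv_continuous[OF N(1,2) C1_compactD(2)[OF cg[OF that]] cK bump_zero(3)[OF r(2)]])
  define K where "K = (\<lambda>(a, c). a + c) ` (A \<times> cball 0 r)"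
  have K: "compact K"
    unfolding K_def by (intro compact_continuous_image compact_Times A(1) cK) (auto intro!: continuous_intros simp: case_prod_beta)
  have K\<Omega>: "K \<subseteq> \<Omega>"
  proof
    fix x assume "x \<in> K"
    then obtain a c where "x = a + c" "a \<in> A" "norm c \<le> r" by (auto simp: K_def)
    then have "x \<in> ball a \<epsilon>" "a \<in> A" using \<epsilon>(1) by (auto simp: dist_norm r_def)
    then have "x \<in> (\<Union>x\<in>A. ball x \<epsilon>)" by blast
    then show "x \<in> \<Omega>" using \<epsilon>(2) by blast
  qed
  have b_out: "b x = 0" if "x \<notin> K" for x
  proof -
    have "AE z in N. bump r (x - z) = 0"
      using A(3)
    proof eventually_elim
      case (elim z)
      have "x - z \<notin> cball 0 r"
      proof
        assume "x - z \<in> cball 0 r"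
        then have "(\<lambda>(a, c). a + c) (z, x - z) \<in> K" unfolding K_def using elim by (intro imageI) auto
        then show False using that by simp
      qed
      then show ?case by (rule bump_zero(1)[OF r(2)])
    qed
    then show ?thesis unfolding b_def conv_def by (rule integral_eq_zero_AE)
  qed
  have C: "C1_compact \<Omega> b g" by (rule C1_compactI[OF b_der g_cont K K\<Omega> b_out])
  have b0: "0 \<le> b x" for x unfolding b_def conv_def by (intro integral_nonneg_AE) (simp add: bump_nonneg)
  define t where "t x = (\<Sum>i\<in>Basis. h i x \<bullet> i)" for x
  have t_eq: "t x = (LINT z|N. hess_trace (bump_hess r) (x - z))" for x
    unfolding t_def h_def conv_def hess_trace_def using h_int by simp
  have tr_int: "integrable N (\<lambda>z. hess_trace (bump_hess r) (x - z))" for x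
    unfolding hess_trace_def using h_int by simp
  \<comment> \<open>The bump reflected and centred at \<open>x\<close> is a nonnegative test
    function of \<open>z\<close>, and \<open>(-1)\<^sup>2\<close> leaves its Laplacian unchanged.
    The distributional inequality for \<open>N\<close> thereby becomes a pointwise one for
    \<open>b\<close>.\<close>
  have t_ge: "- (1/2) * t x \<le> \<kappa> * b x" for x
  proof -
    have "C2_fun (\<lambda>z. bump r (x + (-1) *\<^sub>R z)) (\<lambda>z. (-1) *\<^sub>R bump_grad r (x + (-1) *\<^sub>R z)) (\<lambda>i z. (-1)\<^sup>2 *\<^sub>R bump_hess r i (x + (-1) *\<^sub>R z))"
      by (rule C2_fun_affine[OF C2_fun_bump])
    then have "0 \<le> (LINT z|N. 1/2 * hess_trace (\<lambda>i z. (-1)\<^sup>2 *\<^sub>R bump_hess r i (x + (-1) *\<^sub>R z)) z + \<kappa> * bump r (x + (-1) *\<^sub>R z))"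
      by (rule sub) (rule bump_nonneg)
    also have "\<dots> = (LINT z|N. 1/2 * hess_trace (bump_hess r) (x - z) + \<kappa> * bump r (x - z))"
      by (simp add: hess_trace_def)
    also have "\<dots> = 1/2 * t x + \<kappa> * b x"
      using tr_int b_int by (simp add: t_eq b_def conv_def)
    finally show ?thesis by simp
  qed
  have t_cont: "continuous_on UNIV t"
    unfolding t_def by (intro continuous_intros h_cont)
  have bt_int: "integrable lborel (\<lambda>x. b x * t x)"
    by (rule integrable_continuous_zero_outside_compact[OF _ K])
      (auto intro!: continuous_intros b_cont t_cont simp: b_out)
  have g_out: "g x = 0" if "x \<notin> K" for x
  proof (rule C1_compactD(5)[OF C])
    have "closure {x. b x \<noteq> 0} \<subseteq> K"
      using b_out compact_imp_closed[OF K] by (intro closure_minimal) auto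
    then show "x \<notin> closure {x. b x \<noteq> 0}" using that by auto
  qed
  have gi_int: "integrable lborel (\<lambda>x. (g x \<bullet> i)\<^sup>2)" for i
    by (rule integrable_continuous_zero_outside_compact[OF _ K])
      (auto intro!: continuous_intros g_cont simp: g_out)
  have bh_int: "integrable lborel (\<lambda>x. b x * (h i x \<bullet> i))" if "i \<in> Basis" for i
    by (rule integrable_continuous_zero_outside_compact[OF _ K])
      (auto intro!: continuous_intros b_cont h_cont that simp: b_out)
  \<comment> \<open>Integration by parts in one coordinate: the gradient of
    \<open>b * (g \<bullet> i)\<close> has vanishing i-th integral.\<close>
  have parts: "(LINT x|lborel. (g x \<bullet> i)\<^sup>2) = - (LINT x|lborel. b x * (h i x \<bullet> i))" if i: "i \<in> Basis" for i
  proof -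
    have "C1_compact \<Omega> (\<lambda>x. b x * (g x \<bullet> i)) (\<lambda>x. b x *\<^sub>R h i x + (g x \<bullet> i) *\<^sub>R g x)"
    proof (rule C1_compactI[OF _ _ K K\<Omega>])
      show "GDERIV (\<lambda>x. b x * (g x \<bullet> i)) x :> b x *\<^sub>R h i x + (g x \<bullet> i) *\<^sub>R g x" for x
        by (rule GDERIV_mult[OF b_der g_der[OF i]])
      show "continuous_on UNIV (\<lambda>x. b x *\<^sub>R h i x + (g x \<bullet> i) *\<^sub>R g x)"
        by (intro continuous_intros b_cont g_cont h_cont i)
    qed (simp add: b_out)
    from integral_gradient_zero[OF this i]
    have "0 = (LINT x|lborel. b x * (h i x \<bullet> i) + (g x \<bullet> i)\<^sup>2)"
      by (simp add: inner_add_left power2_eq_square)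
    also have "\<dots> = (LINT x|lborel. b x * (h i x \<bullet> i)) + (LINT x|lborel. (g x \<bullet> i)\<^sup>2)"
    proof (rule Bochner_Integration.integral_add)
      show "integrable lborel (\<lambda>x. b x * (h i x \<bullet> i))" by (rule bh_int[OF i])
      show "integrable lborel (\<lambda>x. (g x \<bullet> i)\<^sup>2)" by (rule gi_int)
    qed
    finally show ?thesis by simp
  qed
  have "(LINT x|lborel. (norm (g x))\<^sup>2) = (LINT x|lborel. (\<Sum>i\<in>Basis. (g x \<bullet> i)\<^sup>2))"
    by (intro Bochner_Integration.integral_cong refl)
      (unfold power2_norm_eq_inner, subst euclidean_inner, simp add: power2_eq_square)
  also have "\<dots> = (\<Sum>i\<in>Basis. LINT x|lborel. (g x \<bullet> i)\<^sup>2)"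
    by (rule Bochner_Integration.integral_sum) (rule gi_int)
  also have "\<dots> = (\<Sum>i\<in>Basis. - (LINT x|lborel. b x * (h i x \<bullet> i)))"
    by (rule sum.cong) (simp_all add: parts)
  also have "\<dots> = - (LINT x|lborel. (\<Sum>i\<in>Basis. b x * (h i x \<bullet> i)))"
    using bh_int by (simp add: sum_negf)
  also have "\<dots> = - (LINT x|lborel. b x * t x)"
    by (simp add: t_def sum_distrib_left)
  finally have "1/2 * (LINT x|lborel. (norm (g x))\<^sup>2) = (LINT x|lborel. b x * (- (1/2) * t x))"
    using bt_int by simp
  also have "\<dots> \<le> (LINT x|lborel. b x * (\<kappa> * b x))"
  proof (rule integral_mono)
    have "integrable lborel (\<lambda>x. - (1/2) * (b x * t x))" by (rule integrable_mult_right[OF bt_int])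
    then show "integrable lborel (\<lambda>x. b x * (- (1/2) * t x))" by (simp add: mult.left_commute)
    have "integrable lborel (\<lambda>x. \<kappa> * (b x * b x))"
      by (rule integrable_mult_right[OF C1_compact_integrable(1)[OF C C]])
    then show "integrable lborel (\<lambda>x. b x * (\<kappa> * b x))" by (simp add: mult.left_commute)
    show "b x * (- (1/2) * t x) \<le> b x * (\<kappa> * b x)" for x
      by (rule mult_left_mono[OF t_ge b0])
  qed
  also have "\<dots> = \<kappa> * (LINT x|lborel. (b x)\<^sup>2)"
    by (simp add: power2_eq_square mult.left_commute)
  finally have ray: "1/2 * (LINT x|lborel. (norm (g x))\<^sup>2) \<le> \<kappa> * (LINT x|lborel. (b x)\<^sup>2)" .
  \<comment> \<open>If \<open>b\<close> vanished almost everywhere, exchanging the integrals would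
    make the integral of the bump times the mass of \<open>N\<close> zero, although both factors are
    positive.\<close>
  have pos: "0 < (LINT x|lborel. (b x)\<^sup>2)"
  proof (rule ccontr)
    assume "\<not> ?thesis"
    then have "(LINT x|lborel. (b x)\<^sup>2) = 0" by (intro antisym) auto
    moreover have "integrable lborel (\<lambda>x. (b x)\<^sup>2)"
      using C1_compact_integrable(1)[OF C C] by (simp add: power2_eq_square)
    ultimately have "AE x in lborel. (b x)\<^sup>2 = 0"
      by (subst (asm) integral_nonneg_eq_0_iff_AE) auto
    then have "AE x in lborel. ennreal (b x) = 0" by eventually_elim simp
    then have "(\<integral>\<^sup>+x. ennreal (b x) \<partial>lborel) = 0"
      by (subst nn_integral_cong_AE[where v = "\<lambda>_. 0"]) auto
    interpret pair_sigma_finite lborel N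
      by (simp add: pair_sigma_finite_def sigma_finite_lborel sigma_finite_measure_axioms)
    note [measurable_cong] = N(2)
    have [measurable]: "(bump r :: 'a \<Rightarrow> real) \<in> borel_measurable borel" by (rule C1_compactD(8)[OF cb])
    define c where "c = (\<integral>\<^sup>+x. ennreal (bump r (x :: 'a)) \<partial>lborel)"
    have "(\<integral>\<^sup>+x. ennreal (b x) \<partial>lborel) = (\<integral>\<^sup>+x. \<integral>\<^sup>+z. ennreal (bump r (x - z)) \<partial>N \<partial>lborel)"
      unfolding b_def conv_def
    proof (rule nn_integral_cong)
      fix x
      have "integrable N (\<lambda>z. bump r (x - z))" by (rule b_int)
      then show "ennreal (LINT z|N. bump r (x - z)) = (\<integral>\<^sup>+z. ennreal (bump r (x - z)) \<partial>N)"
        by (rule nn_integral_eq_integral[symmetric]) (simp add: bump_nonneg)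
    qed
    also have "\<dots> = (\<integral>\<^sup>+z. \<integral>\<^sup>+x. ennreal (bump r (x - z)) \<partial>lborel \<partial>N)"
      by (rule Fubini'[symmetric]) measurable
    also have "\<dots> = (\<integral>\<^sup>+z. c \<partial>N)"
    proof (rule nn_integral_cong)
      fix z :: 'a
      have "(\<integral>\<^sup>+x. ennreal (bump r (x + - z)) \<partial>lborel) = c"
        unfolding c_def
        by (rule nn_integral_lborel_translate[of "\<lambda>x. ennreal (bump r x)"]) measurable
      then show "(\<integral>\<^sup>+x. ennreal (bump r (x - z)) \<partial>lborel) = c" by simp
    qed
    also have "\<dots> = c * emeasure N (space N)" by simp
    finally have "c = 0" using \<open>(\<integral>\<^sup>+x. ennreal (b x) \<partial>lborel) = 0\<close> N(3) by simp
    then have "AE x::'a in lborel. ennreal (bump r x) = 0"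
      unfolding c_def by (subst (asm) nn_integral_0_iff_AE) auto
    then have "AE x::'a in lborel. indicator (ball 0 r) x = (0::ennreal)"
    proof eventually_elim
      case (elim x)
      then have "bump r x = 0" using bump_nonneg[of r x] by simp
      then have "\<not> norm x < r" using bump_pos[of x r] by force
      then show ?case by (simp add: indicator_def)
    qed
    then have "(\<integral>\<^sup>+x. indicator (ball (0::'a) r) x \<partial>lborel) = 0"
      by (subst nn_integral_cong_AE[where v = "\<lambda>_. 0"]) auto
    then have "emeasure lborel (ball (0::'a) r) = 0" by simp
    then have "measure lborel (ball (0::'a) r) = 0" by (simp add: measure_def)
    then show False using content_ball_pos[OF r(1), of "0::'a"] by simp
  qed
  show thesis by (rule that[OF C pos ray])
qed

section \<open>Dini's theorem and the separation argument for the supersolution\<close>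

lemma Dini:
  fixes f :: "nat \<Rightarrow> 'a::metric_space \<Rightarrow> real"
  assumes K: "compact K" and cont: "\<And>n. continuous_on K (f n)"
    and dec: "\<And>n x. x \<in> K \<Longrightarrow> f (Suc n) x \<le> f n x"
    and lim: "\<And>x. x \<in> K \<Longrightarrow> (\<lambda>n. f n x) \<longlonglongrightarrow> 0" and e: "e > 0"
  shows "\<exists>N. \<forall>n\<ge>N. \<forall>x\<in>K. f n x < e"
proof (rule ccontr)
  have anti: "f n x \<le> f m x" if "x \<in> K" "m \<le> n" for m n x
    using lift_Suc_antimono_le[of "\<lambda>n. f n x", OF dec[OF that(1)] that(2)] .
  assume "\<not> ?thesis"
  then have "\<forall>N. \<exists>x\<in>K. e \<le> f N x" using anti by (metis not_le order_trans)
  then obtain x where x: "\<And>n. x n \<in> K" "\<And>n. e \<le> f n (x n)" by metis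
  obtain l r where l: "l \<in> K" "strict_mono (r :: nat \<Rightarrow> nat)" "(x \<circ> r) \<longlonglongrightarrow> l"
    using K x(1) unfolding compact_def by metis
  \<comment> \<open>Monotonicity gives \<open>f m\<close> a value of at least \<open>e\<close> at
    all late bad points; continuity of this one function carries the bound to their limit, where
    pointwise convergence contradicts it.\<close>
  have "e \<le> f m l" for m
  proof (rule LIMSEQ_le_const)
    show "(\<lambda>n. f m ((x \<circ> r) n)) \<longlonglongrightarrow> f m l"
      using continuous_on_tendsto_compose[OF cont[of m] l(3) l(1)] x(1) by (auto intro: always_eventually)
    have "e \<le> f m ((x \<circ> r) n)" if "n \<ge> m" for n
    proof -
      have "m \<le> r n" using seq_suble[OF l(2), of n] that by simp
      from anti[OF x(1) this, of "r n"] x(2)[of "r n"] show ?thesis by simp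
    qed
    then show "\<exists>N. \<forall>n\<ge>N. e \<le> f m ((x \<circ> r) n)" by blast
  qed
  then have "e \<le> 0" by (intro LIMSEQ_le_const[OF lim[OF l(1)]]) auto
  with e show False by simp
qed

text \<open>Absence of a supersolution is precisely positivity of a functional on \<open>R\<close>:
  an element that is nonnegative on \<open>S\<close> and has negative value would, after rescaling,
  be a supersolution. The two components, indexed by a Boolean, record the two inequalities required
  of \<open>\<phi>\<close>.\<close>

lemma strict_supersolution_exists:
  fixes \<Omega> :: "'a::euclidean_space set"
  assumes \<Omega>: "open \<Omega>" "bounded \<Omega>" "convex \<Omega>" "\<Omega> \<noteq> {}"
    and l: "is_poincare_constant \<Omega> l" and \<gamma>: "0 < \<gamma>" "\<gamma> < l"
  obtains \<phi> D G where "C2_fun \<phi> D G" "\<And>x. x \<in> closure \<Omega> \<Longrightarrow> 1 \<le> \<phi> x"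
    "\<And>x. x \<in> closure \<Omega> \<Longrightarrow> 1 \<le> - (1/2) * hess_trace G x - \<gamma> * \<phi> x"
proof (rule ccontr)
  assume "\<not> thesis"
  with that have no: False if "C2_fun \<phi> D G" "\<And>x. x \<in> closure \<Omega> \<Longrightarrow> 1 \<le> \<phi> x"
    "\<And>x. x \<in> closure \<Omega> \<Longrightarrow> 1 \<le> - (1/2) * hess_trace G x - \<gamma> * \<phi> x" for \<phi> D G
    using that by blast
  define K where "K = closure \<Omega>"
  have K: "compact K" unfolding K_def using \<Omega>(2) by (simp add: compact_closure)
  define Y :: "('a \<Rightarrow> real) \<Rightarrow> ('a \<Rightarrow> 'a \<Rightarrow> 'a) \<Rightarrow> bool \<times> 'a \<Rightarrow> real"
    where "Y \<phi> G = (\<lambda>(b, x). if b then \<phi> x else - (1/2) * hess_trace G x - \<gamma> * \<phi> x)" for \<phi> G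
  \<comment> \<open>The functional vanishes on all pairs of values coming from C2 functions and
    takes the value 1 at the constant 1. The constants also majorize all bounded functions, so the
    extension covers every continuous function on the compact set \<open>K\<close>.\<close>
  define R where "R = {(y, s :: real). \<exists>\<phi> D G. C2_fun \<phi> D G \<and> y = (\<lambda>i. Y \<phi> G i + s)}"
  have RI: "(\<lambda>i. Y \<phi> G i + s, s) \<in> R" if "C2_fun \<phi> D G" for \<phi> D G s
    using that by (auto simp: R_def)
  have Rconst: "(\<lambda>_. s, s) \<in> R" for s
    using RI[OF C2_fun_const[of 0], of s] by (simp add: Y_def hess_trace_def case_prod_beta cong: if_cong)
  define S where "S = (UNIV :: bool set) \<times> K"
  define E where "E = {x. \<exists>(y, c)\<in>R. \<forall>i\<in>S. \<bar>x i\<bar> \<le> y i}"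
  have Radd: "(\<lambda>i. x i + y i, c + d) \<in> R" if xy: "(x, c) \<in> R" "(y, d) \<in> R" for x c y d
  proof -
    from xy obtain \<phi> D G \<phi>' D' G' where *: "C2_fun \<phi> D G" "C2_fun \<phi>' D' G'"
      "x = (\<lambda>i. Y \<phi> G i + c)" "y = (\<lambda>i. Y \<phi>' G' i + d)" by (auto simp: R_def)
    have "(\<lambda>i. x i + y i) = (\<lambda>i. Y (\<lambda>x. \<phi> x + \<phi>' x) (\<lambda>i x. G i x + G' i x) i + (c + d))"
      by (auto simp: *(3,4) Y_def fun_eq_iff hess_trace_add algebra_simps)
    then show ?thesis using RI[OF C2_fun_add[OF *(1,2)], of "c + d"] by simp
  qed
  have Rscale: "(\<lambda>i. a * x i, a * c) \<in> R" if x: "(x, c) \<in> R" for x c a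
  proof -
    from x obtain \<phi> D G where *: "C2_fun \<phi> D G" "x = (\<lambda>i. Y \<phi> G i + c)" by (auto simp: R_def)
    have "(\<lambda>i. a * x i) = (\<lambda>i. Y (\<lambda>x. a * \<phi> x) (\<lambda>i x. a *\<^sub>R G i x) i + a * c)"
      by (auto simp: *(2) Y_def fun_eq_iff hess_trace_scale algebra_simps)
    then show ?thesis using RI[OF C2_fun_scale[OF *(1)], of a "a * c"] by simp
  qed
  obtain \<Lambda> where \<Lambda>: "linear_functional_on E \<Lambda>"
    "\<And>x. x \<in> E \<Longrightarrow> \<forall>i\<in>S. 0 \<le> x i \<Longrightarrow> 0 \<le> \<Lambda> x"
    "\<And>x c. (x, c) \<in> R \<Longrightarrow> x \<in> E \<Longrightarrow> \<Lambda> x = c"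
  proof (rule positive_extension[of R S, folded E_def])
    show "R \<noteq> {}" using Rconst by blast
    fix x c assume x: "(x, c) \<in> R" "\<forall>i\<in>S. 0 \<le> x i"
    then obtain \<phi> D G where *: "C2_fun \<phi> D G" "x = (\<lambda>i. Y \<phi> G i + c)" by (auto simp: R_def)
    show "0 \<le> c"
    proof (rule ccontr)
      assume "\<not> 0 \<le> c"
      then have c: "0 < - c" "0 < 1 / - c" by auto
      have Yc: "1 \<le> (1 / - c) * Y \<phi> G i" if "i \<in> S" for i
      proof -
        have "- c \<le> Y \<phi> G i" using x(2) that *(2) by (auto simp: algebra_simps)
        then show ?thesis using c by (simp add: field_simps)
      qed
      show False
      proof (rule no[OF C2_fun_scale[OF *(1), of "1 / - c"]])
        fix x assume "x \<in> closure \<Omega>"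
        then have "(True, x) \<in> S" "(False, x) \<in> S" by (auto simp: S_def K_def)
        from this[THEN Yc] show "1 \<le> 1 / - c * \<phi> x"
          "1 \<le> - (1/2) * hess_trace (\<lambda>i x. (1 / - c) *\<^sub>R G i x) x - \<gamma> * (1 / - c * \<phi> x)"
          unfolding hess_trace_scale by (simp_all add: Y_def algebra_simps)
      qed
    qed
  qed (rule that, assumption+ | rule Radd Rscale, assumption+)+
  have E_space: "linear_fun_space E"
    unfolding E_def by (rule linear_fun_space_majorized[OF Radd Rscale])
  have EI: "x \<in> E" if "\<forall>i\<in>S. \<bar>x i\<bar> \<le> M" for x M
    using Rconst[of M] that unfolding E_def by fast
  define C0 where "C0 = {f :: 'a \<Rightarrow> real. continuous_on K f}"
  define emb :: "bool \<Rightarrow> ('a \<Rightarrow> real) \<Rightarrow> bool \<times> 'a \<Rightarrow> real"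
    where "emb b f = (\<lambda>(b', x). if b' = b then f x else 0)" for b f
  have embE: "emb b f \<in> E" if "f \<in> C0" for b f
  proof -
    have "compact (f ` K)" using that K by (intro compact_continuous_image) (auto simp: C0_def)
    from compact_imp_bounded[OF this] obtain B where "\<forall>y\<in>f ` K. norm y \<le> B" by (auto simp: bounded_iff)
    then show ?thesis by (intro EI[of _ "max B 0"]) (auto simp: emb_def S_def le_max_iff_disj)
  qed
  have emb_add: "emb b (\<lambda>x. f x + g x) = (\<lambda>i. emb b f i + emb b g i)" for b f g
    by (auto simp: emb_def fun_eq_iff)
  have emb_scale: "emb b (\<lambda>x. a * f x) = (\<lambda>i. a * emb b f i)" for b f a
    by (auto simp: emb_def fun_eq_iff)
  define L where "L b f = \<Lambda> (emb b f)" for b f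
  have Lpos: "0 \<le> L b f" if "f \<in> C0" "\<forall>x\<in>K. 0 \<le> f x" for b f
    unfolding L_def using that by (intro \<Lambda>(2) embE) (auto simp: emb_def S_def)
  have L_split: "L True (\<lambda>x. y (True, x)) + L False (\<lambda>x. y (False, x)) = c"
    if "(y, c) \<in> R" "(\<lambda>x. y (True, x)) \<in> C0" "(\<lambda>x. y (False, x)) \<in> C0" for y c
  proof -
    have eq: "y = (\<lambda>i. emb True (\<lambda>x. y (True, x)) i + emb False (\<lambda>x. y (False, x)) i)"
      by (auto simp: emb_def fun_eq_iff)
    have yE: "y \<in> E"
      by (subst eq) (intro linear_fun_spaceD(1)[OF E_space] embE that)
    have "\<Lambda> y = L True (\<lambda>x. y (True, x)) + L False (\<lambda>x. y (False, x))"
      unfolding L_def by (subst eq) (intro linear_functional_onD(1)[OF \<Lambda>(1)] embE that)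
    then show ?thesis using \<Lambda>(3)[OF that(1) yE] by simp
  qed
  \<comment> \<open>On a compact set the Daniell condition is Dini's theorem together with
    positivity. Only this component is turned into a measure; the other contributes its sign and its
    value at constants.\<close>
  interpret daniell K C0 "L False"
  proof
    show "linear_fun_space C0" by (auto simp: linear_fun_space_def C0_def intro!: continuous_intros)
    show "(\<lambda>_. 1) \<in> C0" by (simp add: C0_def)
    show lin: "linear_functional_on C0 (L False)"
      unfolding linear_functional_on_def L_def emb_add emb_scale
      using linear_functional_onD[OF \<Lambda>(1)] embE by blast
    fix u :: "nat \<Rightarrow> 'a \<Rightarrow> real"
    assume u: "\<And>n. u n \<in> C0" "\<And>n x. x \<in> K \<Longrightarrow> u (Suc n) x \<le> u n x" "\<And>x. x \<in> K \<Longrightarrow> (\<lambda>n. u n x) \<longlonglongrightarrow> 0"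
    have u0: "0 \<le> u n x" if "x \<in> K" for n x
      using decseq_ge[OF decseq_SucI u(3)[OF that], of n] u(2)[OF that] by simp
    have one: "(\<lambda>_. 1) \<in> C0" by (simp add: C0_def)
    show "(\<lambda>n. L False (u n)) \<longlonglongrightarrow> 0"
    proof (rule LIMSEQ_I)
      fix e :: real assume e: "0 < e"
      define e' where "e' = e / (L False (\<lambda>_. 1) + 1)"
      have L1: "0 \<le> L False (\<lambda>_. 1)" by (rule Lpos[OF one]) simp
      have e': "e' > 0" "e' * L False (\<lambda>_. 1) < e" using e L1 by (simp_all add: e'_def field_simps)
      have "\<exists>N. \<forall>n\<ge>N. \<forall>x\<in>K. u n x < e'"
      proof (rule Dini[OF K])
        show "continuous_on K (u n)" for n using u(1)[of n] by (simp add: C0_def)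
      qed (use u(2,3) e'(1) in auto)
      then obtain N where N: "\<And>n x. n \<ge> N \<Longrightarrow> x \<in> K \<Longrightarrow> u n x < e'" by auto
      have "norm (L False (u n) - 0) < e" if n: "n \<ge> N" for n
      proof -
        have d: "(\<lambda>x. e' * 1 + (-1) * u n x) \<in> C0"
          using u(1)[of n] by (auto simp: C0_def intro!: continuous_intros)
        have "0 \<le> L False (\<lambda>x. e' * 1 + (-1) * u n x)"
          by (rule Lpos[OF d]) (use N[OF n] in \<open>auto simp: less_imp_le\<close>)
        also have "\<dots> = e' * L False (\<lambda>_. 1) + (-1) * L False (u n)"
        proof -
          have c: "(\<lambda>x. e' * 1) \<in> C0" "(\<lambda>x. (-1) * u n x) \<in> C0"
            using u(1)[of n] by (auto simp: C0_def intro!: continuous_intros)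
          show ?thesis
            by (simp only: linear_functional_onD(1)[OF lin c] linear_functional_onD(2)[OF lin one]
                linear_functional_onD(2)[OF lin u(1)])
        qed
        finally have "L False (u n) < e" using e' by simp
        moreover have "0 \<le> L False (u n)" by (rule Lpos[OF u(1)]) (use u0 in auto)
        ultimately show ?thesis by simp
      qed
      then show "\<exists>no. \<forall>n\<ge>no. norm (L False (u n) - 0) < e" by blast
    qed
  qed (use Lpos in \<open>auto simp: C0_def\<close>)
  \<comment> \<open>This makes \<open>\<kappa>\<close> the midpoint of \<open>\<gamma>\<close> and
    \<open>l\<close>. The reciprocal \<open>c\<close> of \<open>s\<close> is the ratio of the
    contraction about \<open>x0\<close>, whose square will multiply the Laplacian.\<close>
  define s where "s = sqrt ((\<gamma> + l) / (2 * \<gamma>))"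
  have s2: "s\<^sup>2 = (\<gamma> + l) / (2 * \<gamma>)" unfolding s_def using \<gamma> by simp
  have s: "s > 1" unfolding s_def using \<gamma> by (simp add: field_simps)
  define \<kappa> where "\<kappa> = s\<^sup>2 * \<gamma>"
  have \<kappa>: "\<kappa> < l" using \<gamma> by (simp add: \<kappa>_def s2 field_simps)
  define c where "c = 1 / s"
  have c: "0 < c" "c < 1" "c\<^sup>2 * s\<^sup>2 = 1" using s by (simp_all add: c_def power_divide)
  obtain x0 where x0: "x0 \<in> \<Omega>" using \<Omega>(4) by auto
  define p where "p = (1 - c) *\<^sub>R x0"
  define T where "T y = p + c *\<^sub>R y" for y
  have T_cont: "continuous_on A T" for A unfolding T_def by (intro continuous_intros)
  \<comment> \<open>A point of the closure moved towards an interior point of a convex set lands in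
    the interior; this is where the geometry of \<open>\<Omega>\<close> enters.\<close>
  have TK: "T ` K \<subseteq> \<Omega>"
  proof safe
    fix y assume "y \<in> K"
    then have "y - (1 - c) *\<^sub>R (y - x0) \<in> interior \<Omega>"
      using x0 c \<Omega> by (intro mem_interior_closure_convex_shrink) (auto simp: K_def interior_open)
    moreover have "y - (1 - c) *\<^sub>R (y - x0) = T y" by (simp add: T_def p_def algebra_simps)
    ultimately show "T y \<in> \<Omega>" using interior_subset by auto
  qed
  have T_meas: "T \<in> repr \<rightarrow>\<^sub>M borel"
    using borel_measurable_continuous_on_restrict[OF T_cont[of K]] measurable_cong_sets[OF sets_repr refl] by blast
  define N where "N = distr repr borel T"
  have sub: "0 \<le> (LINT z|N. 1/2 * hess_trace G z + \<kappa> * \<phi> z)"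
    if \<phi>: "C2_fun \<phi> D G" "\<And>x. 0 \<le> \<phi> x" for \<phi> D G
  proof -
    have cont: "continuous_on UNIV \<phi>" "continuous_on UNIV (hess_trace G)"
    proof -
      show "continuous_on UNIV \<phi>"
        using \<phi>(1) unfolding C2_fun_def gderiv_def continuous_on_eq_continuous_at[OF open_UNIV]
        by (auto intro: has_derivative_continuous)
      show "continuous_on UNIV (hess_trace G)"
        unfolding hess_trace_def[abs_def] using \<phi>(1) by (auto simp: C2_fun_def intro!: continuous_intros)
    qed
    \<comment> \<open>Composing with the contraction multiplies the Laplacian by
      \<open>c\<^sup>2\<close>, and \<open>\<gamma>\<close> equals
      \<open>c\<^sup>2 * \<kappa>\<close>. The second component is therefore
      \<open>- c\<^sup>2\<close> times the expression with \<open>\<kappa>\<close>, and since the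
      first component is nonnegative, that expression has nonnegative integral.\<close>
    define y where "y = Y (\<lambda>x. \<phi> (p + c *\<^sub>R x)) (\<lambda>i x. c\<^sup>2 *\<^sub>R G i (p + c *\<^sub>R x))"
    have yR: "(y, 0) \<in> R" using RI[OF C2_fun_affine[OF \<phi>(1), of p c], of 0] by (simp add: y_def)
    have y1: "(\<lambda>x. y (True, x)) = (\<lambda>x. \<phi> (T x))" by (simp add: y_def Y_def T_def)
    have y2: "(\<lambda>x. y (False, x)) = (\<lambda>x. (- c\<^sup>2) * (1/2 * hess_trace G (T x) + \<kappa> * \<phi> (T x)))"
    proof
      fix x
      have "y (False, x) = - (1/2) * (c\<^sup>2 * hess_trace G (T x)) - \<gamma> * \<phi> (T x)"
        by (simp add: y_def Y_def T_def hess_trace_def sum_distrib_left)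
      also have "\<gamma> = c\<^sup>2 * \<kappa>" using c(3) by (simp add: \<kappa>_def)
      finally show "y (False, x) = (- c\<^sup>2) * (1/2 * hess_trace G (T x) + \<kappa> * \<phi> (T x))"
        by (simp add: algebra_simps)
    qed
    have ct: "continuous_on K (\<lambda>x. \<phi> (T x))" "continuous_on K (\<lambda>x. hess_trace G (T x))"
      by (rule continuous_on_compose2[OF cont(1) T_cont], simp)
        (rule continuous_on_compose2[OF cont(2) T_cont], simp)
    define w where "w x = 1/2 * hess_trace G (T x) + \<kappa> * \<phi> (T x)" for x
    have wC: "w \<in> C0" unfolding C0_def w_def using ct by (auto intro!: continuous_intros)
    have "L True (\<lambda>x. \<phi> (T x)) + L False (\<lambda>x. (- c\<^sup>2) * w x) = 0"
      using L_split[OF yR] E_scale[OF wC, of "- c\<^sup>2"] ct unfolding y1 y2 w_def by (auto simp: C0_def)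
    moreover have "0 \<le> L True (\<lambda>x. \<phi> (T x))"
      using ct \<phi>(2) by (intro Lpos) (auto simp: C0_def)
    moreover have "L False (\<lambda>x. (- c\<^sup>2) * w x) = (- c\<^sup>2) * L False w" by (rule scale[OF wC])
    ultimately have "0 \<le> c\<^sup>2 * L False w" by simp
    then have "0 \<le> L False w" using c by (simp add: zero_le_mult_iff)
    also have "L False w = (LINT x|repr. w x)" by (rule integral_repr(2)[OF wC, symmetric])
    also have "\<dots> = (LINT z|N. 1/2 * hess_trace G z + \<kappa> * \<phi> z)"
      unfolding N_def w_def using cont
      by (intro integral_distr[symmetric] T_meas)
        (auto intro!: borel_measurable_continuous_onI continuous_intros)
    finally show ?thesis .
  qed
  have one: "(\<lambda>_. 1) \<in> C0" by (simp add: C0_def)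
  \<comment> \<open>Two relations determine the mass: the constant 1 in both components has value 1,
    and the constant function 1 as \<open>\<phi>\<close> gives the pair \<open>1\<close>,
    \<open>- \<gamma>\<close> with value 0. Hence the mass is 1 / (1 + \<gamma>).\<close>
  have "L False (\<lambda>_. 1) > 0"
  proof -
    have 1: "L True (\<lambda>_. 1) + L False (\<lambda>_. 1) = 1" using L_split[OF Rconst[of 1]] one by simp
    have "(\<lambda>i. Y (\<lambda>_. 1) (\<lambda>_ _. 0) i, 0) \<in> R" using RI[OF C2_fun_const[of 1], of 0] by simp
    from L_split[OF this] E_scale[OF one, of "- \<gamma>"] one
    have "L True (\<lambda>_. 1) + L False (\<lambda>_. - \<gamma>) = 0" by (simp add: Y_def hess_trace_def)
    moreover have "L False (\<lambda>_. - \<gamma>) = - \<gamma> * L False (\<lambda>_. 1)" by (rule const)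
    ultimately have "(1 + \<gamma>) * L False (\<lambda>_. 1) = 1" using 1 by (simp add: algebra_simps)
    then show ?thesis using \<gamma> by (metis add_pos_pos zero_less_mult_pos zero_less_one)
  qed
  then have "measure repr K > 0" using integral_repr(2)[OF one] by simp
  moreover have "emeasure N (space N) = emeasure repr K"
    unfolding N_def by (subst emeasure_distr[OF T_meas]) auto
  ultimately have Nnz: "emeasure N (space N) \<noteq> 0" by (auto simp: measure_def)
  have "finite_measure N" unfolding N_def by (rule finite_measure.finite_measure_distr[OF finite_repr T_meas])
  moreover have cTK: "compact (T ` K)" by (rule compact_continuous_image[OF T_cont K])
  moreover have "AE z in N. z \<in> T ` K"
    unfolding N_def by (subst AE_distr_iff[OF T_meas]) (auto intro!: borel_closed compact_imp_closed[OF cTK] AE_I2)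
  moreover have "sets N = sets borel" by (simp add: N_def)
  ultimately have N: "finite_measure N" "sets N = sets borel" "compact (T ` K)" "AE z in N. z \<in> T ` K"
    by simp_all
  obtain b g where bg: "C1_compact \<Omega> b g" "0 < (LINT x|lborel. (b x)\<^sup>2)"
    "1/2 * (LINT x|lborel. (norm (g x))\<^sup>2) \<le> \<kappa> * (LINT x|lborel. (b x)\<^sup>2)"
    by (rule subsolution_measure_imp_test_function[OF N(1,2) Nnz N(3) TK N(4) \<Omega>(1) sub])
  have "l * (LINT x|lborel. (b x)\<^sup>2) \<le> \<kappa> * (LINT x|lborel. (b x)\<^sup>2)"
    using poincare_inequality[OF \<Omega>(1,2) l bg(1)] bg(3) by linarith
  then show False using bg(2) \<kappa> by simp
qed

section \<open>Weighted spaces on the cylinder\<close>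

text \<open>Two derivatives agree along every segment from \<open>x\<close> to a point of the
  closure, by convexity. Any vector \<open>h\<close> is, up to a positive factor, a difference of
  two such directions, since \<open>\<Omega>\<close> contains a ball.\<close>

lemma has_derivative_closure_unique:
  fixes f :: "'a::euclidean_space \<Rightarrow> real"
  assumes \<Omega>: "open \<Omega>" "convex \<Omega>" "\<Omega> \<noteq> {}" and x: "x \<in> closure \<Omega>"
    and A: "(f has_derivative A) (at x within closure \<Omega>)" and B: "(f has_derivative B) (at x within closure \<Omega>)"
  shows "A = B"
proof
  define C where "C h = A h - B h" for h
  have C: "((\<lambda>y. 0) has_derivative C) (at x within closure \<Omega>)"
    unfolding C_def using has_derivative_diff[OF A B] by simp
  interpret C: bounded_linear C using C by (rule has_derivative_bounded_linear)
  have vanish: "C (z - x) = 0" if z: "z \<in> closure \<Omega>" for z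
  proof -
    have path: "((\<lambda>t. x + t *\<^sub>R (z - x)) has_derivative (\<lambda>t. t *\<^sub>R (z - x))) (at 0 within {0..1})"
      by (auto intro!: derivative_eq_intros)
    have "(\<lambda>t. x + t *\<^sub>R (z - x)) ` {0..1} \<subseteq> closure \<Omega>"
    proof safe
      fix t :: real assume "t \<in> {0..1}"
      then show "x + t *\<^sub>R (z - x) \<in> closure \<Omega>"
        using convexD_alt[OF convex_closure[OF \<Omega>(2)] x z, of t] by (simp add: algebra_simps)
    qed
    from has_derivative_subset[OF C this]
    have "((\<lambda>y. 0) has_derivative C) (at (x + 0 *\<^sub>R (z - x)) within (\<lambda>t. x + t *\<^sub>R (z - x)) ` {0..1})" by simp
    from has_derivative_in_compose[OF path this]
    have "((\<lambda>t::real. 0) has_vector_derivative C (z - x)) (at 0 within cbox 0 1)"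
      by (simp add: has_vector_derivative_def C.scaleR)
    moreover have "((\<lambda>t::real. 0) has_vector_derivative 0) (at 0 within cbox 0 1)" by simp
    ultimately show ?thesis by (intro vector_derivative_unique_within_closed_interval[of 0 1 0]) auto
  qed
  fix h :: 'a
  obtain z0 where z0: "z0 \<in> \<Omega>" using \<Omega>(3) by auto
  then obtain e where e: "e > 0" "ball z0 e \<subseteq> \<Omega>" using \<Omega>(1) openE by blast
  define d where "d = e / (2 * (norm h + 1))"
  have d: "d > 0" using e by (simp add: d_def add_nonneg_pos)
  have "norm h + 1 \<noteq> 0" using norm_ge_zero[of h] by linarith
  then have "d * (norm h + 1) = e / 2" by (simp add: d_def field_simps)
  moreover have "norm (d *\<^sub>R h) \<le> d * (norm h + 1)" using d by simp
  ultimately have "norm (d *\<^sub>R h) < e" using e by linarith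
  then have "z0 + d *\<^sub>R h \<in> ball z0 e" by (simp add: dist_norm)
  then have "z0 + d *\<^sub>R h \<in> closure \<Omega>" "z0 \<in> closure \<Omega>" using e z0 closure_subset by blast+
  from this[THEN vanish] have "C (z0 + d *\<^sub>R h - x) - C (z0 - x) = 0" by simp
  then have "C (d *\<^sub>R h) = 0" by (simp flip: C.diff)
  then have "d * C h = 0" by (simp only: C.scaleR real_scaleR_def)
  then show "A h = B h" using d by (simp add: C_def)
qed

lemma dx_eq:
  assumes \<Omega>: "open \<Omega>" "convex \<Omega>" "\<Omega> \<noteq> {}" and x: "x \<in> closure \<Omega>"
    and A: "((\<lambda>y. w (t, y)) has_derivative A) (at x within closure \<Omega>)"
  shows "dx \<Omega> i w (t, x) = A i"
proof -
  have "((\<lambda>y. w (t, y)) has_derivative frechet_derivative (\<lambda>y. w (t, y)) (at x within closure \<Omega>)) (at x within closure \<Omega>)"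
    using A by (auto simp: frechet_derivative_works[symmetric] differentiable_def)
  from has_derivative_closure_unique[OF \<Omega> x this A] show ?thesis by (simp add: dx_def)
qed

lemma dt_eq:
  assumes t: "0 \<le> t" and d: "((\<lambda>s. w (s, x)) has_vector_derivative d) (at t within {0..})"
  shows "dt w (t, x) = d"
proof -
  have "t islimpt {t<..<t + 1}" by (rule islimpt_greaterThanLessThan1) simp
  then have "t islimpt {0..}" by (rule islimpt_subset) (use t in auto)
  then have "at t within {0..} \<noteq> bot" by (simp add: trivial_limit_within)
  from vector_derivative_within[OF this d] show ?thesis by (simp add: dt_def)
qed

section \<open>Calculus in the weighted spaces\<close>

lemma C_wt_iff:
  "f \<in> C_wt \<gamma> \<Omega> \<longleftrightarrow> continuous_on (cyl \<Omega>) f \<and>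
     (\<forall>e>0. \<exists>T\<ge>0. \<forall>t\<ge>T. \<forall>x\<in>closure \<Omega>. \<bar>f (t, x)\<bar> < e * exp (\<gamma> * t))"
proof -
  have eq: "dist (exp (- \<gamma> * t) * f (t, x)) 0 < e \<longleftrightarrow> \<bar>f (t, x)\<bar> < e * exp (\<gamma> * t)" for t x e
    by (simp add: abs_mult exp_minus field_simps)
  have "(\<forall>\<^sub>F t in at_top. \<forall>x\<in>closure \<Omega>. \<bar>f (t, x)\<bar> < e * exp (\<gamma> * t)) \<longleftrightarrow>
    (\<exists>T\<ge>0. \<forall>t\<ge>T. \<forall>x\<in>closure \<Omega>. \<bar>f (t, x)\<bar> < e * exp (\<gamma> * t))" for e
  proof
    assume "\<forall>\<^sub>F t in at_top. \<forall>x\<in>closure \<Omega>. \<bar>f (t, x)\<bar> < e * exp (\<gamma> * t)"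
    then obtain T where "\<forall>t\<ge>T. \<forall>x\<in>closure \<Omega>. \<bar>f (t, x)\<bar> < e * exp (\<gamma> * t)"
      unfolding eventually_at_top_linorder by auto
    then show "\<exists>T\<ge>0. \<forall>t\<ge>T. \<forall>x\<in>closure \<Omega>. \<bar>f (t, x)\<bar> < e * exp (\<gamma> * t)"
      by (intro exI[of _ "max T 0"]) auto
  next
    assume "\<exists>T\<ge>0. \<forall>t\<ge>T. \<forall>x\<in>closure \<Omega>. \<bar>f (t, x)\<bar> < e * exp (\<gamma> * t)"
    then show "\<forall>\<^sub>F t in at_top. \<forall>x\<in>closure \<Omega>. \<bar>f (t, x)\<bar> < e * exp (\<gamma> * t)"
      unfolding eventually_at_top_linorder by auto
  qed
  then show ?thesis by (simp only: C_wt_def mem_Collect_eq uniform_limit_iff eq)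
qed

lemma C_wt_solid:
  assumes f: "f \<in> C_wt \<gamma> \<Omega>" and g: "continuous_on (cyl \<Omega>) g" "\<And>p. p \<in> cyl \<Omega> \<Longrightarrow> \<bar>g p\<bar> \<le> \<bar>f p\<bar>"
  shows "g \<in> C_wt \<gamma> \<Omega>"
  unfolding C_wt_iff
proof (intro conjI allI impI g(1))
  fix e :: real assume "0 < e"
  then obtain T where T: "T \<ge> 0" "\<forall>t\<ge>T. \<forall>x\<in>closure \<Omega>. \<bar>f (t, x)\<bar> < e * exp (\<gamma> * t)"
    using f unfolding C_wt_iff by blast
  have "\<bar>g (t, x)\<bar> < e * exp (\<gamma> * t)" if "t \<ge> T" "x \<in> closure \<Omega>" for t x
    using T(2) that g(2)[of "(t, x)"] T(1) by force
  with T(1) show "\<exists>T\<ge>0. \<forall>t\<ge>T. \<forall>x\<in>closure \<Omega>. \<bar>g (t, x)\<bar> < e * exp (\<gamma> * t)" by blast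
qed

lemma C_wt_cong:
  assumes f: "f \<in> C_wt \<gamma> \<Omega>" and g: "\<And>p. p \<in> cyl \<Omega> \<Longrightarrow> g p = f p"
  shows "g \<in> C_wt \<gamma> \<Omega>"
proof (rule C_wt_solid[OF f])
  show "continuous_on (cyl \<Omega>) g"
    using f continuous_on_cong[of "cyl \<Omega>" "cyl \<Omega>" g f, OF refl g] by (simp add: C_wt_iff)
qed (simp add: g)

lemma C_wt_add:
  assumes f: "f \<in> C_wt \<gamma> \<Omega>" and g: "g \<in> C_wt \<gamma> \<Omega>"
  shows "(\<lambda>p. f p + g p) \<in> C_wt \<gamma> \<Omega>"
  unfolding C_wt_iff
proof (intro conjI allI impI)
  show "continuous_on (cyl \<Omega>) (\<lambda>p. f p + g p)"
    using f g by (auto simp: C_wt_iff intro!: continuous_intros)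
  fix e :: real assume "0 < e"
  then have e: "0 < e / 2" by simp
  obtain T where T: "T \<ge> 0" "\<forall>t\<ge>T. \<forall>x\<in>closure \<Omega>. \<bar>f (t, x)\<bar> < e / 2 * exp (\<gamma> * t)"
    using f e unfolding C_wt_iff by blast
  obtain T' where T': "T' \<ge> 0" "\<forall>t\<ge>T'. \<forall>x\<in>closure \<Omega>. \<bar>g (t, x)\<bar> < e / 2 * exp (\<gamma> * t)"
    using g e unfolding C_wt_iff by blast
  have "\<bar>f (t, x) + g (t, x)\<bar> < e * exp (\<gamma> * t)" if "t \<ge> max T T'" "x \<in> closure \<Omega>" for t x
  proof -
    have "\<bar>f (t, x)\<bar> < e / 2 * exp (\<gamma> * t)" "\<bar>g (t, x)\<bar> < e / 2 * exp (\<gamma> * t)"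
      using T(2) T'(2) that by auto
    then show ?thesis by linarith
  qed
  with T(1) show "\<exists>T\<ge>0. \<forall>t\<ge>T. \<forall>x\<in>closure \<Omega>. \<bar>f (t, x) + g (t, x)\<bar> < e * exp (\<gamma> * t)"
    by (intro exI[of _ "max T T'"]) auto
qed

lemma C_wt_scale:
  assumes f: "f \<in> C_wt \<gamma> \<Omega>"
  shows "(\<lambda>p. a * f p) \<in> C_wt \<gamma> \<Omega>"
  unfolding C_wt_iff
proof (intro conjI allI impI)
  show "continuous_on (cyl \<Omega>) (\<lambda>p. a * f p)"
    using f by (auto simp: C_wt_iff intro!: continuous_intros)
  fix e :: real assume "0 < e"
  then have e: "0 < e / (\<bar>a\<bar> + 1)" by (simp add: add_nonneg_pos)
  obtain T where T: "T \<ge> 0" "\<forall>t\<ge>T. \<forall>x\<in>closure \<Omega>. \<bar>f (t, x)\<bar> < e / (\<bar>a\<bar> + 1) * exp (\<gamma> * t)"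
    using f e unfolding C_wt_iff by blast
  have "\<bar>a * f (t, x)\<bar> < e * exp (\<gamma> * t)" if "t \<ge> T" "x \<in> closure \<Omega>" for t x
  proof -
    have "\<bar>f (t, x)\<bar> * (\<bar>a\<bar> + 1) < e / (\<bar>a\<bar> + 1) * exp (\<gamma> * t) * (\<bar>a\<bar> + 1)"
      using T(2) that by (intro mult_strict_right_mono) (auto simp: add_nonneg_pos)
    also have "\<dots> = e * exp (\<gamma> * t)" by (simp add: field_simps)
    finally show ?thesis by (simp add: abs_mult algebra_simps)
  qed
  with T(1) show "\<exists>T\<ge>0. \<forall>t\<ge>T. \<forall>x\<in>closure \<Omega>. \<bar>a * f (t, x)\<bar> < e * exp (\<gamma> * t)" by blast
qed

lemma C_wt_lincomb:
  "f \<in> C_wt \<gamma> \<Omega> \<Longrightarrow> g \<in> C_wt \<gamma> \<Omega> \<Longrightarrow> (\<lambda>p. a * f p + b * g p) \<in> C_wt \<gamma> \<Omega>"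
  by (intro C_wt_add C_wt_scale)

lemma C_wt_bounded:
  assumes \<gamma>: "\<gamma> > 0" and f: "continuous_on (cyl \<Omega>) f" "\<And>p. p \<in> cyl \<Omega> \<Longrightarrow> \<bar>f p\<bar> \<le> B"
  shows "f \<in> C_wt \<gamma> \<Omega>"
  unfolding C_wt_iff
proof (intro conjI allI impI f(1))
  fix e :: real assume e: "0 < e"
  have "LIM t at_top. e * exp (\<gamma> * t) :> at_top"
    using \<gamma> e by (intro filterlim_tendsto_pos_mult_at_top[OF tendsto_const] filterlim_compose[OF exp_at_top] filterlim_ident) auto
  then have "\<forall>\<^sub>F t in at_top. B < e * exp (\<gamma> * t)" by (simp add: filterlim_at_top_dense)
  then obtain T where T: "\<forall>t\<ge>T. B < e * exp (\<gamma> * t)" unfolding eventually_at_top_linorder by auto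
  have "\<bar>f (t, x)\<bar> < e * exp (\<gamma> * t)" if "t \<ge> max T 0" "x \<in> closure \<Omega>" for t x
    using f(2)[of "(t, x)"] T that by force
  then show "\<exists>T\<ge>0. \<forall>t\<ge>T. \<forall>x\<in>closure \<Omega>. \<bar>f (t, x)\<bar> < e * exp (\<gamma> * t)"
    by (intro exI[of _ "max T 0"]) auto
qed

text \<open>Late times are controlled by the decay with constant 1, early times by compactness of
  the closed slab and by the weight being at least 1.\<close>

lemma C_wt_le_exp:
  assumes f: "f \<in> C_wt \<gamma> \<Omega>" and \<Omega>: "bounded \<Omega>" and \<gamma>: "\<gamma> > 0"
  obtains c where "c > 0" "\<And>p. p \<in> cyl \<Omega> \<Longrightarrow> \<bar>f p\<bar> \<le> c * exp (\<gamma> * fst p)"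
proof -
  obtain T where T: "T \<ge> 0" "\<forall>t\<ge>T. \<forall>x\<in>closure \<Omega>. \<bar>f (t, x)\<bar> < 1 * exp (\<gamma> * t)"
    using f unfolding C_wt_iff by (meson zero_less_one)
  have "compact ({0..T} \<times> closure \<Omega>)" using \<Omega> by (intro compact_Times) (auto simp: compact_closure)
  moreover have "continuous_on ({0..T} \<times> closure \<Omega>) f"
    using f by (auto simp: C_wt_iff intro: continuous_on_subset)
  ultimately have "compact (f ` ({0..T} \<times> closure \<Omega>))" by (rule compact_continuous_image[rotated])
  from compact_imp_bounded[OF this] obtain B where B: "\<forall>y\<in>f ` ({0..T} \<times> closure \<Omega>). norm y \<le> B"
    by (auto simp: bounded_iff)
  show thesis
  proof (rule that[of "max 1 B"])
    fix p assume p: "p \<in> cyl \<Omega>"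
    obtain t x where tx: "p = (t, x)" "t \<ge> 0" "x \<in> closure \<Omega>" using p by auto
    show "\<bar>f p\<bar> \<le> max 1 B * exp (\<gamma> * fst p)"
    proof (cases "t \<ge> T")
      case True
      then have "\<bar>f (t, x)\<bar> \<le> 1 * exp (\<gamma> * t)" using T(2) tx by force
      also have "\<dots> \<le> max 1 B * exp (\<gamma> * t)" by (intro mult_right_mono) auto
      finally show ?thesis by (simp add: tx)
    next
      case False
      then have "(t, x) \<in> {0..T} \<times> closure \<Omega>" using tx by auto
      then have "\<bar>f (t, x)\<bar> \<le> B" using B by (metis imageI real_norm_def)
      also have "\<dots> \<le> max 1 B * 1" by simp
      also have "\<dots> \<le> max 1 B * exp (\<gamma> * t)" using \<gamma> tx by (intro mult_left_mono) auto
      finally show ?thesis by (simp add: tx)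
    qed
  qed simp
qed

lemma C_wt_product:
  assumes \<Omega>: "bounded \<Omega>" and a: "continuous_on {0..} a" "((\<lambda>t. exp (- \<gamma> * t) * a t) \<longlongrightarrow> 0) at_top"
    and \<psi>: "continuous_on (closure \<Omega>) \<psi>"
  shows "(\<lambda>p. a (fst p) * \<psi> (snd p)) \<in> C_wt \<gamma> \<Omega>"
  unfolding C_wt_iff
proof (intro conjI allI impI)
  show "continuous_on (cyl \<Omega>) (\<lambda>p. a (fst p) * \<psi> (snd p))"
    by (intro continuous_intros continuous_on_compose2[OF a(1)] continuous_on_compose2[OF \<psi>]) auto
  have "compact (\<psi> ` closure \<Omega>)" using \<psi> \<Omega> by (intro compact_continuous_image) (auto simp: compact_closure)
  from compact_imp_bounded[OF this] obtain B where B: "\<forall>y\<in>\<psi> ` closure \<Omega>. norm y \<le> B"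
    by (auto simp: bounded_iff)
  fix e :: real assume e: "0 < e"
  define e' where "e' = e / (\<bar>B\<bar> + 1)"
  have e': "e' > 0" using e by (simp add: e'_def add_nonneg_pos)
  obtain T where T: "\<forall>t\<ge>T. \<bar>exp (- \<gamma> * t) * a t\<bar> < e'"
    using tendstoD[OF a(2) e'] by (auto simp: eventually_at_top_linorder)
  have "\<bar>a t * \<psi> x\<bar> < e * exp (\<gamma> * t)" if t: "t \<ge> max T 0" "x \<in> closure \<Omega>" for t x
  proof -
    have "\<bar>exp (- \<gamma> * t) * a t\<bar> < e'" using T t by simp
    then have 1: "\<bar>a t\<bar> < e' * exp (\<gamma> * t)" by (simp add: abs_mult exp_minus field_simps)
    have 2: "\<bar>\<psi> x\<bar> < \<bar>B\<bar> + 1" using B t(2) by force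
    have "\<bar>a t * \<psi> x\<bar> < (e' * exp (\<gamma> * t)) * (\<bar>B\<bar> + 1)"
      unfolding abs_mult using 1 2 by (intro mult_strict_mono) (auto simp: e' less_imp_le)
    also have "\<dots> = e * exp (\<gamma> * t)" by (simp add: e'_def field_simps)
    finally show ?thesis .
  qed
  then show "\<exists>T\<ge>0. \<forall>t\<ge>T. \<forall>x\<in>closure \<Omega>. \<bar>a (fst (t, x)) * \<psi> (snd (t, x))\<bar> < e * exp (\<gamma> * t)"
    by (intro exI[of _ "max T 0"]) auto
qed

text \<open>The operators \<open>dt\<close> and \<open>dx\<close> are defined by choice of a
  derivative, so computations are done with explicit derivatives: \<open>wx\<close> is the spatial
  gradient and \<open>wxx i\<close> the gradient of its i-th component.
  \<open>C12_wt_imp_data\<close> and \<open>C12_dataD\<close> translate in the two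
  directions.\<close>

definition C12_data where
  "C12_data \<gamma> \<Omega> w wt wx wxx \<longleftrightarrow> w \<in> C_wt \<gamma> \<Omega> \<and> wt \<in> C_wt \<gamma> \<Omega> \<and>
     (\<forall>i\<in>Basis. \<forall>j\<in>Basis. (\<lambda>p. wxx j p \<bullet> i) \<in> C_wt \<gamma> \<Omega>) \<and>
     (\<forall>t\<ge>0. \<forall>x\<in>closure \<Omega>.
        ((\<lambda>s. w (s, x)) has_vector_derivative wt (t, x)) (at t within {0..}) \<and>
        ((\<lambda>y. w (t, y)) has_derivative (\<lambda>v. v \<bullet> wx (t, x))) (at x within closure \<Omega>) \<and>
        (\<forall>i\<in>Basis. ((\<lambda>y. wx (t, y) \<bullet> i) has_derivative (\<lambda>v. v \<bullet> wxx i (t, x))) (at x within closure \<Omega>)))"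

lemma C12_dataD:
  fixes \<Omega> :: "'a::euclidean_space set"
  assumes \<Omega>: "open \<Omega>" "convex \<Omega>" "\<Omega> \<noteq> {}" and D: "C12_data \<gamma> \<Omega> w wt wx wxx"
  shows "w \<in> C12_wt \<gamma> \<Omega>" "p \<in> cyl \<Omega> \<Longrightarrow> dt w p = wt p"
    "p \<in> cyl \<Omega> \<Longrightarrow> laplacian \<Omega> w p = (\<Sum>i\<in>Basis. wxx i p \<bullet> i)"
proof -
  have d: "((\<lambda>s. w (s, x)) has_vector_derivative wt (t, x)) (at t within {0..})"
    "((\<lambda>y. w (t, y)) has_derivative (\<lambda>v. v \<bullet> wx (t, x))) (at x within closure \<Omega>)"
    "i \<in> Basis \<Longrightarrow> ((\<lambda>y. wx (t, y) \<bullet> i) has_derivative (\<lambda>v. v \<bullet> wxx i (t, x))) (at x within closure \<Omega>)"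
    if "t \<ge> 0" "x \<in> closure \<Omega>" for t x i
    using D that unfolding C12_data_def by blast+
  have dt: "dt w (t, x) = wt (t, x)" if "t \<ge> 0" "x \<in> closure \<Omega>" for t x
    by (rule dt_eq[OF that(1) d(1)[OF that]])
  have dx1: "dx \<Omega> i w (t, x) = wx (t, x) \<bullet> i" if "t \<ge> 0" "x \<in> closure \<Omega>" for t x i
    using dx_eq[OF \<Omega> that(2) d(2)[OF that], of i] by (simp add: inner_commute)
  have ddx: "((\<lambda>y. dx \<Omega> i w (t, y)) has_derivative (\<lambda>v. v \<bullet> wxx i (t, x))) (at x within closure \<Omega>)"
    if "t \<ge> 0" "x \<in> closure \<Omega>" "i \<in> Basis" for t x i
    by (rule has_derivative_transform[OF that(2) _ d(3)[OF that]]) (simp add: dx1 that)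
  have dx2: "dx \<Omega> i (dx \<Omega> j w) (t, x) = wxx j (t, x) \<bullet> i" if "t \<ge> 0" "x \<in> closure \<Omega>" "j \<in> Basis" for t x i j
    using dx_eq[where w = "dx \<Omega> j w", OF \<Omega> that(2) ddx[OF that], of i] by (simp add: inner_commute)
  show "p \<in> cyl \<Omega> \<Longrightarrow> dt w p = wt p" using dt by (cases p) auto
  show "p \<in> cyl \<Omega> \<Longrightarrow> laplacian \<Omega> w p = (\<Sum>i\<in>Basis. wxx i p \<bullet> i)"
    unfolding laplacian_def using dx2 by (cases p) auto
  show "w \<in> C12_wt \<gamma> \<Omega>"
    unfolding C12_wt_def mem_Collect_eq
  proof (intro conjI ballI)
    show "w \<in> C_wt \<gamma> \<Omega>" using D by (simp add: C12_data_def)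
    have "wt \<in> C_wt \<gamma> \<Omega>" using D by (simp add: C12_data_def)
    then show "dt w \<in> C_wt \<gamma> \<Omega>" by (rule C_wt_cong) (use dt in auto)
    fix i j :: 'a assume ij: "i \<in> Basis" "j \<in> Basis"
    then have "(\<lambda>p. wxx j p \<bullet> i) \<in> C_wt \<gamma> \<Omega>" using D by (simp add: C12_data_def)
    then show "dx \<Omega> i (dx \<Omega> j w) \<in> C_wt \<gamma> \<Omega>" by (rule C_wt_cong) (use dx2 ij in auto)
  next
    fix t :: real and x assume t: "t \<in> {0..}" and x: "x \<in> closure \<Omega>"
    then have t0: "t \<ge> 0" by simp
    show "(\<lambda>s. w (s, x)) differentiable at t within {0..}"
      using d(1)[OF t0 x] by (auto simp: has_vector_derivative_def differentiable_def)
    show "(\<lambda>y. w (t, y)) differentiable at x within closure \<Omega>"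
      using d(2)[OF t0 x] by (auto simp: differentiable_def)
    show "(\<lambda>y. dx \<Omega> i w (t, y)) differentiable at x within closure \<Omega>" if "i \<in> Basis" for i
      using ddx[OF t0 x that] by (auto simp: differentiable_def)
  qed
qed

lemma has_derivative_inner_gradient:
  fixes f :: "'a::euclidean_space \<Rightarrow> real"
  assumes "f differentiable F"
  shows "(f has_derivative (\<lambda>v. v \<bullet> (\<Sum>i\<in>Basis. frechet_derivative f F i *\<^sub>R i))) F"
proof -
  let ?A = "frechet_derivative f F"
  have A: "(f has_derivative ?A) F" using assms by (simp add: frechet_derivative_works)
  then interpret bounded_linear ?A by (rule has_derivative_bounded_linear)
  have "?A v = v \<bullet> (\<Sum>i\<in>Basis. ?A i *\<^sub>R i)" for v
  proof -
    have "?A v = ?A (\<Sum>i\<in>Basis. (v \<bullet> i) *\<^sub>R i)" by (simp add: euclidean_representation)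
    also have "\<dots> = (\<Sum>i\<in>Basis. (v \<bullet> i) * ?A i)" by (simp add: sum scaleR)
    also have "\<dots> = v \<bullet> (\<Sum>i\<in>Basis. ?A i *\<^sub>R i)" by (simp add: inner_sum_right mult.commute)
    finally show ?thesis .
  qed
  then have "?A = (\<lambda>v. v \<bullet> (\<Sum>i\<in>Basis. ?A i *\<^sub>R i))" by (rule ext)
  with A show ?thesis by metis
qed

lemma C12_wt_imp_data:
  fixes \<Omega> :: "'a::euclidean_space set"
  assumes w: "w \<in> C12_wt \<gamma> \<Omega>"
  shows "C12_data \<gamma> \<Omega> w (dt w) (\<lambda>p. \<Sum>i\<in>Basis. dx \<Omega> i w p *\<^sub>R i)
    (\<lambda>j p. \<Sum>i\<in>Basis. dx \<Omega> i (dx \<Omega> j w) p *\<^sub>R i)"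
  unfolding C12_data_def
proof (intro conjI ballI allI impI)
  show "w \<in> C_wt \<gamma> \<Omega>" "dt w \<in> C_wt \<gamma> \<Omega>" using w by (auto simp: C12_wt_def)
  show "(\<lambda>p. (\<Sum>k\<in>Basis. dx \<Omega> k (dx \<Omega> j w) p *\<^sub>R k) \<bullet> i) \<in> C_wt \<gamma> \<Omega>" if "i \<in> Basis" "j \<in> Basis" for i j
    using w that by (simp add: C12_wt_def inner_sum_left_Basis)
  fix t :: real and x assume t: "0 \<le> t" and x: "x \<in> closure \<Omega>"
  have "(\<lambda>s. w (s, x)) differentiable at t within {0..}" using w t x by (auto simp: C12_wt_def)
  then show "((\<lambda>s. w (s, x)) has_vector_derivative dt w (t, x)) (at t within {0..})"
    by (simp add: dt_def vector_derivative_works)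
  have "(\<lambda>y. w (t, y)) differentiable at x within closure \<Omega>" using w t x by (auto simp: C12_wt_def)
  from has_derivative_inner_gradient[OF this]
  show "((\<lambda>y. w (t, y)) has_derivative (\<lambda>v. v \<bullet> (\<Sum>i\<in>Basis. dx \<Omega> i w (t, x) *\<^sub>R i))) (at x within closure \<Omega>)"
    by (simp add: dx_def)
  fix j :: 'a assume j: "j \<in> Basis"
  then have "(\<lambda>y. dx \<Omega> j w (t, y)) differentiable at x within closure \<Omega>" using w t x by (auto simp: C12_wt_def)
  from has_derivative_inner_gradient[OF this]
  show "((\<lambda>y. (\<Sum>i\<in>Basis. dx \<Omega> i w (t, y) *\<^sub>R i) \<bullet> j) has_derivative
      (\<lambda>v. v \<bullet> (\<Sum>i\<in>Basis. dx \<Omega> i (dx \<Omega> j w) (t, x) *\<^sub>R i))) (at x within closure \<Omega>)"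
    using j by (simp add: dx_def[of \<Omega> _ "dx \<Omega> j w"] inner_sum_left_Basis)
qed

lemma C12_data_lincomb:
  assumes v: "C12_data \<gamma> \<Omega> v vt vx vxx" and w: "C12_data \<gamma> \<Omega> w wt wx wxx"
  shows "C12_data \<gamma> \<Omega> (\<lambda>p. a * v p + b * w p) (\<lambda>p. a * vt p + b * wt p)
    (\<lambda>p. a *\<^sub>R vx p + b *\<^sub>R wx p) (\<lambda>j p. a *\<^sub>R vxx j p + b *\<^sub>R wxx j p)"
  unfolding C12_data_def
proof (intro conjI ballI allI impI)
  show "(\<lambda>p. a * v p + b * w p) \<in> C_wt \<gamma> \<Omega>" "(\<lambda>p. a * vt p + b * wt p) \<in> C_wt \<gamma> \<Omega>"
    using v w by (auto simp: C12_data_def intro!: C_wt_lincomb)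
  show "(\<lambda>p. (a *\<^sub>R vxx j p + b *\<^sub>R wxx j p) \<bullet> i) \<in> C_wt \<gamma> \<Omega>" if "i \<in> Basis" "j \<in> Basis" for i j
    using v w that by (auto simp: C12_data_def inner_add_left intro!: C_wt_lincomb)
  fix t :: real and x assume t: "0 \<le> t" and x: "x \<in> closure \<Omega>"
  show "((\<lambda>s. a * v (s, x) + b * w (s, x)) has_vector_derivative a * vt (t, x) + b * wt (t, x)) (at t within {0..})"
    using v w t x unfolding C12_data_def by (intro has_vector_derivative_add has_vector_derivative_mult_right) auto
  have "((\<lambda>y. v (t, y)) has_derivative (\<lambda>u. u \<bullet> vx (t, x))) (at x within closure \<Omega>)"
    "((\<lambda>y. w (t, y)) has_derivative (\<lambda>u. u \<bullet> wx (t, x))) (at x within closure \<Omega>)"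
    using v w t x unfolding C12_data_def by auto
  from has_derivative_add[OF has_derivative_mult_right[OF this(1), of a] has_derivative_mult_right[OF this(2), of b]]
  show "((\<lambda>y. a * v (t, y) + b * w (t, y)) has_derivative (\<lambda>u. u \<bullet> (a *\<^sub>R vx (t, x) + b *\<^sub>R wx (t, x)))) (at x within closure \<Omega>)"
    by (simp add: inner_add_right)
  fix i assume i: "i \<in> (Basis :: 'a set)"
  have "((\<lambda>y. vx (t, y) \<bullet> i) has_derivative (\<lambda>u. u \<bullet> vxx i (t, x))) (at x within closure \<Omega>)"
    "((\<lambda>y. wx (t, y) \<bullet> i) has_derivative (\<lambda>u. u \<bullet> wxx i (t, x))) (at x within closure \<Omega>)"
    using v w t x i unfolding C12_data_def by auto
  from has_derivative_add[OF has_derivative_mult_right[OF this(1), of a] has_derivative_mult_right[OF this(2), of b]]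
  show "((\<lambda>y. (a *\<^sub>R vx (t, y) + b *\<^sub>R wx (t, y)) \<bullet> i) has_derivative
    (\<lambda>u. u \<bullet> (a *\<^sub>R vxx i (t, x) + b *\<^sub>R wxx i (t, x)))) (at x within closure \<Omega>)"
    by (simp add: inner_add_left inner_add_right)
qed

lemma C12_wt_lincomb:
  fixes \<Omega> :: "'a::euclidean_space set"
  assumes \<Omega>: "open \<Omega>" "convex \<Omega>" "\<Omega> \<noteq> {}" and v: "v \<in> C12_wt \<gamma> \<Omega>" and w: "w \<in> C12_wt \<gamma> \<Omega>"
  shows "(\<lambda>p. a * v p + b * w p) \<in> C12_wt \<gamma> \<Omega>"
    "p \<in> cyl \<Omega> \<Longrightarrow> dt (\<lambda>p. a * v p + b * w p) p = a * dt v p + b * dt w p"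
    "p \<in> cyl \<Omega> \<Longrightarrow> laplacian \<Omega> (\<lambda>p. a * v p + b * w p) p = a * laplacian \<Omega> v p + b * laplacian \<Omega> w p"
proof -
  note D = C12_dataD[OF \<Omega> C12_data_lincomb[OF C12_wt_imp_data[OF v] C12_wt_imp_data[OF w], of a b]]
  show "(\<lambda>p. a * v p + b * w p) \<in> C12_wt \<gamma> \<Omega>" by (rule D(1))
  show "p \<in> cyl \<Omega> \<Longrightarrow> dt (\<lambda>p. a * v p + b * w p) p = a * dt v p + b * dt w p" by (rule D(2))
  show "p \<in> cyl \<Omega> \<Longrightarrow> laplacian \<Omega> (\<lambda>p. a * v p + b * w p) p = a * laplacian \<Omega> v p + b * laplacian \<Omega> w p"
    using D(3)[of p] by (simp add: inner_add_left inner_sum_left_Basis sum.distrib sum_distrib_left laplacian_def)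
qed

lemma C12_wt_product:
  fixes \<Omega> :: "'a::euclidean_space set"
  assumes \<Omega>: "open \<Omega>" "convex \<Omega>" "\<Omega> \<noteq> {}" "bounded \<Omega>" and \<phi>: "C2_fun \<phi> D G"
    and a: "\<And>t. t \<ge> 0 \<Longrightarrow> (a has_real_derivative a' t) (at t)" "continuous_on {0..} a'"
      "((\<lambda>t. exp (- \<gamma> * t) * a t) \<longlongrightarrow> 0) at_top" "((\<lambda>t. exp (- \<gamma> * t) * a' t) \<longlongrightarrow> 0) at_top"
  defines "w \<equiv> (\<lambda>p. a (fst p) * \<phi> (snd p))"
  shows "w \<in> C12_wt \<gamma> \<Omega>" "p \<in> cyl \<Omega> \<Longrightarrow> dt w p = a' (fst p) * \<phi> (snd p)"
    "p \<in> cyl \<Omega> \<Longrightarrow> laplacian \<Omega> w p = a (fst p) * hess_trace G (snd p)"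
proof -
  have a_cont: "continuous_on {0..} a"
    using a(1) by (intro continuous_at_imp_continuous_on ballI DERIV_isCont) auto
  have \<phi>D: "(\<phi> has_derivative (\<lambda>v. v \<bullet> D x)) (at x)" for x
    using \<phi> by (auto simp: C2_fun_def gderiv_def)
  have \<phi>_cont: "continuous_on UNIV \<phi>"
    using \<phi>D by (intro continuous_at_imp_continuous_on ballI has_derivative_continuous)
  have "C12_data \<gamma> \<Omega> w (\<lambda>p. a' (fst p) * \<phi> (snd p)) (\<lambda>p. a (fst p) *\<^sub>R D (snd p)) (\<lambda>i p. a (fst p) *\<^sub>R G i (snd p))"
    unfolding C12_data_def
  proof (intro conjI ballI allI impI)
    show "w \<in> C_wt \<gamma> \<Omega>" "(\<lambda>p. a' (fst p) * \<phi> (snd p)) \<in> C_wt \<gamma> \<Omega>"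
      unfolding w_def using continuous_on_subset[OF \<phi>_cont]
      by (intro C_wt_product \<Omega>(4) a(2,3,4) a_cont; simp)+
    show "(\<lambda>p. a (fst p) *\<^sub>R G j (snd p) \<bullet> i) \<in> C_wt \<gamma> \<Omega>" if "i \<in> Basis" "j \<in> Basis" for i j
    proof -
      have "continuous_on UNIV (\<lambda>x. G j x \<bullet> i)"
        using \<phi> that by (auto simp: C2_fun_def intro!: continuous_intros)
      from C_wt_product[OF \<Omega>(4) a_cont a(3) continuous_on_subset[OF this]] show ?thesis by simp
    qed
    fix t :: real and x assume t: "0 \<le> t" and x: "x \<in> closure \<Omega>"
    have "((\<lambda>s. a s * \<phi> x) has_real_derivative a' t * \<phi> x) (at t)"
      using a(1)[OF t] by (rule DERIV_cmult_right)
    then show "((\<lambda>s. w (s, x)) has_vector_derivative a' (fst (t, x)) * \<phi> (snd (t, x))) (at t within {0..})"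
      unfolding w_def fst_conv snd_conv has_real_derivative_iff_has_vector_derivative
      by (rule has_vector_derivative_at_within)
    have "((\<lambda>y. a t * \<phi> y) has_derivative (\<lambda>v. a t * (v \<bullet> D x))) (at x)"
      using \<phi>D by (rule has_derivative_mult_right)
    then have "((\<lambda>y. a t * \<phi> y) has_derivative (\<lambda>v. a t * (v \<bullet> D x))) (at x within closure \<Omega>)"
      by (rule has_derivative_at_withinI)
    then show "((\<lambda>y. w (t, y)) has_derivative (\<lambda>v. v \<bullet> a (fst (t, x)) *\<^sub>R D (snd (t, x)))) (at x within closure \<Omega>)"
      by (simp add: w_def)
    fix i assume i: "i \<in> (Basis :: 'a set)"
    have "((\<lambda>y. D y \<bullet> i) has_derivative (\<lambda>v. v \<bullet> G i x)) (at x)"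
      using \<phi> i by (auto simp: C2_fun_def gderiv_def)
    from has_derivative_at_withinI[OF has_derivative_mult_right[OF this, of "a t"], of "closure \<Omega>"]
    show "((\<lambda>y. a (fst (t, y)) *\<^sub>R D (snd (t, y)) \<bullet> i) has_derivative
      (\<lambda>v. v \<bullet> a (fst (t, x)) *\<^sub>R G i (snd (t, x)))) (at x within closure \<Omega>)"
      by simp
  qed
  note W = C12_dataD[OF \<Omega>(1-3) this]
  show "w \<in> C12_wt \<gamma> \<Omega>" by (rule W(1))
  show "p \<in> cyl \<Omega> \<Longrightarrow> dt w p = a' (fst p) * \<phi> (snd p)" by (rule W(2))
  show "p \<in> cyl \<Omega> \<Longrightarrow> laplacian \<Omega> w p = a (fst p) * hess_trace G (snd p)"
    using W(3)[of p] by (simp add: hess_trace_def sum_distrib_left)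
qed

section \<open>Majorants of arbitrarily slow decay\<close>

lemma exp_series_has_derivative:
  fixes b r :: "nat \<Rightarrow> real" and t :: real
  assumes b: "summable (\<lambda>k. \<bar>b k\<bar>)" and r: "\<And>k. 0 \<le> r k" "\<And>k. r k \<le> 1" and t: "t > -1"
  shows "summable (\<lambda>k. b k * exp (- r k * t))"
    "((\<lambda>t. \<Sum>k. b k * exp (- r k * t)) has_real_derivative (\<Sum>k. (- r k * b k) * exp (- r k * t))) (at t)"
proof -
  \<comment> \<open>Reaching back to -1 makes \<open>t = 0\<close> an interior point, so that
    derivatives there are two-sided; the exponentials stay below \<open>exp 1\<close> on this
    set.\<close>
  define S where "S = {-1<..} \<inter> (UNIV :: real set)"
  have uc: "uniformly_convergent_on S (\<lambda>n t. \<Sum>k<n. (- r k * b k) * exp (- r k * t))"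
  proof (rule Weierstrass_m_test')
    show "summable (\<lambda>k. exp 1 * \<bar>b k\<bar>)" by (rule summable_mult[OF b])
    fix k and t :: real assume "t \<in> S"
    then have t: "- t \<le> 1" by (simp add: S_def)
    have "r k * (- t) \<le> r k * 1" using r(1)[of k] t by (rule mult_left_mono[rotated])
    then have "- r k * t \<le> 1" using r(2)[of k] by simp
    then have "exp (- r k * t) \<le> exp 1" by (simp only: exp_le_cancel_iff)
    moreover have "\<bar>r k * b k\<bar> \<le> 1 * \<bar>b k\<bar>" unfolding abs_mult using r[of k] by (intro mult_right_mono) auto
    ultimately have "\<bar>r k * b k\<bar> * exp (- r k * t) \<le> (1 * \<bar>b k\<bar>) * exp 1" by (intro mult_mono) auto
    then show "norm ((- r k * b k) * exp (- r k * t)) \<le> exp 1 * \<bar>b k\<bar>" by (simp add: abs_mult mult.commute)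
  qed
  have S: "convex S" by (simp add: S_def)
  have d: "((\<lambda>t. b k * exp (- r k * t)) has_real_derivative (- r k * b k) * exp (- r k * t)) (at t within S)" for k t
    by (auto intro!: derivative_eq_intros)
  have z: "0 \<in> S" by (simp add: S_def)
  have s0: "summable (\<lambda>k. b k * exp (- r k * 0))" using summable_rabs_cancel[OF b] by simp
  have ti: "t \<in> interior S" using t by (simp add: S_def interior_open)
  show "summable (\<lambda>k. b k * exp (- r k * t))"
    "((\<lambda>t. \<Sum>k. b k * exp (- r k * t)) has_real_derivative (\<Sum>k. (- r k * b k) * exp (- r k * t))) (at t)"
    by (rule has_field_derivative_series'[OF S d uc z s0 ti])+
qed

text \<open>A function that tends to zero has a smooth nonincreasing majorant tending to zero, here a sum
  of exponentials each of which takes care of one dyadic level.\<close>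

lemma smooth_decaying_majorant:
  fixes h :: "real \<Rightarrow> 'b \<Rightarrow> real"
  assumes c: "c > 0" and bound: "\<And>t x. 0 \<le> t \<Longrightarrow> x \<in> X \<Longrightarrow> h t x \<le> c"
    and decay: "\<And>e. e > 0 \<Longrightarrow> \<exists>T\<ge>0. \<forall>t\<ge>T. \<forall>x\<in>X. h t x \<le> e"
  obtains \<theta> \<theta>' where "\<And>t. 0 \<le> t \<Longrightarrow> (\<theta> has_real_derivative \<theta>' t) (at t)" "continuous_on {0..} \<theta>'"
    "\<And>t. 0 \<le> t \<Longrightarrow> 0 \<le> \<theta> t" "\<And>t. 0 \<le> t \<Longrightarrow> \<theta>' t \<le> 0" "\<theta> 0 \<le> 4 * c"
    "\<And>t x. 0 \<le> t \<Longrightarrow> x \<in> X \<Longrightarrow> h t x \<le> \<theta> t" "(\<theta> \<longlongrightarrow> 0) at_top" "(\<theta>' \<longlongrightarrow> 0) at_top"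
proof -
  have "\<exists>T\<ge>0. \<forall>t\<ge>T. \<forall>x\<in>X. h t x \<le> c / 2^k" for k by (rule decay) (use c in simp)
  then obtain T0 where T0: "\<And>k. T0 k \<ge> 0" "\<And>k t x. t \<ge> T0 k \<Longrightarrow> x \<in> X \<Longrightarrow> h t x \<le> c / 2^k" by metis
  \<comment> \<open>Taking \<open>T k \<ge> k\<close> lets the levels exhaust the time axis and
    makes \<open>T (Suc k)\<close> at least 1, which bounds all rates \<open>r k\<close> by
    1/2.\<close>
  define T where "T k = max (T0 k) (real k)" for k
  have T: "T k \<ge> real k" "\<And>t x. t \<ge> T k \<Longrightarrow> x \<in> X \<Longrightarrow> h t x \<le> c / 2^k" for k
    using T0(2) by (auto simp: T_def)
  \<comment> \<open>Twice the level \<open>c / 2^k\<close>, because with the rate \<open>r k\<close>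
    the exponential is still at least 1/2 up to time \<open>T (Suc k)\<close>. The doubling and the
    geometric series together give the sum \<open>4 * c\<close>.\<close>
  define b where "b k = 2 * c * (1/2)^k" for k :: nat
  define r where "r k = 1 / (2 * T (Suc k))" for k
  have Tpos: "T (Suc k) \<ge> 1" for k using T(1)[of "Suc k"] by simp
  have r: "0 < r k" "r k \<le> 1/2" for k using Tpos[of k] by (simp_all add: r_def field_simps)
  have r': "0 \<le> r k" "r k \<le> 1" for k using r[of k] by auto
  have b0: "0 < b k" for k using c by (simp add: b_def)
  have b_sums: "b sums (4 * c)"
    using sums_mult[OF geometric_sums[of "1/2::real"], of "2 * c"] unfolding b_def by simp
  then have b_sum: "summable (\<lambda>k. \<bar>b k\<bar>)" using b0 by (simp add: sums_iff less_imp_le)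
  define b' where "b' k = - r k * b k" for k
  have b'_sum: "summable (\<lambda>k. \<bar>b' k\<bar>)"
  proof (rule summable_comparison_test'[OF b_sum])
    show "norm \<bar>b' k\<bar> \<le> \<bar>b k\<bar>" for k
      unfolding b'_def using r'[of k] by (simp add: abs_mult mult_left_le_one_le)
  qed
  define \<theta> where "\<theta> t = (\<Sum>k. b k * exp (- r k * t))" for t
  define \<theta>' where "\<theta>' t = (\<Sum>k. b' k * exp (- r k * t))" for t
  note sm = exp_series_has_derivative[OF b_sum r'] and sm' = exp_series_has_derivative[OF b'_sum r']
  have der: "(\<theta> has_real_derivative \<theta>' t) (at t)" if "0 \<le> t" for t
    using sm(2)[of t] that unfolding \<theta>_def \<theta>'_def b'_def by simp
  have cont: "continuous_on {0..} \<theta>'"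
    unfolding \<theta>'_def[abs_def]
    by (intro continuous_at_imp_continuous_on ballI DERIV_isCont[OF sm'(2)]) auto
  have \<theta>0: "0 \<le> \<theta> t" if "0 \<le> t" for t
    unfolding \<theta>_def using sm(1)[of t] that b0 by (intro suminf_nonneg) (auto simp: less_imp_le)
  have b'0: "b' k \<le> 0" for k unfolding b'_def using r[of k] b0[of k] by (simp add: mult_nonneg_nonneg less_imp_le)
  have \<theta>'le: "\<theta>' t \<le> 0" if "0 \<le> t" for t
  proof -
    have "0 \<le> (\<Sum>k. - (b' k * exp (- r k * t)))"
      using sm'(1)[of t] that b'0 by (intro suminf_nonneg summable_minus) (auto simp: mult_nonpos_nonneg)
    also have "\<dots> = - \<theta>' t" unfolding \<theta>'_def using sm'(1)[of t] that by (intro suminf_minus) auto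
    finally show ?thesis by simp
  qed
  \<comment> \<open>All rates are at most 1, so the derivative is squeezed between
    \<open>- \<theta>\<close> and 0 and inherits the decay of \<open>\<theta>\<close>.\<close>
  have \<theta>'ge: "- \<theta> t \<le> \<theta>' t" if "0 \<le> t" for t
  proof -
    have s1: "summable (\<lambda>k. b k * exp (- r k * t))" "summable (\<lambda>k. b' k * exp (- r k * t))"
      using sm(1)[of t] sm'(1)[of t] that by auto
    have "0 \<le> (\<Sum>k. b k * exp (- r k * t) + b' k * exp (- r k * t))"
    proof (intro suminf_nonneg summable_add s1)
      fix k
      have "0 \<le> (1 - r k) * b k" using r'[of k] b0[of k] by simp
      then have "0 \<le> b k + b' k" by (simp add: b'_def algebra_simps)
      then have "0 \<le> (b k + b' k) * exp (- r k * t)" by simp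
      then show "0 \<le> b k * exp (- r k * t) + b' k * exp (- r k * t)" by (simp add: distrib_right)
    qed
    also have "\<dots> = \<theta> t + \<theta>' t" unfolding \<theta>_def \<theta>'_def by (rule suminf_add[OF s1, symmetric])
    finally show ?thesis by simp
  qed
  have maj: "h t x \<le> \<theta> t" if t: "0 \<le> t" and x: "x \<in> X" for t x
  proof -
    have ex: "\<exists>k. t < T (Suc k)"
    proof -
      obtain k :: nat where "t < real k" using reals_Archimedean2 by blast
      then have "t < T (Suc k)" using T(1)[of "Suc k"] by simp
      then show ?thesis ..
    qed
    \<comment> \<open>For the least such \<open>k\<close> either \<open>k = 0\<close> or
      \<open>T k \<le> t\<close>; in both cases \<open>h t x\<close> is at most
      \<open>c / 2^k\<close>, and the k-th term alone dominates it.\<close>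
    define k where "k = (LEAST k. t < T (Suc k))"
    have k: "t < T (Suc k)" unfolding k_def by (rule LeastI_ex[OF ex])
    have "h t x \<le> c / 2^k"
    proof (cases k)
      case 0
      then show ?thesis using bound[OF t x] by simp
    next
      case (Suc j)
      then have "\<not> t < T (Suc j)" using not_less_Least[of j "\<lambda>k. t < T (Suc k)"] by (simp add: k_def)
      then show ?thesis using T(2)[of k t x] x Suc by simp
    qed
    also have "\<dots> = b k * (1/2)" by (simp add: b_def power_one_over)
    also have "\<dots> \<le> b k * exp (- r k * t)"
    proof (rule mult_left_mono)
      have "r k * t \<le> r k * T (Suc k)" using k r[of k] by (intro mult_left_mono) auto
      also have "\<dots> = 1/2" using Tpos[of k] by (simp add: r_def)
      finally have "1/2 \<le> 1 + (- r k * t)" by simp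
      also have "\<dots> \<le> exp (- r k * t)" by (rule exp_ge_add_one_self)
      finally show "1/2 \<le> exp (- r k * t)" .
    qed (use b0[of k] in simp)
    also have "\<dots> \<le> \<theta> t"
    proof -
      have "(\<Sum>i\<in>{k}. b i * exp (- r i * t)) \<le> \<theta> t"
        unfolding \<theta>_def using sm(1)[of t] t b0 by (intro sum_le_suminf) (auto simp: less_imp_le)
      then show ?thesis by simp
    qed
    finally show ?thesis .
  qed
  have lim: "(\<theta> \<longlongrightarrow> 0) at_top"
  proof -
    have "((\<lambda>t. \<Sum>k. b k * exp (- r k * t)) \<longlongrightarrow> (\<Sum>k. 0)) at_top"
    \<comment> \<open>The times \<open>T k\<close> may grow arbitrarily fast, so no rate is
      available; each term tends to 0 and is dominated by the summable \<open>b k\<close>.\<close>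
    proof (rule tannerys_theorem[where M = b, THEN conjunct2, THEN conjunct2])
      show "((\<lambda>t. b k * exp (- r k * t)) \<longlongrightarrow> 0) at_top" for k
      proof -
        have "filterlim (\<lambda>t. r k * t) at_top at_top"
          using r(1)[of k] by (intro filterlim_tendsto_pos_mult_at_top[OF tendsto_const] filterlim_ident)
        then have "filterlim (\<lambda>t. - (r k * t)) at_bot at_top" by (simp add: filterlim_uminus_at_bot)
        then have "((\<lambda>t. exp (- (r k * t))) \<longlongrightarrow> 0) at_top" by (rule filterlim_compose[OF exp_at_bot])
        then have "((\<lambda>t. b k * exp (- (r k * t))) \<longlongrightarrow> b k * 0) at_top" by (intro tendsto_mult tendsto_const)
        then show ?thesis by simp
      qed
      have "norm (b k * exp (- r k * t)) \<le> b k" if "t \<ge> 0" for k t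
        using r'[of k] b0[of k] that by (simp add: abs_mult mult_left_le)
      then show "\<forall>\<^sub>F (k, t) in at_top \<times>\<^sub>F at_top. norm (b k * exp (- r k * t)) \<le> b k"
        unfolding eventually_prod_filter
        by (intro exI[of _ "\<lambda>_. True"] exI[of _ "\<lambda>t. t \<ge> 0"]) (auto intro: eventually_ge_at_top)
      show "summable b" using b_sums by (simp add: sums_iff)
    qed simp
    then show ?thesis by (simp add: \<theta>_def[abs_def])
  qed
  have lim': "(\<theta>' \<longlongrightarrow> 0) at_top"
  proof (rule tendsto_sandwich)
    show "\<forall>\<^sub>F t in at_top. - \<theta> t \<le> \<theta>' t"
      using eventually_ge_at_top[of 0] by eventually_elim (rule \<theta>'ge)
    show "\<forall>\<^sub>F t in at_top. \<theta>' t \<le> 0"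
      using eventually_ge_at_top[of 0] by eventually_elim (rule \<theta>'le)
    show "((\<lambda>t. - \<theta> t) \<longlongrightarrow> 0) at_top" using tendsto_minus[OF lim] by simp
  qed simp
  have "\<theta> 0 \<le> 4 * c" using b_sums by (simp add: \<theta>_def sums_iff)
  from that[OF der cont \<theta>0 \<theta>'le this maj lim lim'] show thesis .
qed

text \<open>The profile of the weighted function is multiplied by the weight again. Monotonicity of
  \<open>\<theta>\<close> becomes \<open>a' t \<le> \<gamma> * a t\<close>, exactly what the term
  with \<open>\<gamma>\<close> in the supersolution inequality absorbs, and the bound on
  \<open>a 0\<close> makes the cost of the majorant linear in \<open>c\<close>.\<close>

lemma C_wt_majorant:
  assumes \<gamma>: "\<gamma> > 0" and c: "c > 0" and f: "f \<in> C_wt \<gamma> \<Omega>" and fc: "\<And>p. p \<in> cyl \<Omega> \<Longrightarrow> f p \<le> c * exp (\<gamma> * fst p)"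
  obtains a a' where "\<And>t. 0 \<le> t \<Longrightarrow> (a has_real_derivative a' t) (at t)" "continuous_on {0..} a'"
    "((\<lambda>t. exp (- \<gamma> * t) * a t) \<longlongrightarrow> 0) at_top" "((\<lambda>t. exp (- \<gamma> * t) * a' t) \<longlongrightarrow> 0) at_top"
    "\<And>t. 0 \<le> t \<Longrightarrow> 0 \<le> a t" "\<And>t. 0 \<le> t \<Longrightarrow> a' t \<le> \<gamma> * a t" "a 0 \<le> 4 * c"
    "\<And>p. p \<in> cyl \<Omega> \<Longrightarrow> f p \<le> a (fst p)"
proof -
  define h where "h t x = exp (- \<gamma> * t) * f (t, x)" for t x
  have exp_cancel: "exp (- \<gamma> * t) * exp (\<gamma> * t) = 1" for t by (simp flip: exp_add)
  have hf: "f (t, x) = exp (\<gamma> * t) * h t x" for t x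
  proof -
    have "exp (\<gamma> * t) * h t x = (exp (- \<gamma> * t) * exp (\<gamma> * t)) * f (t, x)"
      by (simp only: h_def mult_ac)
    then show ?thesis by (simp only: exp_cancel mult_1_left)
  qed
  have bound: "h t x \<le> c" if "0 \<le> t" "x \<in> closure \<Omega>" for t x
  proof -
    have "exp (- \<gamma> * t) * f (t, x) \<le> exp (- \<gamma> * t) * (c * exp (\<gamma> * t))"
      using fc[of "(t, x)"] that by (intro mult_left_mono) auto
    also have "\<dots> = c" by (simp only: mult.left_commute[of _ c] exp_cancel mult_1_right)
    finally show ?thesis by (simp add: h_def)
  qed
  have decay: "\<exists>T\<ge>0. \<forall>t\<ge>T. \<forall>x\<in>closure \<Omega>. h t x \<le> e" if e: "e > 0" for e
  proof -
    obtain T where T: "T \<ge> 0" "\<forall>t\<ge>T. \<forall>x\<in>closure \<Omega>. \<bar>f (t, x)\<bar> < e * exp (\<gamma> * t)"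
      using f e unfolding C_wt_iff by blast
    have "h t x \<le> e" if "t \<ge> T" "x \<in> closure \<Omega>" for t x
    proof -
      have "f (t, x) \<le> e * exp (\<gamma> * t)" using T(2) that by force
      then have "exp (- \<gamma> * t) * f (t, x) \<le> exp (- \<gamma> * t) * (e * exp (\<gamma> * t))"
        by (rule mult_left_mono) simp
      also have "\<dots> = e" by (simp only: mult.left_commute[of _ e] exp_cancel mult_1_right)
      finally show ?thesis by (simp add: h_def)
    qed
    with T(1) show ?thesis by blast
  qed
  obtain \<theta> \<theta>' where \<theta>: "\<And>t. 0 \<le> t \<Longrightarrow> (\<theta> has_real_derivative \<theta>' t) (at t)" "continuous_on {0..} \<theta>'"
    "\<And>t. 0 \<le> t \<Longrightarrow> 0 \<le> \<theta> t" "\<And>t. 0 \<le> t \<Longrightarrow> \<theta>' t \<le> 0" "\<theta> 0 \<le> 4 * c"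
    "\<And>t x. 0 \<le> t \<Longrightarrow> x \<in> closure \<Omega> \<Longrightarrow> h t x \<le> \<theta> t" "(\<theta> \<longlongrightarrow> 0) at_top" "(\<theta>' \<longlongrightarrow> 0) at_top"
    by (rule smooth_decaying_majorant[of c "closure \<Omega>" h, OF c bound decay], assumption+, rule that)
  have \<theta>_cont: "continuous_on {0..} \<theta>"
    using \<theta>(1) by (intro continuous_at_imp_continuous_on ballI DERIV_isCont) auto
  define a where "a t = exp (\<gamma> * t) * \<theta> t" for t
  define a' where "a' t = exp (\<gamma> * t) * (\<gamma> * \<theta> t + \<theta>' t)" for t
  show thesis
  proof (rule that[of a a'])
    show "(a has_real_derivative a' t) (at t)" if "0 \<le> t" for t
      unfolding a_def[abs_def] a'_def using \<theta>(1)[OF that]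
      by (auto intro!: derivative_eq_intros simp: algebra_simps)
    show "continuous_on {0..} a'"
      unfolding a'_def[abs_def] by (intro continuous_intros \<theta>(2) \<theta>_cont)
    have "exp (- \<gamma> * t) * a t = \<theta> t" "exp (- \<gamma> * t) * a' t = \<gamma> * \<theta> t + \<theta>' t" for t
      unfolding a_def a'_def mult.assoc[symmetric] exp_cancel by simp_all
    then show "((\<lambda>t. exp (- \<gamma> * t) * a t) \<longlongrightarrow> 0) at_top" "((\<lambda>t. exp (- \<gamma> * t) * a' t) \<longlongrightarrow> 0) at_top"
      using \<theta>(7) tendsto_add[OF tendsto_mult[OF tendsto_const[of \<gamma>] \<theta>(7)] \<theta>(8)] by simp_all
    show "0 \<le> a t" if "0 \<le> t" for t using \<theta>(3)[OF that] by (simp add: a_def)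
    show "a' t \<le> \<gamma> * a t" if "0 \<le> t" for t
      using \<theta>(4)[OF that] mult_left_mono[of "\<gamma> * \<theta> t + \<theta>' t" "\<gamma> * \<theta> t" "exp (\<gamma> * t)"]
      by (simp add: a_def a'_def mult_ac)
    show "a 0 \<le> 4 * c" using \<theta>(5) by (simp add: a_def)
    show "f p \<le> a (fst p)" if "p \<in> cyl \<Omega>" for p
    proof -
      have "h (fst p) (snd p) \<le> \<theta> (fst p)" using that by (intro \<theta>(6)) auto
      then show ?thesis using hf[of "fst p" "snd p"] by (simp add: a_def)
    qed
  qed
qed

section \<open>Duality\<close>

lemma M_wt_measurable:
  assumes "\<eta> \<in> M_wt_nonneg \<gamma> \<Omega>" "continuous_on (cyl \<Omega>) f"
  shows "f \<in> borel_measurable \<eta>"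
proof -
  have "sets \<eta> = sets (restrict_space borel (cyl \<Omega>))" using assms(1) by (simp add: M_wt_nonneg_def)
  from measurable_cong_sets[OF this refl] borel_measurable_continuous_on_restrict[OF assms(2)]
  show ?thesis by blast
qed

lemma M_wt_space: "\<eta> \<in> M_wt_nonneg \<gamma> \<Omega> \<Longrightarrow> space \<eta> = cyl \<Omega>"
  using sets_eq_imp_space_eq[of \<eta> "restrict_space borel (cyl \<Omega>)"]
  by (simp add: M_wt_nonneg_def space_restrict_space)

lemma M_wt_integrable:
  assumes \<eta>: "\<eta> \<in> M_wt_nonneg \<gamma> \<Omega>" and f: "f \<in> C_wt \<gamma> \<Omega>" and \<Omega>: "bounded \<Omega>" and \<gamma>: "\<gamma> > 0"
  shows "integrable \<eta> f"
proof (rule integrableI_bounded)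
  show "f \<in> borel_measurable \<eta>" using f by (intro M_wt_measurable[OF \<eta>]) (simp add: C_wt_iff)
  obtain c where c: "c > 0" "\<And>p. p \<in> cyl \<Omega> \<Longrightarrow> \<bar>f p\<bar> \<le> c * exp (\<gamma> * fst p)"
  proof (rule C_wt_le_exp[OF f \<Omega> \<gamma>])
    fix c assume "0 < c" "\<And>p. p \<in> cyl \<Omega> \<Longrightarrow> \<bar>f p\<bar> \<le> c * exp (\<gamma> * fst p)"
    then show thesis by (rule that)
  qed
  have "(\<integral>\<^sup>+p. ennreal (norm (f p)) \<partial>\<eta>) \<le> (\<integral>\<^sup>+p. ennreal c * ennreal (exp (\<gamma> * fst p)) \<partial>\<eta>)"
  proof (rule nn_integral_mono)
    fix p assume "p \<in> space \<eta>"
    then have "p \<in> cyl \<Omega>" using M_wt_space[OF \<eta>] by simp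
    from ennreal_leI[OF c(2)[OF this]] show "ennreal (norm (f p)) \<le> ennreal c * ennreal (exp (\<gamma> * fst p))"
      using c(1) by (simp add: ennreal_mult)
  qed
  also have "\<dots> = ennreal c * (\<integral>\<^sup>+p. ennreal (exp (\<gamma> * fst p)) \<partial>\<eta>)"
  proof (rule nn_integral_cmult)
    have "(\<lambda>p. exp (\<gamma> * fst p)) \<in> borel_measurable \<eta>"
      by (intro M_wt_measurable[OF \<eta>] continuous_intros)
    then show "(\<lambda>p. ennreal (exp (\<gamma> * fst p))) \<in> borel_measurable \<eta>" by measurable
  qed
  also have "\<dots> < \<infinity>" using \<eta> by (simp add: M_wt_nonneg_def ennreal_mult_less_top)
  finally show "(\<integral>\<^sup>+p. ennreal (norm (f p)) \<partial>\<eta>) < \<infinity>" .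
qed

lemma C_wt_sum:
  assumes "finite I" "\<And>i. i \<in> I \<Longrightarrow> F i \<in> C_wt \<gamma> \<Omega>" "\<gamma> > 0"
  shows "(\<lambda>p. \<Sum>i\<in>I. F i p) \<in> C_wt \<gamma> \<Omega>"
  using assms(1,2)
proof (induction I rule: finite_induct)
  case empty
  show ?case using C_wt_bounded[OF assms(3), of \<Omega> "\<lambda>_. 0" 0] by simp
next
  case (insert i I)
  then show ?case using C_wt_add[of "F i" \<gamma> \<Omega> "\<lambda>p. \<Sum>i\<in>I. F i p"] by simp
qed

lemma C12_wt_in_C_wt:
  assumes "w \<in> C12_wt \<gamma> \<Omega>" "\<gamma> > 0"
  shows "w \<in> C_wt \<gamma> \<Omega>" "dt w \<in> C_wt \<gamma> \<Omega>" "laplacian \<Omega> w \<in> C_wt \<gamma> \<Omega>"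
proof -
  show "w \<in> C_wt \<gamma> \<Omega>" "dt w \<in> C_wt \<gamma> \<Omega>" using assms(1) by (auto simp: C12_wt_def)
  show "laplacian \<Omega> w \<in> C_wt \<gamma> \<Omega>"
    unfolding laplacian_def[abs_def] by (rule C_wt_sum) (use assms in \<open>auto simp: C12_wt_def\<close>)
qed

lemma C_wt_spatial:
  assumes "\<gamma> > 0" "bounded \<Omega>" "continuous_on (closure \<Omega>) \<psi>"
  shows "(\<lambda>p. \<psi> (snd p)) \<in> C_wt \<gamma> \<Omega>"
proof -
  have "compact (\<psi> ` closure \<Omega>)" using assms by (intro compact_continuous_image) (auto simp: compact_closure)
  from compact_imp_bounded[OF this] obtain B where B: "\<forall>y\<in>\<psi> ` closure \<Omega>. norm y \<le> B" by (auto simp: bounded_iff)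
  show ?thesis
  proof (rule C_wt_bounded[OF assms(1)])
    show "continuous_on (cyl \<Omega>) (\<lambda>p. \<psi> (snd p))"
      by (intro continuous_on_compose2[OF assms(3)] continuous_intros) auto
    show "\<bar>\<psi> (snd p)\<bar> \<le> B" if "p \<in> cyl \<Omega>" for p using B that by auto
  qed
qed

lemma C_wt_initial: "f \<in> C_wt \<gamma> \<Omega> \<Longrightarrow> continuous_on (closure \<Omega>) (\<lambda>y. f (0, y))"
  unfolding C_wt_iff by (elim conjE, rule continuous_on_compose2[where g = f]) (auto intro!: continuous_intros)

lemma set_integrable_closure:
  fixes f :: "'a::euclidean_space \<Rightarrow> real"
  assumes "prob_space \<mu>" "sets \<mu> = sets borel" "bounded \<Omega>" "continuous_on (closure \<Omega>) f"
  shows "set_integrable \<mu> (closure \<Omega>) f"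
proof -
  interpret prob_space \<mu> by fact
  have "compact (f ` closure \<Omega>)" using assms by (intro compact_continuous_image) (auto simp: compact_closure)
  from compact_imp_bounded[OF this] obtain B where B: "\<forall>y\<in>f ` closure \<Omega>. norm y \<le> B" by (auto simp: bounded_iff)
  have "(\<lambda>x. indicator (closure \<Omega>) x *\<^sub>R f x) \<in> borel_measurable borel"
    by (rule borel_measurable_continuous_on_indicator) (use assms in auto)
  then have "(\<lambda>x. indicator (closure \<Omega>) x *\<^sub>R f x) \<in> borel_measurable \<mu>"
    using measurable_cong_sets[OF assms(2) refl] by blast
  then show ?thesis
    unfolding set_integrable_def
    by (intro integrable_const_bound[of _ "max B 0"]) (use B in \<open>auto simp: indicator_def le_max_iff_disj\<close>)
qed

context
  fixes \<Omega> :: "'a::euclidean_space set" and \<mu> \<nu> :: "'a measure" and L :: "real \<times> 'a \<Rightarrow> real" and l \<gamma> :: real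
  assumes \<Omega>: "open \<Omega>" "bounded \<Omega>" "convex \<Omega>" "\<Omega> \<noteq> {}"
    and l: "is_poincare_constant \<Omega> l" and \<gamma>: "0 < \<gamma>" "\<gamma> < l"
    and \<mu>: "prob_space \<mu>" "sets \<mu> = sets borel" and \<nu>: "prob_space \<nu>" "sets \<nu> = sets borel"
    and L: "L \<in> C_wt \<gamma> \<Omega>" "\<forall>p\<in>cyl \<Omega>. 0 \<le> L p"
begin

section \<open>The dual problem and its positive functional\<close>

definition dual_value :: "('a \<Rightarrow> real) \<Rightarrow> (real \<times> 'a \<Rightarrow> real) \<Rightarrow> real" where
  "dual_value \<psi> J = (LINT x:closure \<Omega>|\<nu>. \<psi> x) - (LINT y:closure \<Omega>|\<mu>. J (0, y))"

definition feasible :: "('a \<Rightarrow> real) \<Rightarrow> (real \<times> 'a \<Rightarrow> real) \<Rightarrow> bool" where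
  "feasible \<psi> J \<longleftrightarrow> continuous_on (closure \<Omega>) \<psi> \<and> J \<in> C12_wt \<gamma> \<Omega> \<and> (\<forall>p\<in>cyl \<Omega>. 0 \<le> V \<Omega> L \<psi> J p)"

text \<open>Minus the backward heat operator, signed so that the second dual constraint reads
  \<open>0 \<le> heat J p + L p\<close>.\<close>

definition heat :: "(real \<times> 'a \<Rightarrow> real) \<Rightarrow> real \<times> 'a \<Rightarrow> real" where
  "heat J p = - dt J p - 1/2 * laplacian \<Omega> J p"

lemma D1_eq: "D1 \<gamma> \<Omega> L \<mu> \<nu> = Sup {ereal (dual_value \<psi> J) |\<psi> J. feasible \<psi> J}"
  unfolding D1_def dual_value_def feasible_def by simp

lemma feasible_iff:
  "feasible \<psi> J \<longleftrightarrow> continuous_on (closure \<Omega>) \<psi> \<and> J \<in> C12_wt \<gamma> \<Omega> \<and>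
    (\<forall>p\<in>cyl \<Omega>. \<psi> (snd p) \<le> J p \<and> 0 \<le> heat J p + L p)"
  unfolding feasible_def V_def heat_def by (simp add: algebra_simps)

lemma weak_duality: "D1 \<gamma> \<Omega> L \<mu> \<nu> \<le> P1 \<gamma> \<Omega> L \<mu> \<nu>"
  unfolding D1_eq P1_def
proof (intro Sup_least Inf_greatest; clarify)
  fix \<psi> J \<eta> \<rho> assume f: "feasible \<psi> J" and a: "admissible \<gamma> \<Omega> \<mu> \<nu> \<eta> \<rho>"
  have \<eta>: "\<eta> \<in> M_wt_nonneg \<gamma> \<Omega>" and \<rho>: "\<rho> \<in> M_wt_nonneg \<gamma> \<Omega>" using a by (auto simp: admissible_def)
  have \<psi>: "continuous_on (closure \<Omega>) \<psi>" and J: "J \<in> C12_wt \<gamma> \<Omega>" using f by (auto simp: feasible_iff)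
  note JC = C12_wt_in_C_wt[OF J \<gamma>(1)]
  have 1: "(LINT x:closure \<Omega>|\<nu>. \<psi> x) = (LINT p|\<rho>. \<psi> (snd p))" using a \<psi> by (auto simp: admissible_def)
  have 2: "- (LINT y:closure \<Omega>|\<mu>. J (0, y)) =
    (LINT p|\<eta>. dt J p + (1/2) * laplacian \<Omega> J p) - (LINT p|\<rho>. J p)" using a J by (auto simp: admissible_def)
  have 3: "(LINT p|\<rho>. \<psi> (snd p)) \<le> (LINT p|\<rho>. J p)"
  proof (rule integral_mono)
    show "integrable \<rho> (\<lambda>p. \<psi> (snd p))" by (rule M_wt_integrable[OF \<rho> C_wt_spatial[OF \<gamma>(1) \<Omega>(2) \<psi>] \<Omega>(2) \<gamma>(1)])
    show "integrable \<rho> J" by (rule M_wt_integrable[OF \<rho> JC(1) \<Omega>(2) \<gamma>(1)])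
    show "\<psi> (snd p) \<le> J p" if "p \<in> space \<rho>" for p
      using f that unfolding feasible_iff M_wt_space[OF \<rho>] by blast
  qed
  have 4: "(LINT p|\<eta>. dt J p + (1/2) * laplacian \<Omega> J p) \<le> (LINT p|\<eta>. L p)"
  proof (rule integral_mono)
    show "integrable \<eta> (\<lambda>p. dt J p + (1/2) * laplacian \<Omega> J p)"
      by (rule M_wt_integrable[OF \<eta> C_wt_add[OF JC(2) C_wt_scale[OF JC(3)]] \<Omega>(2) \<gamma>(1)])
    show "integrable \<eta> L" by (rule M_wt_integrable[OF \<eta> L(1) \<Omega>(2) \<gamma>(1)])
    show "dt J p + (1/2) * laplacian \<Omega> J p \<le> L p" if "p \<in> space \<eta>" for p
    proof -
      have "0 \<le> heat J p + L p" using f that unfolding feasible_iff M_wt_space[OF \<eta>] by blast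
      then show ?thesis by (simp add: heat_def)
    qed
  qed
  show "ereal (dual_value \<psi> J) \<le> ereal (LINT p|\<eta>. L p)"
    using 1 2 3 4 unfolding dual_value_def by simp
qed

lemma dual_value_lincomb:
  assumes "continuous_on (closure \<Omega>) \<psi>" "J \<in> C12_wt \<gamma> \<Omega>" "continuous_on (closure \<Omega>) \<psi>'" "J' \<in> C12_wt \<gamma> \<Omega>"
  shows "dual_value (\<lambda>x. a * \<psi> x + b * \<psi>' x) (\<lambda>p. a * J p + b * J' p) = a * dual_value \<psi> J + b * dual_value \<psi>' J'"
proof -
  note i1 = set_integrable_closure[OF \<nu> \<Omega>(2) assms(1)] set_integrable_closure[OF \<nu> \<Omega>(2) assms(3)]
  note i2 = set_integrable_closure[OF \<mu> \<Omega>(2) C_wt_initial[OF C12_wt_in_C_wt(1)[OF assms(2) \<gamma>(1)]]]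
    set_integrable_closure[OF \<mu> \<Omega>(2) C_wt_initial[OF C12_wt_in_C_wt(1)[OF assms(4) \<gamma>(1)]]]
  have "(LINT x:closure \<Omega>|\<nu>. a * \<psi> x + b * \<psi>' x) = a * (LINT x:closure \<Omega>|\<nu>. \<psi> x) + b * (LINT x:closure \<Omega>|\<nu>. \<psi>' x)"
    using i1 by (subst set_integral_add) auto
  moreover have "(LINT y:closure \<Omega>|\<mu>. a * J (0, y) + b * J' (0, y)) =
      a * (LINT y:closure \<Omega>|\<mu>. J (0, y)) + b * (LINT y:closure \<Omega>|\<mu>. J' (0, y))"
    using i2 by (subst set_integral_add) auto
  ultimately show ?thesis unfolding dual_value_def by (simp add: algebra_simps)
qed

lemma heat_lincomb:
  assumes "J \<in> C12_wt \<gamma> \<Omega>" "J' \<in> C12_wt \<gamma> \<Omega>" "p \<in> cyl \<Omega>"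
  shows "heat (\<lambda>p. a * J p + b * J' p) p = a * heat J p + b * heat J' p"
  unfolding heat_def C12_wt_lincomb(2,3)[OF \<Omega>(1,3,4) assms] by (simp add: algebra_simps)

lemma zero_C12: "(\<lambda>_. 0) \<in> C12_wt \<gamma> \<Omega>" "p \<in> cyl \<Omega> \<Longrightarrow> heat (\<lambda>_. 0) p = 0"
proof -
  note Z = C12_wt_product[OF \<Omega>(1,3,4,2) C2_fun_const[of 0], of "\<lambda>_. 0" "\<lambda>_. 0" \<gamma>]
  show "(\<lambda>_. 0) \<in> C12_wt \<gamma> \<Omega>" using Z(1) by simp
  show "p \<in> cyl \<Omega> \<Longrightarrow> heat (\<lambda>_. 0) p = 0" using Z(2,3)[of p] by (simp add: heat_def)
qed

lemma heat_C_wt: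
  assumes J: "J \<in> C12_wt \<gamma> \<Omega>"
  shows "heat J \<in> C_wt \<gamma> \<Omega>"
proof -
  note JC = C12_wt_in_C_wt[OF J \<gamma>(1)]
  have "(\<lambda>p. (-1) * dt J p + (-1/2) * laplacian \<Omega> J p) \<in> C_wt \<gamma> \<Omega>" by (rule C_wt_lincomb[OF JC(2,3)])
  then show ?thesis by (simp add: heat_def[abs_def])
qed

lemma obstacle_C_wt:
  assumes \<psi>: "continuous_on (closure \<Omega>) \<psi>" and J: "J \<in> C12_wt \<gamma> \<Omega>"
  shows "(\<lambda>p. J p - \<psi> (snd p)) \<in> C_wt \<gamma> \<Omega>"
proof -
  have "(\<lambda>p. 1 * J p + (-1) * \<psi> (snd p)) \<in> C_wt \<gamma> \<Omega>"
    by (rule C_wt_lincomb[OF C12_wt_in_C_wt(1)[OF J \<gamma>(1)] C_wt_spatial[OF \<gamma>(1) \<Omega>(2) \<psi>]])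
  then show ?thesis by simp
qed

lemma strong_duality:
  assumes fin: "D1 \<gamma> \<Omega> L \<mu> \<nu> \<noteq> \<infinity>"
  shows "P1 \<gamma> \<Omega> L \<mu> \<nu> \<le> D1 \<gamma> \<Omega> L \<mu> \<nu>"
proof -
  \<comment> \<open>Since \<open>L\<close> is nonnegative the zero pair is feasible, so the dual
    value is not minus infinity and hence is a real number.\<close>
  have "feasible (\<lambda>_. 0) (\<lambda>_. 0)" using zero_C12 L(2) by (simp add: feasible_iff)
  then have "ereal (dual_value (\<lambda>_. 0) (\<lambda>_. 0)) \<le> D1 \<gamma> \<Omega> L \<mu> \<nu>" unfolding D1_eq by (intro Sup_upper) blast
  with fin obtain D where D: "D1 \<gamma> \<Omega> L \<mu> \<nu> = ereal D" by (cases "D1 \<gamma> \<Omega> L \<mu> \<nu>") auto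
  have D_ub: "dual_value \<psi> J \<le> D" if "feasible \<psi> J" for \<psi> J
  proof -
    have "ereal (dual_value \<psi> J) \<le> D1 \<gamma> \<Omega> L \<mu> \<nu>" unfolding D1_eq using that by (intro Sup_upper) blast
    then show ?thesis by (simp add: D)
  qed
  have D_le: "D \<le> b" if "\<And>\<psi> J. feasible \<psi> J \<Longrightarrow> dual_value \<psi> J \<le> b" for b
  proof -
    have "D1 \<gamma> \<Omega> L \<mu> \<nu> \<le> ereal b" unfolding D1_eq by (rule Sup_least) (use that in auto)
    then show ?thesis by (simp add: D)
  qed
  \<comment> \<open>A pair satisfying the homogeneous constraints may be scaled at will and remains
    feasible. A positive value would, scaled by \<open>n\<close>, reach
    \<open>\<bar>D\<bar> + 1\<close> and exceed the supremum.\<close>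
  have cone: "dual_value \<psi> J \<le> 0" if \<psi>: "continuous_on (closure \<Omega>) \<psi>" and J: "J \<in> C12_wt \<gamma> \<Omega>"
    and pos: "\<And>p. p \<in> cyl \<Omega> \<Longrightarrow> \<psi> (snd p) \<le> J p" "\<And>p. p \<in> cyl \<Omega> \<Longrightarrow> 0 \<le> heat J p" for \<psi> J
  proof (rule ccontr)
    assume "\<not> dual_value \<psi> J \<le> 0"
    then have v: "0 < dual_value \<psi> J" by simp
    define n where "n = (\<bar>D\<bar> + 1) / dual_value \<psi> J"
    have n: "0 < n" using v by (simp add: n_def)
    have "feasible (\<lambda>x. n * \<psi> x + 0 * \<psi> x) (\<lambda>p. n * J p + 0 * J p)"
      unfolding feasible_iff
    proof (intro conjI ballI)
      show "continuous_on (closure \<Omega>) (\<lambda>x. n * \<psi> x + 0 * \<psi> x)" using \<psi> by (intro continuous_intros)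
      show "(\<lambda>p. n * J p + 0 * J p) \<in> C12_wt \<gamma> \<Omega>" by (rule C12_wt_lincomb(1)[OF \<Omega>(1,3,4) J J])
      fix p assume p: "p \<in> cyl \<Omega>"
      show "n * \<psi> (snd p) + 0 * \<psi> (snd p) \<le> n * J p + 0 * J p" using pos(1)[OF p] n by simp
      show "0 \<le> heat (\<lambda>p. n * J p + 0 * J p) p + L p"
        unfolding heat_lincomb[OF J J p] using pos(2)[OF p] n L(2)[rule_format, OF p] by simp
    qed
    from D_ub[OF this] have "n * dual_value \<psi> J \<le> D" unfolding dual_value_lincomb[OF \<psi> J \<psi> J] by simp
    then show False using v by (simp add: n_def)
  qed
  \<comment> \<open>Membership fixes \<open>y\<close> on the cylinder only, in keeping with
    functions whose outside values are irrelevant; the variable \<open>s\<close> records the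
    multiple of \<open>L\<close>.\<close>
  define R where "R = {(y, c). \<exists>\<psi> J s. continuous_on (closure \<Omega>) \<psi> \<and> J \<in> C12_wt \<gamma> \<Omega> \<and>
    (\<forall>p\<in>cyl \<Omega>. y (True, p) = J p - \<psi> (snd p) \<and> y (False, p) = heat J p + s * L p) \<and>
    c = s * D - dual_value \<psi> J}"
  have RI: "(y, s * D - dual_value \<psi> J) \<in> R" if "continuous_on (closure \<Omega>) \<psi>" "J \<in> C12_wt \<gamma> \<Omega>"
    "\<And>p. p \<in> cyl \<Omega> \<Longrightarrow> y (True, p) = J p - \<psi> (snd p)" "\<And>p. p \<in> cyl \<Omega> \<Longrightarrow> y (False, p) = heat J p + s * L p"
    for y \<psi> J s using that unfolding R_def by blast
  have RE: thesis if "(y, c) \<in> R" "\<And>\<psi> J s. continuous_on (closure \<Omega>) \<psi> \<Longrightarrow> J \<in> C12_wt \<gamma> \<Omega> \<Longrightarrow>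
    (\<And>p. p \<in> cyl \<Omega> \<Longrightarrow> y (True, p) = J p - \<psi> (snd p)) \<Longrightarrow>
    (\<And>p. p \<in> cyl \<Omega> \<Longrightarrow> y (False, p) = heat J p + s * L p) \<Longrightarrow> c = s * D - dual_value \<psi> J \<Longrightarrow> thesis" for y c thesis
    using that unfolding R_def by blast
  have Rlin: "(\<lambda>i. a * x i + b * y i, a * c + b * d) \<in> R" if x: "(x, c) \<in> R" and y: "(y, d) \<in> R" for x c y d a b
  proof (rule RE[OF x], rule RE[OF y])
    fix \<psi> J s \<psi>' J' s'
    assume *: "continuous_on (closure \<Omega>) \<psi>" "J \<in> C12_wt \<gamma> \<Omega>"
      "\<And>p. p \<in> cyl \<Omega> \<Longrightarrow> x (True, p) = J p - \<psi> (snd p)" "\<And>p. p \<in> cyl \<Omega> \<Longrightarrow> x (False, p) = heat J p + s * L p"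
      "c = s * D - dual_value \<psi> J"
      and **: "continuous_on (closure \<Omega>) \<psi>'" "J' \<in> C12_wt \<gamma> \<Omega>"
      "\<And>p. p \<in> cyl \<Omega> \<Longrightarrow> y (True, p) = J' p - \<psi>' (snd p)" "\<And>p. p \<in> cyl \<Omega> \<Longrightarrow> y (False, p) = heat J' p + s' * L p"
      "d = s' * D - dual_value \<psi>' J'"
    have "(\<lambda>i. a * x i + b * y i, (a * s + b * s') * D - dual_value (\<lambda>x. a * \<psi> x + b * \<psi>' x) (\<lambda>p. a * J p + b * J' p)) \<in> R"
    proof (rule RI)
      show "continuous_on (closure \<Omega>) (\<lambda>x. a * \<psi> x + b * \<psi>' x)" using *(1) **(1) by (intro continuous_intros)
      show "(\<lambda>p. a * J p + b * J' p) \<in> C12_wt \<gamma> \<Omega>" by (rule C12_wt_lincomb(1)[OF \<Omega>(1,3,4) *(2) **(2)])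
      fix p assume p: "p \<in> cyl \<Omega>"
      show "a * x (True, p) + b * y (True, p) = a * J p + b * J' p - (a * \<psi> (snd p) + b * \<psi>' (snd p))"
        unfolding *(3)[OF p] **(3)[OF p] by (simp add: algebra_simps)
      show "a * x (False, p) + b * y (False, p) = heat (\<lambda>p. a * J p + b * J' p) p + (a * s + b * s') * L p"
        unfolding *(4)[OF p] **(4)[OF p] heat_lincomb[OF *(2) **(2) p] by (simp add: algebra_simps)
    qed
    then show ?thesis unfolding *(5) **(5) dual_value_lincomb[OF *(1,2) **(1,2)] by (simp add: algebra_simps)
  qed
  have Radd: "(\<lambda>i. x i + y i, c + d) \<in> R" if "(x, c) \<in> R" "(y, d) \<in> R" for x c y d
    using Rlin[OF that, of 1 1] by simp
  have Rscale: "(\<lambda>i. a * x i, a * c) \<in> R" if "(x, c) \<in> R" for x c a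
    using Rlin[OF that that, of a 0] by simp
  define S where "S = (UNIV :: bool set) \<times> cyl \<Omega>"
  \<comment> \<open>The sign of \<open>s\<close> decides: for \<open>s = 0\<close> the pair is a
    homogeneous direction, for \<open>s > 0\<close> division by \<open>s\<close> makes it feasible,
    and for \<open>s < 0\<close> it is compared with all feasible pairs.\<close>
  have Rpos: "0 \<le> c" if yc: "(y, c) \<in> R" and y0: "\<forall>i\<in>S. 0 \<le> y i" for y c
  proof (rule RE[OF yc])
    fix \<psi> J s
    assume *: "continuous_on (closure \<Omega>) \<psi>" "J \<in> C12_wt \<gamma> \<Omega>"
      "\<And>p. p \<in> cyl \<Omega> \<Longrightarrow> y (True, p) = J p - \<psi> (snd p)" "\<And>p. p \<in> cyl \<Omega> \<Longrightarrow> y (False, p) = heat J p + s * L p"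
      "c = s * D - dual_value \<psi> J"
    have y1: "\<psi> (snd p) \<le> J p" and y2: "0 \<le> heat J p + s * L p" if p: "p \<in> cyl \<Omega>" for p
    proof -
      have "(True, p) \<in> S" "(False, p) \<in> S" using p by (auto simp: S_def)
      then have "0 \<le> y (True, p)" "0 \<le> y (False, p)" using y0 by blast+
      then show "\<psi> (snd p) \<le> J p" "0 \<le> heat J p + s * L p" unfolding *(3)[OF p] *(4)[OF p] by simp_all
    qed
    consider "s = 0" | "s > 0" | "s < 0" by linarith
    then show "0 \<le> c"
    proof cases
      case 1
      then show ?thesis using cone[OF *(1,2) y1] y2 *(5) by simp
    next
      case 2
      have "feasible (\<lambda>x. 1/s * \<psi> x + 0 * \<psi> x) (\<lambda>p. 1/s * J p + 0 * J p)"
        unfolding feasible_iff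
      proof (intro conjI ballI)
        show "continuous_on (closure \<Omega>) (\<lambda>x. 1/s * \<psi> x + 0 * \<psi> x)" using *(1) by (intro continuous_intros)
        show "(\<lambda>p. 1/s * J p + 0 * J p) \<in> C12_wt \<gamma> \<Omega>" by (rule C12_wt_lincomb(1)[OF \<Omega>(1,3,4) *(2) *(2)])
        fix p assume p: "p \<in> cyl \<Omega>"
        show "1/s * \<psi> (snd p) + 0 * \<psi> (snd p) \<le> 1/s * J p + 0 * J p"
          using y1[OF p] 2 by (simp add: divide_right_mono)
        have "0 \<le> 1/s * (heat J p + s * L p)" using y2[OF p] 2 by simp
        then show "0 \<le> heat (\<lambda>p. 1/s * J p + 0 * J p) p + L p"
          unfolding heat_lincomb[OF *(2) *(2) p] using 2 by (simp add: field_simps)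
      qed
      from D_ub[OF this] have "1/s * dual_value \<psi> J \<le> D" unfolding dual_value_lincomb[OF *(1,2) *(1,2)] by simp
      then show ?thesis using 2 *(5) by (simp add: field_simps)
    next
      case 3
      \<comment> \<open>Adding \<open>- s\<close> times any feasible pair cancels the multiple of
        \<open>L\<close> and leaves a homogeneous direction, whose value is at most 0.\<close>
      have "D \<le> dual_value \<psi> J / s"
      proof (rule D_le)
        fix \<psi>' J' assume f: "feasible \<psi>' J'"
        then have f1: "continuous_on (closure \<Omega>) \<psi>'" "J' \<in> C12_wt \<gamma> \<Omega>" by (auto simp: feasible_iff)
        have "dual_value (\<lambda>x. 1 * \<psi> x + (- s) * \<psi>' x) (\<lambda>p. 1 * J p + (- s) * J' p) \<le> 0"
        proof (rule cone)
          show "continuous_on (closure \<Omega>) (\<lambda>x. 1 * \<psi> x + (- s) * \<psi>' x)" using *(1) f1(1) by (intro continuous_intros)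
          show "(\<lambda>p. 1 * J p + (- s) * J' p) \<in> C12_wt \<gamma> \<Omega>" by (rule C12_wt_lincomb(1)[OF \<Omega>(1,3,4) *(2) f1(2)])
          fix p assume p: "p \<in> cyl \<Omega>"
          have fp: "\<psi>' (snd p) \<le> J' p" "0 \<le> heat J' p + L p" using f p by (auto simp: feasible_iff)
          have "(- s) * \<psi>' (snd p) \<le> (- s) * J' p" using 3 by (intro mult_left_mono fp) simp
          then show "1 * \<psi> (snd p) + (- s) * \<psi>' (snd p) \<le> 1 * J p + (- s) * J' p" using y1[OF p] by simp
          have "0 \<le> (- s) * (heat J' p + L p)" using 3 fp by (intro mult_nonneg_nonneg) auto
          then show "0 \<le> heat (\<lambda>p. 1 * J p + (- s) * J' p) p"
            unfolding heat_lincomb[OF *(2) f1(2) p] using y2[OF p] by (simp add: algebra_simps)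
        qed
        then have "dual_value \<psi> J \<le> s * dual_value \<psi>' J'" unfolding dual_value_lincomb[OF *(1,2) f1] by simp
        then show "dual_value \<psi>' J' \<le> dual_value \<psi> J / s" using 3 by (simp add: field_simps)
      qed
      then show ?thesis using 3 *(5) by (simp add: field_simps)
    qed
  qed
  obtain \<phi> G\<phi> H\<phi> where \<phi>: "C2_fun \<phi> G\<phi> H\<phi>" "\<And>x. x \<in> closure \<Omega> \<Longrightarrow> 1 \<le> \<phi> x"
    "\<And>x. x \<in> closure \<Omega> \<Longrightarrow> 1 \<le> - (1/2) * hess_trace H\<phi> x - \<gamma> * \<phi> x"
  proof (rule strict_supersolution_exists[OF \<Omega> l \<gamma>])
    fix \<phi> D G assume "C2_fun \<phi> D G" "\<And>x. x \<in> closure \<Omega> \<Longrightarrow> 1 \<le> \<phi> x"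
      "\<And>x. x \<in> closure \<Omega> \<Longrightarrow> 1 \<le> - (1/2) * hess_trace G x - \<gamma> * \<phi> x"
    then show thesis by (rule that)
  qed
  \<comment> \<open>The factor 4 is the one in \<open>a 0 \<le> 4 * c\<close>, and only the initial
    values of the majorant enter its cost.\<close>
  define C where "C = 4 * (LINT y:closure \<Omega>|\<mu>. \<phi> y)"
  have C0: "0 \<le> C"
  proof -
    have "0 \<le> \<phi> x" if "x \<in> closure \<Omega>" for x using \<phi>(2)[OF that] by simp
    then show ?thesis unfolding C_def set_lebesgue_integral_def
      by (intro mult_nonneg_nonneg integral_nonneg_AE) (auto simp: indicator_def)
  qed
  \<comment> \<open>The majorant is a graph element with \<open>\<psi> = 0\<close> and
    \<open>s = 0\<close>. It has to dominate in both components simultaneously and be nonnegative in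
    both, so that a function placed in one of them, with 0 in the other, is majorized.\<close>
  have maj: "\<exists>y d. (y, d) \<in> R \<and> d \<le> C * c \<and> (\<forall>b. \<forall>p\<in>cyl \<Omega>. f p \<le> y (b, p) \<and> 0 \<le> y (b, p))"
    if f: "f \<in> C_wt \<gamma> \<Omega>" and c: "c > 0" and fc: "\<And>p. p \<in> cyl \<Omega> \<Longrightarrow> f p \<le> c * exp (\<gamma> * fst p)" for f c
  proof (rule C_wt_majorant[OF \<gamma>(1) c f fc])
    fix a a' assume a: "\<And>t. 0 \<le> t \<Longrightarrow> (a has_real_derivative a' t) (at t)" "continuous_on {0..} a'"
      "((\<lambda>t. exp (- \<gamma> * t) * a t) \<longlongrightarrow> 0) at_top" "((\<lambda>t. exp (- \<gamma> * t) * a' t) \<longlongrightarrow> 0) at_top"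
      "\<And>t. 0 \<le> t \<Longrightarrow> 0 \<le> a t" "\<And>t. 0 \<le> t \<Longrightarrow> a' t \<le> \<gamma> * a t" "a 0 \<le> 4 * c"
      "\<And>p. p \<in> cyl \<Omega> \<Longrightarrow> f p \<le> a (fst p)"
    define J where "J p = a (fst p) * \<phi> (snd p)" for p
    note W = C12_wt_product[OF \<Omega>(1,3,4,2) \<phi>(1) a(1-4), folded J_def[abs_def]]
    define y where "y = (\<lambda>(b, p). if b then J p else heat J p)"
    have yR: "(y, 0 * D - dual_value (\<lambda>_. 0) J) \<in> R"
      by (rule RI) (auto simp: y_def W(1) intro: continuous_intros)
    have d: "0 * D - dual_value (\<lambda>_. 0) J = a 0 * (LINT y:closure \<Omega>|\<mu>. \<phi> y)"
      by (simp add: dual_value_def J_def set_lebesgue_integral_def)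
    have dC: "a 0 * (LINT y:closure \<Omega>|\<mu>. \<phi> y) \<le> C * c"
    proof -
      have "a 0 * (LINT y:closure \<Omega>|\<mu>. \<phi> y) \<le> (4 * c) * (LINT y:closure \<Omega>|\<mu>. \<phi> y)"
        using a(7) C0 by (intro mult_right_mono) (auto simp: C_def)
      then show ?thesis by (simp add: C_def mult_ac)
    qed
    have ay: "a (fst p) \<le> y (b, p)" "0 \<le> a (fst p)" if p: "p \<in> cyl \<Omega>" for b p
    proof -
      have t: "0 \<le> fst p" and x: "snd p \<in> closure \<Omega>" using p by auto
      note a0 = a(5)[OF t] and x1 = \<phi>(2)[OF x] and x2 = \<phi>(3)[OF x]
      show "0 \<le> a (fst p)" by (rule a0)
      have J: "a (fst p) \<le> J p" unfolding J_def using mult_left_mono[OF x1 a0] by simp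
      \<comment> \<open>The growth bound on \<open>a\<close> and the strict inequality for
        \<open>\<phi>\<close> combine to \<open>heat J \<ge> a\<close>: the two terms with
        \<open>\<gamma>\<close> cancel and the margin 1 remains.\<close>
      have "a' (fst p) * \<phi> (snd p) \<le> (\<gamma> * a (fst p)) * \<phi> (snd p)"
        using a(6)[OF t] x1 by (intro mult_right_mono) auto
      moreover have "a (fst p) * 1 \<le> a (fst p) * (- (1/2) * hess_trace H\<phi> (snd p) - \<gamma> * \<phi> (snd p))"
        by (rule mult_left_mono[OF x2 a0])
      moreover have "dt J p = a' (fst p) * \<phi> (snd p)" "laplacian \<Omega> J p = a (fst p) * hess_trace H\<phi> (snd p)"
        using W(2,3)[of p] p by blast+
      ultimately have "a (fst p) \<le> heat J p" by (simp add: heat_def algebra_simps)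
      with J show "a (fst p) \<le> y (b, p)" by (simp add: y_def)
    qed
    show ?thesis
    proof (intro exI[of _ y] exI[of _ "0 * D - dual_value (\<lambda>_. 0) J"] conjI yR allI ballI)
      show "0 * D - dual_value (\<lambda>_. 0) J \<le> C * c" unfolding d by (rule dC)
      fix b p assume p: "p \<in> cyl \<Omega>"
      show "f p \<le> y (b, p)" by (rule order_trans[OF a(8)[OF p] ay(1)[OF p]])
      show "0 \<le> y (b, p)" by (rule order_trans[OF ay(2)[OF p] ay(1)[OF p]])
    qed
  qed
  define E where "E = {x. \<exists>(y, c)\<in>R. \<forall>i\<in>S. \<bar>x i\<bar> \<le> y i}"
  have E_space: "linear_fun_space E"
    unfolding E_def by (rule linear_fun_space_majorized[OF Radd Rscale])
  have R_ne: "R \<noteq> {}"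
    using RI[of "\<lambda>_. 0" "\<lambda>_. 0" "\<lambda>(b, p). if b then 0 else heat (\<lambda>_. 0) p" 0] zero_C12 by auto
  obtain \<Lambda> where \<Lambda>: "linear_functional_on E \<Lambda>"
    "\<And>x. x \<in> E \<Longrightarrow> \<forall>i\<in>S. 0 \<le> x i \<Longrightarrow> 0 \<le> \<Lambda> x"
    "\<And>x c. (x, c) \<in> R \<Longrightarrow> x \<in> E \<Longrightarrow> \<Lambda> x = c"
  proof (rule positive_extension[of R S, folded E_def, OF R_ne Radd Rscale Rpos])
    fix \<Lambda> assume "linear_functional_on E \<Lambda>"
      "\<And>x. x \<in> E \<Longrightarrow> \<forall>i\<in>S. 0 \<le> x i \<Longrightarrow> 0 \<le> \<Lambda> x" "\<And>x c. (x, c) \<in> R \<Longrightarrow> x \<in> E \<Longrightarrow> \<Lambda> x = c"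
    then show thesis by (rule that)
  qed
  define emb :: "bool \<Rightarrow> (real \<times> 'a \<Rightarrow> real) \<Rightarrow> bool \<times> (real \<times> 'a) \<Rightarrow> real"
    where "emb b f = (\<lambda>(b', p). if b' = b then f p else 0)" for b f
  have embE: "emb b f \<in> E" if f: "f \<in> C_wt \<gamma> \<Omega>" for b f
  proof -
    have af: "(\<lambda>p. \<bar>f p\<bar>) \<in> C_wt \<gamma> \<Omega>"
      by (rule C_wt_solid[OF f]) (use f in \<open>auto simp: C_wt_iff intro!: continuous_intros\<close>)
    obtain c where c: "c > 0" "\<And>p. p \<in> cyl \<Omega> \<Longrightarrow> \<bar>f p\<bar> \<le> c * exp (\<gamma> * fst p)"
    proof (rule C_wt_le_exp[OF f \<Omega>(2) \<gamma>(1)])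
      fix c assume "0 < c" "\<And>p. p \<in> cyl \<Omega> \<Longrightarrow> \<bar>f p\<bar> \<le> c * exp (\<gamma> * fst p)"
      then show thesis by (rule that)
    qed
    from maj[OF af c] obtain y d where "(y, d) \<in> R" "\<forall>b. \<forall>p\<in>cyl \<Omega>. \<bar>f p\<bar> \<le> y (b, p) \<and> 0 \<le> y (b, p)" by blast
    then show ?thesis unfolding E_def by (auto simp: emb_def S_def intro!: bexI[of _ "(y, d)"])
  qed
  have emb_add: "emb b (\<lambda>x. f x + g x) = (\<lambda>i. emb b f i + emb b g i)" for b f g
    by (auto simp: emb_def fun_eq_iff)
  have emb_scale: "emb b (\<lambda>x. a * f x) = (\<lambda>i. a * emb b f i)" for b f a
    by (auto simp: emb_def fun_eq_iff)
  define F where "F b f = \<Lambda> (emb b f)" for b f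
  have Flin: "linear_functional_on (C_wt \<gamma> \<Omega>) (F b)" for b
    unfolding linear_functional_on_def F_def emb_add emb_scale
    using linear_functional_onD[OF \<Lambda>(1)] embE by blast
  have Fpos: "0 \<le> F b f" if "f \<in> C_wt \<gamma> \<Omega>" "\<forall>p\<in>cyl \<Omega>. 0 \<le> f p" for b f
    unfolding F_def using that by (intro \<Lambda>(2) embE) (auto simp: emb_def S_def)
  \<comment> \<open>This estimate depends on \<open>f\<close> only through \<open>c\<close>,
    although the majorant itself does not; it controls the functional in the weighted supremum
    norm.\<close>
  have Fbound: "F b f \<le> C * c"
    if f: "f \<in> C_wt \<gamma> \<Omega>" and c: "c > 0" and fc: "\<And>p. p \<in> cyl \<Omega> \<Longrightarrow> f p \<le> c * exp (\<gamma> * fst p)" for b f c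
  proof -
    from maj[OF f c fc] obtain y d where y: "(y, d) \<in> R" "d \<le> C * c"
      "\<forall>b. \<forall>p\<in>cyl \<Omega>. f p \<le> y (b, p) \<and> 0 \<le> y (b, p)" by blast
    have yE: "y \<in> E" unfolding E_def using y(1,3) by (auto simp: S_def intro!: bexI[of _ "(y, d)"])
    have m: "(\<lambda>i. -1 * emb b f i) \<in> E" by (rule linear_fun_spaceD(2)[OF E_space embE[OF f]])
    have "0 \<le> \<Lambda> (\<lambda>i. y i + -1 * emb b f i)"
      by (rule \<Lambda>(2)[OF linear_fun_spaceD(1)[OF E_space yE m]]) (use y(3) in \<open>auto simp: emb_def S_def\<close>)
    also have "\<dots> = \<Lambda> y + -1 * F b f"
      unfolding F_def by (simp only: linear_functional_onD(1)[OF \<Lambda>(1) yE m] linear_functional_onD(2)[OF \<Lambda>(1) embE[OF f]])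
    finally show ?thesis using \<Lambda>(3)[OF y(1) yE] y(2) by simp
  qed
  have key: "F True (\<lambda>p. J p - \<psi> (snd p)) + F False (\<lambda>p. heat J p + s * L p) = s * D - dual_value \<psi> J"
    if \<psi>: "continuous_on (closure \<Omega>) \<psi>" and J: "J \<in> C12_wt \<gamma> \<Omega>" for \<psi> J s
  proof -
    have 1: "(\<lambda>p. J p - \<psi> (snd p)) \<in> C_wt \<gamma> \<Omega>" by (rule obstacle_C_wt[OF \<psi> J])
    have 2: "(\<lambda>p. heat J p + s * L p) \<in> C_wt \<gamma> \<Omega>" by (intro C_wt_add heat_C_wt J C_wt_scale L(1))
    let ?y = "\<lambda>i. emb True (\<lambda>p. J p - \<psi> (snd p)) i + emb False (\<lambda>p. heat J p + s * L p) i"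
    have yR: "(?y, s * D - dual_value \<psi> J) \<in> R" by (rule RI[OF \<psi> J]) (auto simp: emb_def)
    have yE: "?y \<in> E" by (rule linear_fun_spaceD(1)[OF E_space embE[OF 1] embE[OF 2]])
    have "\<Lambda> ?y = F True (\<lambda>p. J p - \<psi> (snd p)) + F False (\<lambda>p. heat J p + s * L p)"
      unfolding F_def by (rule linear_functional_onD(1)[OF \<Lambda>(1) embE[OF 1] embE[OF 2]])
    then show ?thesis using \<Lambda>(3)[OF yR yE] by simp
  qed
  have dan: "daniell (cyl \<Omega>) (C_wt \<gamma> \<Omega>) (F b)" for b
  proof
    show "linear_fun_space (C_wt \<gamma> \<Omega>)" unfolding linear_fun_space_def by (auto intro: C_wt_add C_wt_scale)
    show "(\<lambda>_. 1) \<in> C_wt \<gamma> \<Omega>" by (rule C_wt_bounded[OF \<gamma>(1), of _ _ 1]) auto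
    show "linear_functional_on (C_wt \<gamma> \<Omega>) (F b)" by (rule Flin)
    show "continuous_on (cyl \<Omega>) f" if "f \<in> C_wt \<gamma> \<Omega>" for f using that by (simp add: C_wt_iff)
    show "g \<in> C_wt \<gamma> \<Omega>" if "f \<in> C_wt \<gamma> \<Omega>" "continuous_on (cyl \<Omega>) g" "\<forall>x\<in>cyl \<Omega>. \<bar>g x\<bar> \<le> \<bar>f x\<bar>" for f g
      by (rule C_wt_solid[OF that(1,2)]) (use that(3) in blast)
    show "0 \<le> F b f" if "f \<in> C_wt \<gamma> \<Omega>" "\<forall>x\<in>cyl \<Omega>. 0 \<le> f x" for f by (rule Fpos[OF that])
    fix u :: "nat \<Rightarrow> real \<times> 'a \<Rightarrow> real"
    assume u: "\<And>n. u n \<in> C_wt \<gamma> \<Omega>" "\<And>n x. x \<in> cyl \<Omega> \<Longrightarrow> u (Suc n) x \<le> u n x"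
      "\<And>x. x \<in> cyl \<Omega> \<Longrightarrow> (\<lambda>n. u n x) \<longlonglongrightarrow> 0"
    have dec: "decseq (\<lambda>n. u n p)" if "p \<in> cyl \<Omega>" for p by (rule decseq_SucI) (rule u(2)[OF that])
    have u0: "0 \<le> u n p" if "p \<in> cyl \<Omega>" for n p by (rule decseq_ge[OF dec[OF that] u(3)[OF that]])
    show "(\<lambda>n. F b (u n)) \<longlonglongrightarrow> 0"
    proof (rule LIMSEQ_I)
      fix e :: real assume e: "0 < e"
      define e' where "e' = e / (C + 1)"
      have e': "e' > 0" "C * e' < e" using e C0 by (simp_all add: e'_def field_simps)
      obtain T where T: "T \<ge> 0" "\<forall>t\<ge>T. \<forall>x\<in>closure \<Omega>. \<bar>u 0 (t, x)\<bar> < e' * exp (\<gamma> * t)"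
        using u(1)[of 0] e'(1) unfolding C_wt_iff by blast
      \<comment> \<open>Dini's theorem handles the times up to \<open>T\<close>. Afterwards
        \<open>u n\<close> stays below \<open>u 0\<close>, which is already small compared with the
        weight, so both ranges give \<open>u n \<le> e'\<close> times the weight.\<close>
      have "\<exists>N. \<forall>n\<ge>N. \<forall>p\<in>{0..T} \<times> closure \<Omega>. u n p < e'"
      proof (rule Dini)
        show "compact ({0..T} \<times> closure \<Omega>)" using \<Omega>(2) by (intro compact_Times) (auto simp: compact_closure)
        show "continuous_on ({0..T} \<times> closure \<Omega>) (u n)" for n
          by (rule continuous_on_subset[of "cyl \<Omega>"]) (use u(1)[of n] in \<open>auto simp: C_wt_iff\<close>)
      qed (use u(2,3) e'(1) in auto)
      then obtain N where N: "\<And>n p. n \<ge> N \<Longrightarrow> p \<in> {0..T} \<times> closure \<Omega> \<Longrightarrow> u n p < e'" by blast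
      have "norm (F b (u n) - 0) < e" if n: "n \<ge> N" for n
      proof -
        have "u n p \<le> e' * exp (\<gamma> * fst p)" if p: "p \<in> cyl \<Omega>" for p
        proof (cases "fst p \<ge> T")
          case True
          have "u n p \<le> u 0 p" using decseqD[OF dec[OF p], of 0 n] by simp
          also have "\<dots> \<le> e' * exp (\<gamma> * fst p)"
            using T(2)[rule_format, OF True, of "snd p"] p by force
          finally show ?thesis .
        next
          case False
          then have "u n p < e'" using p by (intro N[OF n]) (cases p, auto)
          also have "\<dots> \<le> e' * exp (\<gamma> * fst p)" using e'(1) \<gamma>(1) p by auto
          finally show ?thesis by simp
        qed
        then have "F b (u n) \<le> C * e'" by (rule Fbound[OF u(1) e'(1)])
        moreover have "0 \<le> F b (u n)" by (rule Fpos[OF u(1)]) (use u0 in blast)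
        ultimately show ?thesis using e'(2) by simp
      qed
      then show "\<exists>no. \<forall>n\<ge>no. norm (F b (u n) - 0) < e" by blast
    qed
  qed
  define m where "m b = daniell.repr (cyl \<Omega>) (C_wt \<gamma> \<Omega>) (F b)" for b
  have int_m: "(LINT p|m b. f p) = F b f" if "f \<in> C_wt \<gamma> \<Omega>" for b f
    unfolding m_def by (rule daniell.integral_repr(2)[OF dan that])
  have mM: "m b \<in> M_wt_nonneg \<gamma> \<Omega>" for b
    unfolding M_wt_nonneg_def mem_Collect_eq
  proof
    show "sets (m b) = sets (restrict_space borel (cyl \<Omega>))" unfolding m_def by (rule daniell.sets_repr[OF dan])
    \<comment> \<open>The weight itself is not in \<open>C_wt\<close>, since dividing it by itself
      does not tend to 0. Its truncations are bounded, hence in \<open>C_wt\<close>, and lie below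
      the weight with \<open>c = 1\<close>, so \<open>C\<close> bounds all their integrals.\<close>
    define g where "g n p = min (exp (\<gamma> * fst p)) (real n)" for n and p :: "real \<times> 'a"
    have g: "g n \<in> C_wt \<gamma> \<Omega>" for n
      unfolding g_def by (rule C_wt_bounded[OF \<gamma>(1), of _ _ "real n"]) (auto intro!: continuous_intros)
    have "(\<integral>\<^sup>+p. ennreal (g n p) \<partial>m b) \<le> ennreal C" for n
    proof -
      have "(\<integral>\<^sup>+p. ennreal (g n p) \<partial>m b) = ennreal (F b (g n))"
        unfolding m_def by (rule daniell.nn_integral_repr[OF dan g]) (simp add: g_def)
      also have "F b (g n) \<le> C * 1" by (rule Fbound[OF g]) (auto simp: g_def)
      finally show ?thesis by (simp add: ennreal_leI)
    qed
    moreover have "(\<lambda>n. \<integral>\<^sup>+p. ennreal (g n p) \<partial>m b) \<longlonglongrightarrow> (\<integral>\<^sup>+p. ennreal (exp (\<gamma> * fst p)) \<partial>m b)"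
    proof (rule nn_integral_LIMSEQ)
      show "incseq (\<lambda>n p. ennreal (g n p))"
        by (auto simp: incseq_def le_fun_def g_def intro!: ennreal_leI min.mono)
      have "g n \<in> borel_measurable (m b)" for n unfolding m_def by (rule daniell.measurable_repr[OF dan g])
      then show "(\<lambda>p. ennreal (g n p)) \<in> borel_measurable (m b)" for n by measurable
      fix p :: "real \<times> 'a"
      obtain N :: nat where "exp (\<gamma> * fst p) \<le> real N" using real_arch_simple by blast
      then have "\<forall>\<^sub>F n in sequentially. ennreal (g n p) = ennreal (exp (\<gamma> * fst p))"
        unfolding eventually_sequentially by (intro exI[of _ N]) (auto simp: min_def g_def)
      then show "(\<lambda>n. ennreal (g n p)) \<longlonglongrightarrow> ennreal (exp (\<gamma> * fst p))" by (rule tendsto_eventually)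
    qed
    ultimately have "(\<integral>\<^sup>+p. ennreal (exp (\<gamma> * fst p)) \<partial>m b) \<le> ennreal C"
      by (intro LIMSEQ_le_const2) auto
    then show "(\<integral>\<^sup>+p. ennreal (exp (\<gamma> * fst p)) \<partial>m b) < \<infinity>" by (simp add: order_le_less_trans)
  qed
  have F0: "F b f = 0" if "f \<in> C_wt \<gamma> \<Omega>" "\<And>p. p \<in> cyl \<Omega> \<Longrightarrow> f p = 0" for b f
  proof -
    have "F b f = F b (\<lambda>p. 0 * f p)"
      by (rule daniell.cong[OF dan that(1) C_wt_scale[OF that(1)]]) (use that(2) in simp)
    also have "\<dots> = 0" by (subst linear_functional_onD(2)[OF Flin that(1)]) simp
    finally show ?thesis .
  qed
  have Fcong: "F b f = F b g" if "f \<in> C_wt \<gamma> \<Omega>" "g \<in> C_wt \<gamma> \<Omega>" "\<And>p. p \<in> cyl \<Omega> \<Longrightarrow> f p = g p" for b f g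
    by (rule daniell.cong[OF dan that(1,2)]) (use that(3) in blast)
  have zero_int: "(LINT x:closure \<Omega>|M. (0::real)) = 0" for M :: "'a measure" by (simp add: set_lebesgue_integral_def)
  have c0: "continuous_on (closure \<Omega>) (\<lambda>_::'a. 0::real)" by simp
  \<comment> \<open>With \<open>J = 0\<close> and \<open>s = 0\<close> the identity
    \<open>key\<close> gives the marginal condition, with \<open>\<psi> = 0\<close> and
    \<open>s = 0\<close> the evolution equation. The component of the obstacle constraint yields the
    stopping measure \<open>\<rho>\<close>, that of the heat constraint the occupation measure
    \<open>\<eta>\<close>.\<close>
  have adm: "admissible \<gamma> \<Omega> \<mu> \<nu> (m False) (m True)"
    unfolding admissible_def
  proof (intro conjI allI impI ballI mM)
    fix u :: "'a \<Rightarrow> real" assume u: "continuous_on (closure \<Omega>) u"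
    note uC = C_wt_spatial[OF \<gamma>(1) \<Omega>(2) u]
    have "F True (\<lambda>p. (-1) * u (snd p)) = F True (\<lambda>p. 0 - u (snd p))" by simp
    also have "\<dots> = - dual_value u (\<lambda>_. 0)"
    proof -
      have "F False (\<lambda>p. heat (\<lambda>_. 0) p + 0 * L p) = 0"
        by (rule F0) (use zero_C12 in \<open>auto intro: C_wt_add C_wt_scale L(1) heat_C_wt\<close>)
      then show ?thesis using key[OF u zero_C12(1), of 0] by simp
    qed
    finally have "(-1) * F True (\<lambda>p. u (snd p)) = - (LINT x:closure \<Omega>|\<nu>. u x)"
      unfolding linear_functional_onD(2)[OF Flin uC] dual_value_def zero_int by simp
    then show "(LINT x:closure \<Omega>|\<nu>. u x) = (LINT p|m True. u (snd p))" using int_m[OF uC] by simp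
  next
    fix w assume w: "w \<in> C12_wt \<gamma> \<Omega>"
    note wC = C12_wt_in_C_wt[OF w \<gamma>(1)]
    have hC: "(\<lambda>p. dt w p + (1/2) * laplacian \<Omega> w p) \<in> C_wt \<gamma> \<Omega>" by (intro C_wt_add C_wt_scale wC)
    have "F True (\<lambda>p. w p - 0) + F False (\<lambda>p. heat w p + 0 * L p) = 0 * D - dual_value (\<lambda>_. 0) w"
      using key[OF c0 w, of 0] .
    moreover have "(\<lambda>p. heat w p + 0 * L p) = (\<lambda>p. (-1) * (dt w p + (1/2) * laplacian \<Omega> w p))"
      by (simp add: heat_def fun_eq_iff)
    ultimately have "F True w - F False (\<lambda>p. dt w p + (1/2) * laplacian \<Omega> w p) = (LINT y:closure \<Omega>|\<mu>. w (0, y))"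
      using linear_functional_onD(2)[OF Flin hC, of False "-1"] by (simp add: dual_value_def zero_int)
    then show "- (LINT y:closure \<Omega>|\<mu>. w (0, y)) =
      (LINT p|m False. dt w p + (1/2) * laplacian \<Omega> w p) - (LINT p|m True. w p)"
      unfolding int_m[OF hC] int_m[OF wC(1)] by simp
  qed
  \<comment> \<open>Here \<open>\<psi>\<close> and \<open>J\<close> vanish and \<open>s = 1\<close>,
    so the cost is the value prescribed for \<open>L\<close> in the graph.\<close>
  have "F False L = D"
  proof -
    have "F True (\<lambda>p. 0 - 0) = 0" by (rule F0) (use C_wt_bounded[OF \<gamma>(1), of \<Omega> "\<lambda>_. 0" 0] in auto)
    moreover have "F False (\<lambda>p. heat (\<lambda>_. 0) p + 1 * L p) = F False L"
      by (rule Fcong) (use zero_C12 L(1) in \<open>auto intro: C_wt_add heat_C_wt\<close>)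
    moreover have "dual_value (\<lambda>_. 0) (\<lambda>_. 0) = 0" by (simp add: dual_value_def zero_int)
    ultimately show ?thesis using key[OF c0 zero_C12(1), of 1] by simp
  qed
  then have "(LINT p|m False. L p) = D" using int_m[OF L(1)] by simp
  then have "P1 \<gamma> \<Omega> L \<mu> \<nu> \<le> ereal D" unfolding P1_def using adm by (intro Inf_lower) blast
  then show ?thesis by (simp add: D)
qed

end

theorem theorem2p3:
  fixes \<Omega> :: "'a::euclidean_space set"
    and \<mu> \<nu> :: "'a measure"
    and L :: "real \<times> 'a \<Rightarrow> real"
    and l \<gamma> :: real
  assumes "open \<Omega>" and "bounded \<Omega>" and "convex \<Omega>"
    and "is_poincare_constant \<Omega> l" and "0 < \<gamma>" and "\<gamma> < l"
    and "prob_space \<mu>" and "sets \<mu> = sets borel" and "closure (measure_support \<mu>) \<subseteq> \<Omega>"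
    and "prob_space \<nu>" and "sets \<nu> = sets borel" and "closure (measure_support \<nu>) \<subseteq> \<Omega>"
    and "L \<in> C_wt \<gamma> \<Omega>" and "\<forall>p\<in>cyl \<Omega>. 0 \<le> L p"
  shows "D1 \<gamma> \<Omega> L \<mu> \<nu> = P1 \<gamma> \<Omega> L \<mu> \<nu>"
proof -
  \<comment> \<open>On the empty set every function vanishes almost everywhere, so there would be no
    eigenfunction and no constant \<open>l\<close>.\<close>
  have "\<Omega> \<noteq> {}"
  proof
    assume "\<Omega> = {}"
    then have "AE x in lebesgue_on \<Omega>. u x = 0" for u :: "'a \<Rightarrow> real"
      by (intro AE_I2) (simp add: space_restrict_space)
    with assms(4) show False by (auto simp: is_poincare_constant_def dirichlet_eigenvalue_def)
  qed
  note A = assms(1-3) this assms(4-8,10,11,13,14)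
  show ?thesis
  proof (rule antisym)
    show "D1 \<gamma> \<Omega> L \<mu> \<nu> \<le> P1 \<gamma> \<Omega> L \<mu> \<nu>" by (rule weak_duality[OF A])
    show "P1 \<gamma> \<Omega> L \<mu> \<nu> \<le> D1 \<gamma> \<Omega> L \<mu> \<nu>"
      using strong_duality[OF A] by (cases "D1 \<gamma> \<Omega> L \<mu> \<nu> = \<infinity>") auto
  qed
qed

end
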